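(* Let $M$ be a compact oriented 2-dimensional manifold with boundary $\partial M$, and let $\mathbf{R}:M\to\mathbb{R}^3$ be a smooth immersion which can be parametrized by curvature line coordinates near each point. For constants $a,b,c\in\mathbb{R}$ define the functional $$E=\int_M(a\mathcal{H}+b)\,dA+cV,\qquad V=\frac13\int_M(\mathbf{R}\cdot\mathbf{N})\,dA .$$ Then for every smooth variation vector field $\mathbf{V}=\boldsymbol{\eta}+v_n\mathbf{N}$ along $\mathbf{R}$, with tangential component $\boldsymbol{\eta}$ and normal component $v_n=\mathbf{V}\cdot\mathbf{N}$, the first variation of $E$ under the deformation $\mathbf{r}=\mathbf{R}+t\mathbf{V}$ is $$\delta E=-\int_M(a\mathcal{K}+2b\mathcal{H}-c)\,v_n\,dA+\int_{\partial M}\left[a\left(\frac12\nabla v_n+\mathcal{H}\boldsymbol{\eta}\right)+b\boldsymbol{\eta}+\frac{c}{3}\big((\mathbf{R}\cdot\mathbf{N})\boldsymbol{\eta}-v_n\mathbf{R}\big)\right]\cdot\mathbf{t}\,ds,$$ where $\mathbf{t}$ is the outward-pointing unit conormal vector and $ds$ is the line element of $\partial M$. In particular, the equilibrium condition away from the boundary (that is, $\delta E=0$ for all smooth variation vector fields compactly supported in the interior of $M$) is the linear Weingarten condition $$a\mathcal{K}+2b\mathcal{H}=c$$ on the interior of $M$.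
   Context: Local coordinates $(\alpha,\beta)$ are curvature line coordinates if the first and second fundamental forms are both diagonal in them; they are taken compatible with the orientation. $\mathbf{N}$ is the unit normal $\mathbf{R}_\alpha\times\mathbf{R}_\beta/\|\mathbf{R}_\alpha\times\mathbf{R}_\beta\|$, where subscripts denote partial derivatives. The principal curvatures $\kappa_1,\kappa_2$ are defined by $\mathbf{N}_\alpha=-\kappa_1\mathbf{R}_\alpha$, $\mathbf{N}_\beta=-\kappa_2\mathbf{R}_\beta$; $\mathcal{H}=\frac12(\kappa_1+\kappa_2)$ is the mean curvature and $\mathcal{K}=\kappa_1\kappa_2$ the Gaussian curvature. The area element is $dA=\|\mathbf{R}_\alpha\times\mathbf{R}_\beta\|\,d\alpha\,d\beta$, and $\nabla$ is the surface gradient with respect to the induced metric. For a quantity $Q$ depending on the immersion, $\delta Q=\frac{d}{dt}\big|_{t=0}Q(\mathbf{r}_t)$, where $\mathbf{r}_t=\mathbf{R}+t\mathbf{V}$, $|t|\ll1$ (unit normal, mean curvature with the same sign convention, and area element are those of $\mathbf{r}_t$). The scalar $V$ (algebraic volume) is not to be confused with the vector field $\mathbf{V}$. The unit conormal $\mathbf{t}$ is tangent to the surface and orthogonal to the boundary curve. *)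

theory Defs
  imports "HOL-Analysis.Analysis"
begin

section \<open>Smooth maps between Euclidean spaces\<close>

text \<open>\<open>Ck_on k f T\<close> is meant for open \<open>T\<close> only: all iterated directional derivatives of order
  \<open>\<le> k\<close> exist and are continuous on \<open>T\<close>.\<close>

primrec Ck_on ::
  "nat \<Rightarrow> ('e::euclidean_space \<Rightarrow> 'f::real_normed_vector) \<Rightarrow> 'e set \<Rightarrow> bool" where
  "Ck_on 0 f T \<longleftrightarrow> continuous_on T f"
| "Ck_on (Suc k) f T \<longleftrightarrow>
     f differentiable_on T \<and> (\<forall>v. Ck_on k (\<lambda>x. frechet_derivative f (at x) v) T)"

text \<open>Smoothness on an arbitrary set, as usual for half-plane charts: near each point the function
  is the restriction of a \<open>C\<^sup>\<infinity>\<close> function on an open set.\<close>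

definition smooth_on ::
  "'e set \<Rightarrow> ('e::euclidean_space \<Rightarrow> 'f::real_normed_vector) \<Rightarrow> bool" where
  "smooth_on S f \<longleftrightarrow>
     (\<forall>x\<in>S. \<exists>T g. open T \<and> x \<in> T \<and> (\<forall>k. Ck_on k g T) \<and> (\<forall>y\<in>S \<inter> T. g y = f y))"


section \<open>Compact oriented surfaces with boundary\<close>

text \<open>A chart is a coordinate domain together with its coordinate map.\<close>

type_synonym 'a chart = "'a set \<times> ('a \<Rightarrow> real^2)"

definition half_plane :: "(real^2) set" where
  "half_plane = {x. 0 \<le> x $ 2}"

definition chart_image :: "'a chart \<Rightarrow> (real^2) set" where
  "chart_image c = snd c ` fst c"

definition chart_inv :: "'a chart \<Rightarrow> real^2 \<Rightarrow> 'a" where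
  "chart_inv c = inv_into (fst c) (snd c)"

definition coordinate_chart :: "'a topology \<Rightarrow> 'a chart \<Rightarrow> bool" where
  "coordinate_chart M c \<longleftrightarrow> openin M (fst c) \<and>
     homeomorphic_map (subtopology M (fst c)) (top_of_set (chart_image c)) (snd c)"

text \<open>The change of coordinates from \<open>c\<close> to \<open>d\<close> is smooth and orientation preserving.  The sets
  occurring here have enough tangent directions at every point (also at boundary points) for the
  derivative within the set to be unique.\<close>

definition oriented_transition :: "'a chart \<Rightarrow> 'a chart \<Rightarrow> bool" where
  "oriented_transition c d \<longleftrightarrow>
     (let W = snd c ` (fst c \<inter> fst d); \<tau> = snd d \<circ> chart_inv c
      in smooth_on W \<tau> \<and> (\<forall>x\<in>W. 0 < det (matrix (frechet_derivative \<tau> (at x within W)))))"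

definition compact_oriented_surface :: "'a topology \<Rightarrow> 'a chart set \<Rightarrow> bool" where
  "compact_oriented_surface M A \<longleftrightarrow>
     compact_space M \<and> Hausdorff_space M \<and> (\<Union>c\<in>A. fst c) = topspace M \<and>
     (\<forall>c\<in>A. coordinate_chart M c \<and> openin (top_of_set half_plane) (chart_image c)) \<and>
     (\<forall>c\<in>A. \<forall>d\<in>A. oriented_transition c d)"

definition surface_boundary :: "'a topology \<Rightarrow> 'a chart set \<Rightarrow> 'a set" where
  "surface_boundary M A = {p \<in> topspace M. \<exists>c\<in>A. p \<in> fst c \<and> snd c p $ 2 = 0}"

definition surface_interior :: "'a topology \<Rightarrow> 'a chart set \<Rightarrow> 'a set" where
  "surface_interior M A = topspace M - surface_boundary M A"

definition smooth_map :: "'a chart set \<Rightarrow> ('a \<Rightarrow> 'f::real_normed_vector) \<Rightarrow> bool" where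
  "smooth_map A f \<longleftrightarrow> (\<forall>c\<in>A. smooth_on (chart_image c) (f \<circ> chart_inv c))"

text \<open>The differential of \<open>f\<close> at \<open>p\<close> in the chart \<open>c\<close>; in particular \<open>coord_deriv c f p (axis i 1)\<close>
  is the partial derivative of \<open>f\<close> with respect to the \<open>i\<close>-th coordinate.\<close>

definition coord_deriv ::
  "'a chart \<Rightarrow> ('a \<Rightarrow> 'f::real_normed_vector) \<Rightarrow> 'a \<Rightarrow> real^2 \<Rightarrow> 'f" where
  "coord_deriv c f p =
     frechet_derivative (f \<circ> chart_inv c) (at (snd c p) within chart_image c)"

text \<open>Pointwise geometric quantities are computed in a chosen chart of the atlas around the point;
  those defined below do not depend on the choice.\<close>

definition chart_at :: "'a chart set \<Rightarrow> 'a \<Rightarrow> 'a chart" where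
  "chart_at A p = (SOME c. c \<in> A \<and> p \<in> fst c)"

abbreviation differential ::
  "'a chart set \<Rightarrow> ('a \<Rightarrow> 'f::real_normed_vector) \<Rightarrow> 'a \<Rightarrow> real^2 \<Rightarrow> 'f" where
  "differential A f p \<equiv> coord_deriv (chart_at A p) f p"


section \<open>Geometry of an immersion\<close>

definition smooth_immersion ::
  "'a topology \<Rightarrow> 'a chart set \<Rightarrow> ('a \<Rightarrow> real^3) \<Rightarrow> bool" where
  "smooth_immersion M A r \<longleftrightarrow> smooth_map A r \<and> (\<forall>p\<in>topspace M. inj (differential A r p))"

definition unit_normal :: "'a chart set \<Rightarrow> ('a \<Rightarrow> real^3) \<Rightarrow> 'a \<Rightarrow> real^3" where
  "unit_normal A r p =
     sgn (cross3 (differential A r p (axis 1 1)) (differential A r p (axis 2 1)))"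

definition first_form ::
  "'a chart \<Rightarrow> ('a \<Rightarrow> real^3) \<Rightarrow> 'a \<Rightarrow> real^2 \<Rightarrow> real^2 \<Rightarrow> real" where
  "first_form c r p u v = coord_deriv c r p u \<bullet> coord_deriv c r p v"

definition second_form ::
  "'a chart set \<Rightarrow> 'a chart \<Rightarrow> ('a \<Rightarrow> real^3) \<Rightarrow> 'a \<Rightarrow> real^2 \<Rightarrow> real^2 \<Rightarrow> real" where
  "second_form A c r p u v = - (coord_deriv c (unit_normal A r) p u \<bullet> coord_deriv c r p v)"

definition diagonal_form :: "(real^2 \<Rightarrow> real^2 \<Rightarrow> real) \<Rightarrow> bool" where
  "diagonal_form B \<longleftrightarrow> (\<forall>i j. i \<noteq> j \<longrightarrow> B (axis i 1) (axis j 1) = 0)"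

text \<open>Curvature line coordinates are arbitrary positively oriented smooth coordinates.  Near a
  boundary point they need not map into the half-plane, because the boundary need not be a
  curvature line.\<close>

definition curvature_line_coordinates ::
  "'a topology \<Rightarrow> 'a chart set \<Rightarrow> ('a \<Rightarrow> real^3) \<Rightarrow> 'a chart \<Rightarrow> bool" where
  "curvature_line_coordinates M A r x \<longleftrightarrow>
     coordinate_chart M x \<and> (\<forall>c\<in>A. oriented_transition c x) \<and>
     (\<forall>p\<in>fst x. diagonal_form (first_form x r p) \<and> diagonal_form (second_form A x r p))"

definition has_curvature_line_coordinates ::
  "'a topology \<Rightarrow> 'a chart set \<Rightarrow> ('a \<Rightarrow> real^3) \<Rightarrow> bool" where
  "has_curvature_line_coordinates M A r \<longleftrightarrow>
     (\<forall>p\<in>topspace M. \<exists>x. p \<in> fst x \<and> curvature_line_coordinates M A r x)"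

text \<open>In curvature line coordinates \<open>(\<alpha>, \<beta>)\<close> the directions \<open>u\<^sub>1, u\<^sub>2\<close> below can be taken to be
  \<open>\<partial>\<^sub>\<alpha>, \<partial>\<^sub>\<beta>\<close>, and the equations become \<open>N\<^sub>\<alpha> = - \<kappa>\<^sub>1 R\<^sub>\<alpha>\<close>, \<open>N\<^sub>\<beta> = - \<kappa>\<^sub>2 R\<^sub>\<beta>\<close>.  The pointwise form
  is used because a perturbed immersion \<open>R + t V\<close> need not admit curvature line coordinates.
  The pair \<open>\<kappa>\<^sub>1, \<kappa>\<^sub>2\<close> is unique up to order, so the symmetric expressions below are well defined.\<close>

definition principal_curvatures ::
  "'a chart set \<Rightarrow> ('a \<Rightarrow> real^3) \<Rightarrow> 'a \<Rightarrow> real \<Rightarrow> real \<Rightarrow> bool" where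
  "principal_curvatures A r p \<kappa>1 \<kappa>2 \<longleftrightarrow>
     (\<exists>u1 u2. u1 \<noteq> u2 \<and> independent {u1, u2} \<and>
        differential A (unit_normal A r) p u1 = - \<kappa>1 *\<^sub>R differential A r p u1 \<and>
        differential A (unit_normal A r) p u2 = - \<kappa>2 *\<^sub>R differential A r p u2)"

definition mean_curvature :: "'a chart set \<Rightarrow> ('a \<Rightarrow> real^3) \<Rightarrow> 'a \<Rightarrow> real" where
  "mean_curvature A r p =
     (THE h. \<exists>\<kappa>1 \<kappa>2. principal_curvatures A r p \<kappa>1 \<kappa>2 \<and> h = (\<kappa>1 + \<kappa>2) / 2)"

definition gauss_curvature :: "'a chart set \<Rightarrow> ('a \<Rightarrow> real^3) \<Rightarrow> 'a \<Rightarrow> real" where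
  "gauss_curvature A r p =
     (THE k. \<exists>\<kappa>1 \<kappa>2. principal_curvatures A r p \<kappa>1 \<kappa>2 \<and> k = \<kappa>1 * \<kappa>2)"

text \<open>The gradient for the induced metric, viewed as a vector of \<open>\<real>\<^sup>3\<close> tangent to the
  immersed surface.\<close>

definition surface_gradient ::
  "'a chart set \<Rightarrow> ('a \<Rightarrow> real^3) \<Rightarrow> ('a \<Rightarrow> real) \<Rightarrow> 'a \<Rightarrow> real^3" where
  "surface_gradient A r f p =
     (THE w. w \<in> range (differential A r p) \<and>
             (\<forall>u. w \<bullet> differential A r p u = differential A f p u))"

text \<open>At boundary points, \<open>axis 1 1\<close> spans the tangent line of the boundary in a half-plane chart,
  and the outward pointing directions are those with negative second coordinate.\<close>

definition outward_conormal :: "'a chart set \<Rightarrow> ('a \<Rightarrow> real^3) \<Rightarrow> 'a \<Rightarrow> real^3" where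
  "outward_conormal A r p =
     (THE n. norm n = 1 \<and> n \<bullet> differential A r p (axis 1 1) = 0 \<and>
             (\<exists>u. u $ 2 < 0 \<and> n = differential A r p u))"

definition normal_part :: "'a chart set \<Rightarrow> ('a \<Rightarrow> real^3) \<Rightarrow> ('a \<Rightarrow> real^3) \<Rightarrow> 'a \<Rightarrow> real" where
  "normal_part A r V p = V p \<bullet> unit_normal A r p"

definition tangential_part ::
  "'a chart set \<Rightarrow> ('a \<Rightarrow> real^3) \<Rightarrow> ('a \<Rightarrow> real^3) \<Rightarrow> 'a \<Rightarrow> real^3" where
  "tangential_part A r V p = V p - normal_part A r V p *\<^sub>R unit_normal A r p"


section \<open>Integration over the surface and over its boundary\<close>

definition partition_of_unity ::
  "'a topology \<Rightarrow> 'a chart set \<Rightarrow> nat \<Rightarrow> (nat \<Rightarrow> 'a chart) \<Rightarrow> (nat \<Rightarrow> 'a \<Rightarrow> real) \<Rightarrow> bool" where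
  "partition_of_unity M A n c \<rho> \<longleftrightarrow>
     (\<forall>i<n. c i \<in> A \<and> smooth_map A (\<rho> i) \<and> (\<forall>p\<in>topspace M. 0 \<le> \<rho> i p) \<and>
        M closure_of {p \<in> topspace M. \<rho> i p \<noteq> 0} \<subseteq> fst (c i)) \<and>
     (\<forall>p\<in>topspace M. (\<Sum>i<n. \<rho> i p) = 1)"

definition some_partition ::
  "'a topology \<Rightarrow> 'a chart set \<Rightarrow> nat \<times> (nat \<Rightarrow> 'a chart) \<times> (nat \<Rightarrow> 'a \<Rightarrow> real)" where
  "some_partition M A = (SOME (n, c, \<rho>). partition_of_unity M A n c \<rho>)"

text \<open>The integral of \<open>f\<close> with respect to the area element of \<open>r\<close>, and of \<open>f\<close> over the boundary
  with respect to the line element of \<open>r\<close>.  Neither depends on the partition of unity chosen.\<close>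

definition surface_integral ::
  "'a topology \<Rightarrow> 'a chart set \<Rightarrow> ('a \<Rightarrow> real^3) \<Rightarrow> ('a \<Rightarrow> real) \<Rightarrow> real" where
  "surface_integral M A r f =
     (case some_partition M A of (n, c, \<rho>) \<Rightarrow>
        \<Sum>i<n. integral (chart_image (c i)) (\<lambda>x. let p = chart_inv (c i) x in
          \<rho> i p * f p *
          norm (cross3 (coord_deriv (c i) r p (axis 1 1)) (coord_deriv (c i) r p (axis 2 1)))))"

definition boundary_integral ::
  "'a topology \<Rightarrow> 'a chart set \<Rightarrow> ('a \<Rightarrow> real^3) \<Rightarrow> ('a \<Rightarrow> real) \<Rightarrow> real" where
  "boundary_integral M A r f =
     (case some_partition M A of (n, c, \<rho>) \<Rightarrow>
        \<Sum>i<n. integral {s::real. vector [s, 0] \<in> chart_image (c i)}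
          (\<lambda>s. let p = chart_inv (c i) (vector [s, 0]) in
            \<rho> i p * f p * norm (coord_deriv (c i) r p (axis 1 1))))"


section \<open>The functional\<close>

definition algebraic_volume :: "'a topology \<Rightarrow> 'a chart set \<Rightarrow> ('a \<Rightarrow> real^3) \<Rightarrow> real" where
  "algebraic_volume M A r = 1 / 3 * surface_integral M A r (\<lambda>p. r p \<bullet> unit_normal A r p)"

definition energy ::
  "'a topology \<Rightarrow> 'a chart set \<Rightarrow> real \<Rightarrow> real \<Rightarrow> real \<Rightarrow> ('a \<Rightarrow> real^3) \<Rightarrow> real" where
  "energy M A a b c r =
     surface_integral M A r (\<lambda>p. a * mean_curvature A r p + b) + c * algebraic_volume M A r"

text \<open>\<open>has_first_variation Q R V D\<close>: the derivative at \<open>t = 0\<close> of \<open>Q (R + t V)\<close> exists and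
  equals \<open>D\<close>.\<close>

definition has_first_variation ::
  "(('a \<Rightarrow> real^3) \<Rightarrow> real) \<Rightarrow> ('a \<Rightarrow> real^3) \<Rightarrow> ('a \<Rightarrow> real^3) \<Rightarrow> real \<Rightarrow> bool" where
  "has_first_variation Q R V D \<longleftrightarrow>
     ((\<lambda>t. Q (\<lambda>p. R p + t *\<^sub>R V p)) has_real_derivative D) (at 0)"

definition compactly_supported_in ::
  "'a topology \<Rightarrow> ('a \<Rightarrow> 'f::real_normed_vector) \<Rightarrow> 'a set \<Rightarrow> bool" where
  "compactly_supported_in M f U \<longleftrightarrow>
     (\<exists>K. compactin M K \<and> K \<subseteq> U \<and> (\<forall>p\<in>topspace M - K. f p = 0))"

end

theory Submission
  imports Defs
begin

text \<open>In positively oriented coordinates \<open>(x\<^sub>1, x\<^sub>2)\<close> write \<open>r\<^sub>i, N\<^sub>i\<close> for the partial derivatives of the immersion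
  and of its normal and \<open>J = |r\<^sub>1 \<times> r\<^sub>2|\<close>.  The densities of the functional are triple products:
  \<open>J = N \<cdot> (r\<^sub>1 \<times> r\<^sub>2)\<close>, \<open>2 H J = - N \<cdot> (N\<^sub>1 \<times> r\<^sub>2 + r\<^sub>1 \<times> N\<^sub>2)\<close>, \<open>K J = N \<cdot> (N\<^sub>1 \<times> N\<^sub>2)\<close>.  Let \<open>W = \<delta>N\<close>, which is
  orthogonal to \<open>N\<close>.  Since the variation commutes with the partial derivatives, the product rule gives,
  without solving for \<open>W\<close>,
  \<open>\<delta>(density) = - (a K + 2 b H - c) v J + dF \<and> dR + dG \<and> dN\<close> with
  \<open>F = b N \<times> V + (c/3) R \<times> V - (a/2) N \<times> W\<close> and \<open>G = - (a/2) N \<times> V\<close>.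

  As \<open>F\<close> and \<open>G\<close> are globally defined smooth maps, Stokes' theorem turns the exact part into the boundary
  integral of \<open>F \<cdot> dR + G \<cdot> dN\<close>.  Only there \<open>W\<close> is expressed by \<open>\<nabla>v\<close> and \<open>\<eta>\<close>, using the identity
  \<open>S T + T S = (tr S) T\<close> for the shape operator \<open>S\<close> and the rotation \<open>T\<close> by a right angle.  The
  equilibrium condition follows by testing with \<open>V = \<phi> N\<close> for a bump function \<open>\<phi>\<close>.\<close>


section \<open>Iterated directional derivatives\<close>

text \<open>\<open>F\<close> and \<open>G\<close> arise by moving the derivatives off
  \<open>V\<close> and \<open>W\<close>:
  \<open>N \<bullet> (V_1 \<times> r_2 + r_1 \<times> V_2)\<close> equals
  \<open>d(N \<times> V) \<and> dR\<close> plus the remainder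
  \<open>V \<bullet> (N_1 \<times> r_2 + r_1 \<times> N_2)\<close>, and similarly with
  \<open>R\<close> in place of \<open>N\<close> or \<open>dN\<close> in place of \<open>dR\<close>.
  The remainders for \<open>V\<close> are the curvature terms; the remainder for \<open>W\<close> is
  a multiple of \<open>W \<bullet> N = 0\<close>, which is why the interior formula is free of
  \<open>W\<close>. Two obstacles shape the rest. The integrals are built from a partition of unity,
  so Stokes' theorem in a single chart leaves a term with the differential of a partition function;
  these terms cancel only in the sum, and only after a change of variables between charts. Moreover
  the densities are smooth in \<open>t\<close> only where \<open>R + t V\<close> is still an
  immersion; on the compact support of each partition function the tube lemma supplies an interval
  of times around 0. At boundary points all derivatives are taken within the half-plane and are
  handled through local smooth extensions.\<close>

lemma Ck_on_Suc_has_derivative: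
  assumes "Ck_on (Suc k) f T" "open T" "x \<in> T"
  shows "(f has_derivative frechet_derivative f (at x)) (at x)"
proof -
  have "f differentiable (at x within T)" using assms(1,3) by (simp add: differentiable_on_def)
  then have "f differentiable (at x)" using at_within_open[OF assms(3,2)] by simp
  then show ?thesis by (simp only: frechet_derivative_works)
qed

text \<open>Since \<open>T\<close> is open, the derivative at a point of \<open>T\<close> only sees
  values on \<open>T\<close>, so agreement there passes to every iterated derivative.\<close>

lemma Ck_on_cong:
  assumes "open T" "Ck_on k f T" "\<And>x. x \<in> T \<Longrightarrow> f x = g x"
  shows "Ck_on k g T"
  using assms(2,3)
proof (induction k arbitrary: f g)
  case 0
  then show ?case using continuous_on_cong by force
next
  case (Suc k)
  have fd: "(g has_derivative frechet_derivative f (at x)) (at x)" if "x \<in> T" for x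
    using Ck_on_Suc_has_derivative[OF Suc.prems(1) assms(1) that] Suc.prems(2) assms(1) that
    by (metis has_derivative_transform_within_open)
  have "g differentiable_on T"
    using fd by (meson differentiable_at_withinI differentiable_def differentiable_on_def)
  moreover have "Ck_on k (\<lambda>x. frechet_derivative g (at x) v) T" for v
    by (rule Suc.IH[of "\<lambda>x. frechet_derivative f (at x) v"])
      (use Suc.prems frechet_derivative_at[OF fd] in auto)
  ultimately show ?case by simp
qed

text \<open>Allows any explicitly computed derivative \<open>f'\<close> in place of the chosen
  \<open>frechet_derivative\<close>; the inductions below take their derivatives from the usual
  rules.\<close>

lemma Ck_onI:
  assumes "open T" and d: "\<And>x. x \<in> T \<Longrightarrow> (f has_derivative f' x) (at x)"
    and c: "\<And>v. Ck_on k (\<lambda>x. f' x v) T"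
  shows "Ck_on (Suc k) f T"
proof -
  have "f differentiable_on T"
    using d by (meson differentiable_at_withinI differentiable_def differentiable_on_def)
  moreover have "Ck_on k (\<lambda>x. frechet_derivative f (at x) v) T" for v
  proof (rule Ck_on_cong[OF assms(1) c[of v]])
    show "f' x v = frechet_derivative f (at x) v" if "x \<in> T" for x
      by (rule fun_cong[OF frechet_derivative_at[OF d[OF that]]])
  qed
  ultimately show ?thesis by simp
qed

lemma Ck_on_Suc_imp:
  assumes "Ck_on (Suc k) f T" "open T"
  shows "Ck_on k f T"
  using assms
proof (induction k arbitrary: f)
  case 0
  then show ?case using differentiable_imp_continuous_on by auto
next
  case (Suc k)
  then show ?case by simp
qed

lemma Ck_on_open_subset:
  assumes "Ck_on k f T" "open T" "T' \<subseteq> T" "open T'"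
  shows "Ck_on k f T'"
  using assms
proof (induction k arbitrary: f)
  case 0
  then show ?case using continuous_on_subset by auto
next
  case (Suc k)
  then show ?case using differentiable_on_subset by auto
qed

lemma Ck_on_const: "open T \<Longrightarrow> Ck_on k (\<lambda>x. c) T"
proof (induction k arbitrary: c)
  case (Suc k)
  show ?case
    by (rule Ck_onI[where f' = "\<lambda>x v. 0"]) (use Suc in auto)
qed auto

lemma Ck_on_add:
  assumes "open T" "Ck_on k f T" "Ck_on k g T"
  shows "Ck_on k (\<lambda>x. f x + g x) T"
  using assms(2,3)
proof (induction k arbitrary: f g)
  case 0
  then show ?case by (auto intro: continuous_on_add)
next
  case (Suc k)
  show ?case
  proof (rule Ck_onI[OF assms(1)])
    show "((\<lambda>x. f x + g x) has_derivative
        (\<lambda>v. frechet_derivative f (at x) v + frechet_derivative g (at x) v)) (at x)" if "x \<in> T" for x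
      by (intro has_derivative_add Ck_on_Suc_has_derivative[OF _ assms(1) that]) (use Suc in auto)
  qed (use Suc in auto)
qed

text \<open>Both summands of the product rule are again values of \<open>B\<close> with one factor
  differentiated, so the induction closes with \<open>f\<close> and \<open>g\<close> arbitrary. One
  statement covers products, scalar multiples, inner products and cross products.\<close>

lemma Ck_on_bounded_bilinear:
  assumes B: "bounded_bilinear B" and T: "open T" and "Ck_on k f T" "Ck_on k g T"
  shows "Ck_on k (\<lambda>x. B (f x) (g x)) T"
  using assms(3,4)
proof (induction k arbitrary: f g)
  case 0
  then show ?case using bounded_bilinear.continuous_on[OF B] by auto
next
  case (Suc k)
  show ?case
  proof (rule Ck_onI[OF T])
    show "((\<lambda>x. B (f x) (g x)) has_derivative
        (\<lambda>v. B (f x) (frechet_derivative g (at x) v) + B (frechet_derivative f (at x) v) (g x))) (at x)"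
      if "x \<in> T" for x
      by (intro bounded_bilinear.FDERIV[OF B] Ck_on_Suc_has_derivative[OF _ T that]) (use Suc in auto)
    show "Ck_on k (\<lambda>x. B (f x) (frechet_derivative g (at x) v) + B (frechet_derivative f (at x) v) (g x)) T" for v
      by (intro Ck_on_add[OF T] Suc.IH) (use Suc.prems Ck_on_Suc_imp[OF _ T] in auto)
  qed
qed

lemma Ck_on_bounded_linear:
  assumes L: "bounded_linear L" and T: "open T" and "Ck_on k f T"
  shows "Ck_on k (\<lambda>x. L (f x)) T"
  using assms(3)
proof (induction k arbitrary: f)
  case 0
  then show ?case using bounded_linear.continuous_on[OF L] by auto
next
  case (Suc k)
  show ?case
  proof (rule Ck_onI[OF T])
    show "((\<lambda>x. L (f x)) has_derivative (\<lambda>v. L (frechet_derivative f (at x) v))) (at x)"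
      if "x \<in> T" for x
      by (intro bounded_linear.has_derivative[OF L] Ck_on_Suc_has_derivative[OF _ T that]) (use Suc in auto)
  qed (use Suc in auto)
qed

lemma Ck_on_id: "open T \<Longrightarrow> Ck_on k (\<lambda>x. x) T"
proof (induction k)
  case (Suc k)
  show ?case
    by (rule Ck_onI[where f' = "\<lambda>x v. v"]) (use Suc in \<open>auto intro: Ck_on_const\<close>)
qed auto

lemma Ck_on_sum:
  assumes "open T" "\<And>i. i \<in> I \<Longrightarrow> Ck_on k (f i) T"
  shows "Ck_on k (\<lambda>x. \<Sum>i\<in>I. f i x) T"
  using assms(2)
proof (induction I rule: infinite_finite_induct)
  case (insert i I)
  then show ?case using Ck_on_add[OF assms(1)] by auto
qed (auto simp: Ck_on_const assms(1))

text \<open>In the chain rule \<open>x\<close> enters \<open>g' (f x) (f' x v)\<close> both through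
  the base point and through the direction, whereas the induction hypothesis concerns a fixed
  direction. Expanding \<open>f' x v\<close> in the standard basis separates the two
  dependences.\<close>

lemma Ck_on_compose:
  fixes f :: "'e::euclidean_space \<Rightarrow> 'h::euclidean_space" and g :: "'h \<Rightarrow> 'f::real_normed_vector"
  assumes T: "open T" "open T'" "f ` T \<subseteq> T'" and "Ck_on k f T" "Ck_on k g T'"
  shows "Ck_on k (\<lambda>x. g (f x)) T"
  using assms(4,5)
proof (induction k arbitrary: g)
  case 0
  then show ?case using T continuous_on_compose2 by auto
next
  case (Suc k)
  let ?f' = "\<lambda>x. frechet_derivative f (at x)" and ?g' = "\<lambda>x. frechet_derivative g (at x)"
  have dg: "(g has_derivative ?g' y) (at y)" if "y \<in> T'" for y
    using Ck_on_Suc_has_derivative[OF _ T(2) that] Suc.prems by blast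
  show ?case
  proof (rule Ck_onI[OF T(1)])
    fix x assume x: "x \<in> T"
    have "((\<lambda>x. g (f x)) has_derivative (\<lambda>v. ?g' (f x) (?f' x v))) (at x)"
      by (rule has_derivative_compose[OF Ck_on_Suc_has_derivative[OF _ T(1) x] dg])
        (use x T Suc in auto)
    moreover have *: "?g' (f x) w = (\<Sum>b\<in>Basis. (w \<bullet> b) *\<^sub>R ?g' (f x) b)" for w
    proof -
      have l: "linear (?g' (f x))" by (rule has_derivative_linear[OF dg]) (use x T in auto)
      have "?g' (f x) w = ?g' (f x) (\<Sum>b\<in>Basis. (w \<bullet> b) *\<^sub>R b)"
        by (simp only: euclidean_representation)
      also have "\<dots> = (\<Sum>b\<in>Basis. ?g' (f x) ((w \<bullet> b) *\<^sub>R b))" by (rule linear_sum[OF l])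
      also have "\<dots> = (\<Sum>b\<in>Basis. (w \<bullet> b) *\<^sub>R ?g' (f x) b)" by (simp only: linear_cmul[OF l])
      finally show ?thesis .
    qed
    ultimately show "((\<lambda>x. g (f x)) has_derivative (\<lambda>v. \<Sum>b\<in>Basis. (?f' x v \<bullet> b) *\<^sub>R ?g' (f x) b)) (at x)"
      using has_derivative_eq_rhs[OF _ ext[OF *]] by blast
  next
    fix v
    show "Ck_on k (\<lambda>x. \<Sum>b\<in>Basis. (?f' x v \<bullet> b) *\<^sub>R ?g' (f x) b) T"
      by (intro Ck_on_sum[OF T(1)] Ck_on_bounded_bilinear[OF bounded_bilinear_scaleR T(1)]
          Ck_on_bounded_linear[OF bounded_linear_inner_left T(1)] Suc.IH)
        (use Suc.prems Ck_on_Suc_imp[OF _ T(1)] in auto)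
  qed
qed

text \<open>The derivative of \<open>1 / f\<close> contains \<open>1 / f\<close> itself, to the
  order that the induction hypothesis provides; only \<open>f\<close> is differentiated further,
  hence the assumption on \<open>f\<close> for all \<open>k\<close>.\<close>

lemma Ck_on_inverse:
  fixes f :: "'e::euclidean_space \<Rightarrow> real"
  assumes T: "open T" and f: "\<And>k. Ck_on k f T" "\<And>x. x \<in> T \<Longrightarrow> f x \<noteq> 0"
  shows "Ck_on k (\<lambda>x. inverse (f x)) T"
proof (induction k)
  case 0
  then show ?case using f(1)[of 0] f(2) by (auto intro: continuous_on_inverse)
next
  case (Suc k)
  let ?f' = "\<lambda>x. frechet_derivative f (at x)"
  show ?case
  proof (rule Ck_onI[OF T])
    show "((\<lambda>x. inverse (f x)) has_derivative (\<lambda>v. - 1 * ((inverse (f x) * ?f' x v) * inverse (f x)))) (at x)"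
      if "x \<in> T" for x
      using Deriv.has_derivative_inverse[OF f(2)[OF that] Ck_on_Suc_has_derivative[OF f(1)[of 1, simplified One_nat_def] T that]]
      by simp
    show "Ck_on k (\<lambda>x. - 1 * ((inverse (f x) * ?f' x v) * inverse (f x))) T" for v
      by (intro Ck_on_bounded_bilinear[OF bounded_bilinear_mult T] Ck_on_const[OF T] Suc)
        (use f(1)[of "Suc k"] in auto)
  qed
qed

text \<open>The derivative is written as \<open>f' * (sqrt f / f) / 2\<close> and not with
  \<open>1 / sqrt f\<close>: in this form it is a product of \<open>sqrt f\<close>, given by the
  induction, and of \<open>1 / f\<close>, already known to be smooth.\<close>

lemma Ck_on_sqrt:
  fixes f :: "'e::euclidean_space \<Rightarrow> real"
  assumes T: "open T" and f: "\<And>k. Ck_on k f T" "\<And>x. x \<in> T \<Longrightarrow> 0 < f x"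
  shows "Ck_on k (\<lambda>x. sqrt (f x)) T"
proof -
  have sq: "Ck_on k (\<lambda>x. inverse (f x) * sqrt (f x)) T" if "Ck_on k (\<lambda>x. sqrt (f x)) T" for k
    by (intro Ck_on_bounded_bilinear[OF bounded_bilinear_mult T] that Ck_on_inverse T f)
      (use f(2) in force)
  show ?thesis
  proof (induction k)
    case 0
    then show ?case using f(1)[of 0] by (auto intro: continuous_on_real_sqrt)
  next
    case (Suc k)
    let ?f' = "\<lambda>x. frechet_derivative f (at x)"
    show ?case
    proof (rule Ck_onI[OF T])
      fix x assume x: "x \<in> T"
      have "((\<lambda>x. sqrt (f x)) has_derivative (\<lambda>v. ?f' x v * (inverse (sqrt (f x)) / 2))) (at x)"
        by (rule has_derivative_real_sqrt[OF f(2)[OF x] Ck_on_Suc_has_derivative[OF f(1)[of 1, simplified One_nat_def] T x]])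
      moreover have "inverse (sqrt (f x)) = inverse (f x) * sqrt (f x)"
        using f(2)[OF x] by (simp add: field_simps)
      ultimately show "((\<lambda>x. sqrt (f x)) has_derivative
          (\<lambda>v. ?f' x v * ((inverse (f x) * sqrt (f x)) * (1/2)))) (at x)"
        by simp
    next
      show "Ck_on k (\<lambda>x. ?f' x v * ((inverse (f x) * sqrt (f x)) * (1/2))) T" for v
        by (intro Ck_on_bounded_bilinear[OF bounded_bilinear_mult T] Ck_on_const[OF T] sq Suc.IH)
          (use f(1)[of "Suc k"] in auto)
    qed
  qed
qed

section \<open>Symmetry of mixed derivatives\<close>

text \<open>Two applications of the mean value theorem to the second difference over the
  parallelogram spanned by \<open>h u\<close> and \<open>h v\<close>: along \<open>u\<close> for the
  difference in direction \<open>v\<close>, then along \<open>v\<close> for the derivative in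
  direction \<open>u\<close>.\<close>

lemma Ck_on_mixed_mean_value:
  fixes g :: "'e::euclidean_space \<Rightarrow> real"
  assumes T: "open T" and g: "Ck_on (Suc (Suc 0)) g T" and h: "0 < h"
    and sub: "\<And>s t. 0 \<le> s \<Longrightarrow> s \<le> h \<Longrightarrow> 0 \<le> t \<Longrightarrow> t \<le> h \<Longrightarrow> x + s *\<^sub>R u + t *\<^sub>R v \<in> T"
  shows "\<exists>s t. 0 \<le> s \<and> s \<le> h \<and> 0 \<le> t \<and> t \<le> h \<and>
    g (x + h *\<^sub>R u + h *\<^sub>R v) - g (x + h *\<^sub>R u) - g (x + h *\<^sub>R v) + g x =
    h * (h * frechet_derivative (\<lambda>y. frechet_derivative g (at y) u) (at (x + s *\<^sub>R u + t *\<^sub>R v)) v)"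
proof -
  let ?gu = "\<lambda>y. frechet_derivative g (at y) u"
  let ?guv = "\<lambda>y. frechet_derivative ?gu (at y) v"
  have d1: "(g has_derivative frechet_derivative g (at y)) (at y)" if "y \<in> T" for y
    by (rule Ck_on_Suc_has_derivative[OF g T that])
  have d2: "(?gu has_derivative frechet_derivative ?gu (at y)) (at y)" if "y \<in> T" for y
    by (rule Ck_on_Suc_has_derivative[of 0, OF _ T that]) (use g in auto)
  have D1: "((\<lambda>s. g (x + s *\<^sub>R u + t *\<^sub>R v)) has_field_derivative ?gu (x + s *\<^sub>R u + t *\<^sub>R v)) (at s)"
    if "0 \<le> s" "s \<le> h" "0 \<le> t" "t \<le> h" for s t
  proof -
    let ?y = "x + s *\<^sub>R u + t *\<^sub>R v"
    have "((\<lambda>s. x + s *\<^sub>R u + t *\<^sub>R v) has_derivative (\<lambda>k. k *\<^sub>R u)) (at s)"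
      by (auto intro!: derivative_eq_intros)
    from has_derivative_compose[OF this d1[OF sub[OF that]]]
    have "((\<lambda>s. g (x + s *\<^sub>R u + t *\<^sub>R v)) has_derivative (\<lambda>k. frechet_derivative g (at ?y) (k *\<^sub>R u))) (at s)" .
    then show ?thesis
      unfolding has_field_derivative_def
      using has_derivative_linear[OF d1[OF sub[OF that]]]
      by (simp add: linear_cmul mult.commute[of _ "?gu ?y"])
  qed
  have D2: "((\<lambda>t. ?gu (x + s *\<^sub>R u + t *\<^sub>R v)) has_field_derivative ?guv (x + s *\<^sub>R u + t *\<^sub>R v)) (at t)"
    if "0 \<le> s" "s \<le> h" "0 \<le> t" "t \<le> h" for s t
  proof -
    let ?y = "x + s *\<^sub>R u + t *\<^sub>R v"
    have "((\<lambda>t. x + s *\<^sub>R u + t *\<^sub>R v) has_derivative (\<lambda>k. k *\<^sub>R v)) (at t)"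
      by (auto intro!: derivative_eq_intros)
    from has_derivative_compose[OF this d2[OF sub[OF that]]]
    have "((\<lambda>t. ?gu (x + s *\<^sub>R u + t *\<^sub>R v)) has_derivative (\<lambda>k. frechet_derivative ?gu (at ?y) (k *\<^sub>R v))) (at t)" .
    then show ?thesis
      unfolding has_field_derivative_def
      using has_derivative_linear[OF d2[OF sub[OF that]]]
      by (simp add: linear_cmul mult.commute[of _ "?guv ?y"])
  qed
  have "\<exists>s>0. s < h \<and> (g (x + h *\<^sub>R u + h *\<^sub>R v) - g (x + h *\<^sub>R u + 0 *\<^sub>R v))
      - (g (x + 0 *\<^sub>R u + h *\<^sub>R v) - g (x + 0 *\<^sub>R u + 0 *\<^sub>R v))
      = (h - 0) * (?gu (x + s *\<^sub>R u + h *\<^sub>R v) - ?gu (x + s *\<^sub>R u + 0 *\<^sub>R v))"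
    by (rule MVT2[OF h, where f = "\<lambda>s. g (x + s *\<^sub>R u + h *\<^sub>R v) - g (x + s *\<^sub>R u + 0 *\<^sub>R v)"])
      (intro DERIV_diff D1; use h in auto)
  then obtain s where s: "0 < s" "s < h" "(g (x + h *\<^sub>R u + h *\<^sub>R v) - g (x + h *\<^sub>R u))
      - (g (x + h *\<^sub>R v) - g x) = h * (?gu (x + s *\<^sub>R u + h *\<^sub>R v) - ?gu (x + s *\<^sub>R u + 0 *\<^sub>R v))"
    by auto
  have "\<exists>t>0. t < h \<and> ?gu (x + s *\<^sub>R u + h *\<^sub>R v) - ?gu (x + s *\<^sub>R u + 0 *\<^sub>R v)
      = (h - 0) * ?guv (x + s *\<^sub>R u + t *\<^sub>R v)"
    by (rule MVT2[OF h, where f = "\<lambda>t. ?gu (x + s *\<^sub>R u + t *\<^sub>R v)"]) (intro D2; use s in auto)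
  then obtain t where "0 < t" "t < h" "?gu (x + s *\<^sub>R u + h *\<^sub>R v) - ?gu (x + s *\<^sub>R u + 0 *\<^sub>R v)
      = h * ?guv (x + s *\<^sub>R u + t *\<^sub>R v)" by auto
  then show ?thesis using s
    by (intro exI[of _ s] exI[of _ t]) (simp add: algebra_simps)
qed

text \<open>The second difference is symmetric in \<open>u\<close> and \<open>v\<close>, so the two
  mixed derivatives take equal values at suitable points of arbitrarily small parallelograms at
  \<open>x\<close>; continuity carries the equality to \<open>x\<close>.\<close>

lemma Ck_on_mixed_commute_real:
  fixes g :: "'e::euclidean_space \<Rightarrow> real"
  assumes T: "open T" "x \<in> T" and g: "Ck_on (Suc (Suc 0)) g T"
  shows "frechet_derivative (\<lambda>y. frechet_derivative g (at y) u) (at x) v =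
    frechet_derivative (\<lambda>y. frechet_derivative g (at y) v) (at x) u"
proof -
  define D where "D u v y = frechet_derivative (\<lambda>y. frechet_derivative g (at y) u) (at y) v" for u v y
  have cont: "isCont (D u v) x" for u v
    using g T unfolding D_def by (auto simp: continuous_on_eq_continuous_at)
  have "\<bar>D u v x - D v u x\<bar> < 2 * e" if e: "e > 0" for e
  proof -
    obtain d1 where d1: "d1 > 0" "\<And>y. dist y x < d1 \<Longrightarrow> dist (D u v y) (D u v x) < e"
      using cont[of u v] e unfolding continuous_at_eps_delta by blast
    obtain d2 where d2: "d2 > 0" "\<And>y. dist y x < d2 \<Longrightarrow> dist (D v u y) (D v u x) < e"
      using cont[of v u] e unfolding continuous_at_eps_delta by blast
    obtain d3 where d3: "d3 > 0" "ball x d3 \<subseteq> T" using T openE by blast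
    define d where "d = min d1 (min d2 d3)"
    \<comment> \<open>This \<open>h\<close> keeps the whole parallelogram within distance
      \<open>d\<close> of \<open>x\<close>; the summand 1 covers the case
      \<open>u = v = 0\<close>.\<close>
    define h where "h = d / (norm u + norm v + 1)"
    have dp: "d > 0" using d1 d2 d3 by (simp add: d_def)
    have np: "norm u + norm v + 1 > 0" using norm_ge_zero[of u] norm_ge_zero[of v] by linarith
    have hp: "h > 0" using dp np by (simp add: h_def)
    have close: "dist (x + s *\<^sub>R u + t *\<^sub>R v) x < d"
      if "0 \<le> s" "s \<le> h" "0 \<le> t" "t \<le> h" for s t
    proof -
      have "dist (x + s *\<^sub>R u + t *\<^sub>R v) x = norm (s *\<^sub>R u + t *\<^sub>R v)"
        by (simp add: dist_norm add.assoc)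
      also have "\<dots> \<le> s * norm u + t * norm v"
        using that norm_triangle_ineq[of "s *\<^sub>R u" "t *\<^sub>R v"] by simp
      also have "\<dots> \<le> h * norm u + h * norm v"
        using that by (intro add_mono mult_right_mono) auto
      also have "\<dots> < h * (norm u + norm v + 1)" using hp by (simp add: algebra_simps)
      also have "\<dots> = d" using np by (simp add: h_def)
      finally show ?thesis .
    qed
    have inT: "x + s *\<^sub>R u + t *\<^sub>R v \<in> T" if "0 \<le> s" "s \<le> h" "0 \<le> t" "t \<le> h" for s t
      using close[OF that] d3(2) by (auto simp: d_def dist_commute)
    obtain s t where st: "0 \<le> s" "s \<le> h" "0 \<le> t" "t \<le> h"
      "g (x + h *\<^sub>R u + h *\<^sub>R v) - g (x + h *\<^sub>R u) - g (x + h *\<^sub>R v) + g x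
        = h * (h * D u v (x + s *\<^sub>R u + t *\<^sub>R v))"
      using Ck_on_mixed_mean_value[OF T(1) g hp inT] unfolding D_def by blast
    have inT': "x + s *\<^sub>R v + t *\<^sub>R u \<in> T" if "0 \<le> s" "s \<le> h" "0 \<le> t" "t \<le> h" for s t
      using inT[of t s] that by (simp add: add.assoc add.commute[of "s *\<^sub>R v"])
    obtain s' t' where st': "0 \<le> s'" "s' \<le> h" "0 \<le> t'" "t' \<le> h"
      "g (x + h *\<^sub>R v + h *\<^sub>R u) - g (x + h *\<^sub>R v) - g (x + h *\<^sub>R u) + g x
        = h * (h * D v u (x + s' *\<^sub>R v + t' *\<^sub>R u))"
      using Ck_on_mixed_mean_value[OF T(1) g hp inT'] unfolding D_def by blast
    have "D u v (x + s *\<^sub>R u + t *\<^sub>R v) = D v u (x + s' *\<^sub>R v + t' *\<^sub>R u)"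
    proof -
      have "x + h *\<^sub>R v + h *\<^sub>R u = x + h *\<^sub>R u + h *\<^sub>R v" by simp
      then have "h * (h * D u v (x + s *\<^sub>R u + t *\<^sub>R v)) = h * (h * D v u (x + s' *\<^sub>R v + t' *\<^sub>R u))"
        using st(5) st'(5)[unfolded \<open>x + h *\<^sub>R v + h *\<^sub>R u = x + h *\<^sub>R u + h *\<^sub>R v\<close>] by linarith
      then show ?thesis using hp by simp
    qed
    moreover have "dist (D u v (x + s *\<^sub>R u + t *\<^sub>R v)) (D u v x) < e"
      using d1 close[OF st(1-4)] by (auto simp: d_def)
    moreover have "dist (D v u (x + s' *\<^sub>R v + t' *\<^sub>R u)) (D v u x) < e"
      using d2 close[of t' s'] st' by (auto simp: d_def add.assoc add.commute[of "s' *\<^sub>R v"])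
    ultimately show ?thesis by (auto simp: dist_real_def)
  qed
  from this[of "\<bar>D u v x - D v u x\<bar> / 2"] have "D u v x = D v u x" by auto
  then show ?thesis by (simp add: D_def)
qed

lemma Ck_on_mixed_commute:
  fixes g :: "'e::euclidean_space \<Rightarrow> 'f::euclidean_space"
  assumes T: "open T" "x \<in> T" and g: "Ck_on (Suc (Suc 0)) g T"
  shows "frechet_derivative (\<lambda>y. frechet_derivative g (at y) u) (at x) v =
    frechet_derivative (\<lambda>y. frechet_derivative g (at y) v) (at x) u"
proof (rule euclidean_eqI)
  fix b :: 'f assume "b \<in> Basis"
  have *: "frechet_derivative (\<lambda>y. frechet_derivative g (at y) u) (at x) v \<bullet> b
     = frechet_derivative (\<lambda>y. frechet_derivative (\<lambda>z. g z \<bullet> b) (at y) u) (at x) v" for u v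
  proof -
    have 1: "frechet_derivative (\<lambda>z. f z \<bullet> b) (at y) w = frechet_derivative f (at y) w \<bullet> b"
      if "Ck_on (Suc 0) f T" "y \<in> T" for f y w
      using frechet_derivative_at[OF has_derivative_inner_left[OF Ck_on_Suc_has_derivative[OF that(1) T(1) that(2)], of b], symmetric]
      by simp
    have c1: "Ck_on (Suc 0) g T" using g Ck_on_Suc_imp T by blast
    have c2: "Ck_on (Suc 0) (\<lambda>y. frechet_derivative g (at y) u) T" using g by auto
    have "frechet_derivative (\<lambda>y. frechet_derivative (\<lambda>z. g z \<bullet> b) (at y) u) (at x)
       = frechet_derivative (\<lambda>y. frechet_derivative g (at y) u \<bullet> b) (at x)"
      by (rule sym, rule frechet_derivative_transform_within_open[OF _ T])
        (use Ck_on_Suc_has_derivative[OF c2 T(1) T(2)] in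
          \<open>auto simp: 1[OF c1] intro!: differentiableI has_derivative_inner_left\<close>)
    then show ?thesis using 1[OF c2 T(2), of v] by simp
  qed
  have "Ck_on (Suc (Suc 0)) (\<lambda>z. g z \<bullet> b) T"
    by (intro Ck_on_bounded_linear[OF bounded_linear_inner_left T(1)] g)
  from Ck_on_mixed_commute_real[OF T this] show
    "frechet_derivative (\<lambda>y. frechet_derivative g (at y) u) (at x) v \<bullet> b =
     frechet_derivative (\<lambda>y. frechet_derivative g (at y) v) (at x) u \<bullet> b"
    unfolding * .
qed

section \<open>Smooth functions\<close>

lemma smooth_onE:
  assumes "smooth_on S f" "x \<in> S"
  obtains T g where "open T" "x \<in> T" "\<And>k. Ck_on k g T" "\<And>y. y \<in> S \<Longrightarrow> y \<in> T \<Longrightarrow> g y = f y"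
proof -
  obtain T g where "open T" "x \<in> T" "\<forall>k. Ck_on k g T" "\<forall>y\<in>S \<inter> T. g y = f y"
    using bspec[OF assms(1)[unfolded smooth_on_def] assms(2)] by (elim exE conjE) (rule that)
  then show thesis by (intro that[of T g]) simp_all
qed

lemma smooth_onI:
  assumes "\<And>x. x \<in> S \<Longrightarrow> \<exists>T g. open T \<and> x \<in> T \<and> (\<forall>k. Ck_on k g T) \<and> (\<forall>y\<in>S \<inter> T. g y = f y)"
  shows "smooth_on S f"
  unfolding smooth_on_def using assms by (rule ballI)

lemma smooth_on_subset: "smooth_on S f \<Longrightarrow> S' \<subseteq> S \<Longrightarrow> smooth_on S' f"
proof (rule smooth_onI)
  fix x assume "smooth_on S f" "S' \<subseteq> S" "x \<in> S'"
  then obtain T g where "open T" "x \<in> T" "\<And>k. Ck_on k g T" "\<And>y. y \<in> S \<Longrightarrow> y \<in> T \<Longrightarrow> g y = f y"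
    using smooth_onE[of S f x] subsetD by metis
  then show "\<exists>T g. open T \<and> x \<in> T \<and> (\<forall>k. Ck_on k g T) \<and> (\<forall>y\<in>S' \<inter> T. g y = f y)"
    using \<open>S' \<subseteq> S\<close> by (intro exI[of _ T] exI[of _ g]) auto
qed

lemma smooth_on_cong: "smooth_on S f \<Longrightarrow> (\<And>x. x \<in> S \<Longrightarrow> f x = g x) \<Longrightarrow> smooth_on S g"
  by (rule smooth_onI, erule (1) smooth_onE) (metis IntD1 IntD2)

lemma smooth_on_local:
  assumes "\<And>x. x \<in> S \<Longrightarrow> \<exists>T. open T \<and> x \<in> T \<and> smooth_on (S \<inter> T) f"
  shows "smooth_on S f"
proof (rule smooth_onI)
  fix x assume x: "x \<in> S"
  obtain T where T: "open T" "x \<in> T" "smooth_on (S \<inter> T) f" using assms x by blast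
  obtain T' g where g: "open T'" "x \<in> T'" "\<And>k. Ck_on k g T'" "\<And>y. y \<in> S \<inter> T \<Longrightarrow> y \<in> T' \<Longrightarrow> g y = f y"
    using smooth_onE[OF T(3), of x] x T by auto
  have "Ck_on k g (T \<inter> T')" for k
    by (rule Ck_on_open_subset[OF g(3) g(1)]) (use T g in auto)
  then show "\<exists>T g. open T \<and> x \<in> T \<and> (\<forall>k. Ck_on k g T) \<and> (\<forall>y\<in>S \<inter> T. g y = f y)"
    using T g by (intro exI[of _ "T \<inter> T'"] exI[of _ g]) auto
qed

lemma smooth_on_local_openin:
  assumes "\<And>x. x \<in> S \<Longrightarrow> \<exists>W. openin (top_of_set S) W \<and> x \<in> W \<and> smooth_on W f"
  shows "smooth_on S f"
proof (rule smooth_on_local)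
  fix x assume "x \<in> S"
  then obtain W where W: "openin (top_of_set S) W" "x \<in> W" "smooth_on W f" using assms by blast
  then obtain T where "open T" "W = S \<inter> T" by (auto simp: openin_open)
  then show "\<exists>T. open T \<and> x \<in> T \<and> smooth_on (S \<inter> T) f" using W by auto
qed

lemma Ck_on_imp_smooth_on: "open T \<Longrightarrow> (\<And>k. Ck_on k f T) \<Longrightarrow> S \<subseteq> T \<Longrightarrow> smooth_on S f"
  by (rule smooth_onI) blast

lemma smooth_on_const: "smooth_on S (\<lambda>x. c)"
  by (rule Ck_on_imp_smooth_on[of UNIV]) (auto intro: Ck_on_const)

lemma smooth_on_bounded_linear: 
  assumes L: "bounded_linear L" and f: "smooth_on S f"
  shows "smooth_on S (\<lambda>x. L (f x))"
proof (rule smooth_onI)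
  fix x assume "x \<in> S"
  with f obtain T g where g: "open T" "x \<in> T" "\<And>k. Ck_on k g T" "\<And>y. y \<in> S \<Longrightarrow> y \<in> T \<Longrightarrow> g y = f y"
    by (rule smooth_onE) (rule that)
  then show "\<exists>T g. open T \<and> x \<in> T \<and> (\<forall>k. Ck_on k g T) \<and> (\<forall>y\<in>S \<inter> T. g y = L (f y))"
    by (intro exI[of _ T] exI[of _ "\<lambda>x. L (g x)"]) (auto intro: Ck_on_bounded_linear[OF L])
qed

lemma smooth_on_bounded_bilinear:
  assumes B: "bounded_bilinear B" and f: "smooth_on S f" and f': "smooth_on S f'"
  shows "smooth_on S (\<lambda>x. B (f x) (f' x))"
proof (rule smooth_onI)
  fix x assume x: "x \<in> S"
  from f x obtain T g where g: "open T" "x \<in> T" "\<And>k. Ck_on k g T" "\<And>y. y \<in> S \<Longrightarrow> y \<in> T \<Longrightarrow> g y = f y"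
    by (rule smooth_onE) (rule that)
  from f' x obtain T' g' where g': "open T'" "x \<in> T'" "\<And>k. Ck_on k g' T'" "\<And>y. y \<in> S \<Longrightarrow> y \<in> T' \<Longrightarrow> g' y = f' y"
    by (rule smooth_onE) (rule that)
  have T: "open (T \<inter> T')" using g g' by auto
  show "\<exists>T g. open T \<and> x \<in> T \<and> (\<forall>k. Ck_on k g T) \<and> (\<forall>y\<in>S \<inter> T. g y = B (f y) (f' y))"
    by (intro exI[of _ "T \<inter> T'"] exI[of _ "\<lambda>x. B (g x) (g' x)"] conjI T allI
        Ck_on_bounded_bilinear[OF B T] Ck_on_open_subset[OF g(3) g(1)] Ck_on_open_subset[OF g'(3) g'(1)])
      (use g g' in auto)
qed

lemma smooth_on_add: "smooth_on S f \<Longrightarrow> smooth_on S g \<Longrightarrow> smooth_on S (\<lambda>x. f x + g x)"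
proof (rule smooth_onI)
  fix x assume f: "smooth_on S f" and f': "smooth_on S g" and x: "x \<in> S"
  from f x obtain T h where h: "open T" "x \<in> T" "\<And>k. Ck_on k h T" "\<And>y. y \<in> S \<Longrightarrow> y \<in> T \<Longrightarrow> h y = f y"
    by (rule smooth_onE) (rule that)
  from f' x obtain T' h' where h': "open T'" "x \<in> T'" "\<And>k. Ck_on k h' T'" "\<And>y. y \<in> S \<Longrightarrow> y \<in> T' \<Longrightarrow> h' y = g y"
    by (rule smooth_onE) (rule that)
  have T: "open (T \<inter> T')" using h h' by auto
  show "\<exists>T h. open T \<and> x \<in> T \<and> (\<forall>k. Ck_on k h T) \<and> (\<forall>y\<in>S \<inter> T. h y = f y + g y)"
    by (intro exI[of _ "T \<inter> T'"] exI[of _ "\<lambda>x. h x + h' x"] conjI T allI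
        Ck_on_add[OF T] Ck_on_open_subset[OF h(3) h(1)] Ck_on_open_subset[OF h'(3) h'(1)])
      (use h h' in auto)
qed

lemma smooth_on_sum: "(\<And>i. i \<in> I \<Longrightarrow> smooth_on S (f i)) \<Longrightarrow> smooth_on S (\<lambda>x. \<Sum>i\<in>I. f i x)"
  by (induction I rule: infinite_finite_induct) (auto intro: smooth_on_const smooth_on_add)

lemma smooth_on_compose:
  fixes f :: "'e::euclidean_space \<Rightarrow> 'h::euclidean_space" and f' :: "'h \<Rightarrow> 'f::real_normed_vector"
  assumes f: "smooth_on S f" and f': "smooth_on S' f'" and sub: "\<And>x. x \<in> S \<Longrightarrow> f x \<in> S'"
  shows "smooth_on S (\<lambda>x. f' (f x))"
proof (rule smooth_onI)
  fix x assume x: "x \<in> S"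
  from f x obtain T g where g: "open T" "x \<in> T" "\<And>k. Ck_on k g T" "\<And>y. y \<in> S \<Longrightarrow> y \<in> T \<Longrightarrow> g y = f y"
    by (rule smooth_onE) (rule that)
  from f' sub[OF x] obtain T' g' where g': "open T'" "f x \<in> T'" "\<And>k. Ck_on k g' T'" "\<And>y. y \<in> S' \<Longrightarrow> y \<in> T' \<Longrightarrow> g' y = f' y"
    by (rule smooth_onE) (rule that)
  have "continuous_on T g" using g(3)[of 0] by simp
  \<comment> \<open>The extension \<open>g\<close> of the inner map may leave the domain of the
    extension of the outer map, so the neighbourhood is cut down to a preimage.\<close>
  then have T: "open (T \<inter> g -` T')" using continuous_open_preimage g(1) g'(1) by blast
  have "Ck_on k (\<lambda>x. g' (g x)) (T \<inter> g -` T')" for k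
    by (rule Ck_on_compose[OF T g'(1) _ Ck_on_open_subset[OF g(3) g(1) _ T] g'(3)]) auto
  then show "\<exists>T g. open T \<and> x \<in> T \<and> (\<forall>k. Ck_on k g T) \<and> (\<forall>y\<in>S \<inter> T. g y = f' (f y))"
    using g g' x sub T by (intro exI[of _ "T \<inter> g -` T'"] exI[of _ "\<lambda>x. g' (g x)"] conjI T) auto
qed

lemma smooth_on_inverse:
  fixes f :: "'e::euclidean_space \<Rightarrow> real"
  assumes "smooth_on S f" "\<And>x. x \<in> S \<Longrightarrow> f x \<noteq> 0"
  shows "smooth_on S (\<lambda>x. inverse (f x))"
  by (rule smooth_on_compose[OF assms(1), of "-{0}"])
    (use assms(2) in \<open>auto intro!: Ck_on_imp_smooth_on[of "-{0}"] Ck_on_inverse Ck_on_id\<close>)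

lemma smooth_on_sqrt:
  fixes f :: "'e::euclidean_space \<Rightarrow> real"
  assumes "smooth_on S f" "\<And>x. x \<in> S \<Longrightarrow> f x > 0"
  shows "smooth_on S (\<lambda>x. sqrt (f x))"
  by (rule smooth_on_compose[OF assms(1), of "{0<..}"])
    (use assms(2) in \<open>auto intro!: Ck_on_imp_smooth_on[of "{0<..}"] Ck_on_sqrt Ck_on_id\<close>)

lemmas smooth_on_mult = smooth_on_bounded_bilinear[OF bounded_bilinear_mult]
lemmas smooth_on_scaleR = smooth_on_bounded_bilinear[OF bounded_bilinear_scaleR]
lemmas smooth_on_inner = smooth_on_bounded_bilinear[OF bounded_bilinear_inner]

lemma smooth_on_diff: "smooth_on S f \<Longrightarrow> smooth_on S g \<Longrightarrow> smooth_on S (\<lambda>x. f x - g x)"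
  using smooth_on_add[OF _ smooth_on_bounded_linear[OF bounded_linear_minus[OF bounded_linear_ident]], of S f g]
  by simp

lemma bounded_bilinear_cross3: "bounded_bilinear cross3"
  using bilinear_cross bilinear_conv_bounded_bilinear by blast

lemmas smooth_on_cross3 = smooth_on_bounded_bilinear[OF bounded_bilinear_cross3]

lemma smooth_on_norm:
  fixes f :: "'e::euclidean_space \<Rightarrow> 'f::euclidean_space"
  assumes "smooth_on S f" "\<And>x. x \<in> S \<Longrightarrow> f x \<noteq> 0"
  shows "smooth_on S (\<lambda>x. norm (f x))"
  unfolding norm_eq_sqrt_inner
  by (intro smooth_on_sqrt smooth_on_inner assms) (use assms(2) in simp)

lemma smooth_on_sgn:
  fixes f :: "'e::euclidean_space \<Rightarrow> 'f::euclidean_space"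
  assumes "smooth_on S f" "\<And>x. x \<in> S \<Longrightarrow> f x \<noteq> 0"
  shows "smooth_on S (\<lambda>x. sgn (f x))"
  unfolding sgn_div_norm
  by (intro smooth_on_scaleR smooth_on_inverse smooth_on_norm assms(1)) (use assms(2) in auto)

lemma smooth_on_id: "smooth_on S (\<lambda>x. x)"
  by (rule Ck_on_imp_smooth_on[of UNIV]) (auto intro: Ck_on_id)

lemma smooth_on_continuous: "smooth_on S f \<Longrightarrow> continuous_on S f"
  unfolding continuous_on_eq_continuous_within
proof
  fix x assume f: "smooth_on S f" and x: "x \<in> S"
  from f x obtain T g where g: "open T" "x \<in> T" "\<And>k. Ck_on k g T" "\<And>y. y \<in> S \<Longrightarrow> y \<in> T \<Longrightarrow> g y = f y"
    by (rule smooth_onE) (rule that)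
  have "continuous_on T g" using g(3)[of 0] by simp
  then have "continuous (at x within S) g"
    using g(1,2) by (simp add: continuous_at_imp_continuous_at_within continuous_on_eq_continuous_at)
  then show "continuous (at x within S) f"
    by (rule continuous_transform_within_openin[where S = "S \<inter> T"])
      (use g x in \<open>auto simp: openin_open\<close>)
qed

text \<open>Derivatives within a thick set are unique, although the set may have boundary points.\<close>

definition thick :: "'e::euclidean_space set \<Rightarrow> bool" where
  "thick H \<longleftrightarrow> (\<forall>x\<in>H. \<forall>i\<in>Basis. \<forall>e>0. \<exists>d. 0 < \<bar>d\<bar> \<and> \<bar>d\<bar> < e \<and> x + d *\<^sub>R i \<in> H)"

abbreviation dw :: "'e::euclidean_space set \<Rightarrow> ('e \<Rightarrow> 'f::real_normed_vector) \<Rightarrow> 'e \<Rightarrow> 'e \<Rightarrow> 'f" where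
  "dw H f x \<equiv> frechet_derivative f (at x within H)"

lemma dw_eqI:
  assumes "thick H" "x \<in> H" "(f has_derivative f') (at x within H)"
  shows "dw H f x = f'"
proof -
  have "(f has_derivative dw H f x) (at x within H)"
    using assms(3) differentiableI frechet_derivative_works by blast
  then show ?thesis
    by (rule frechet_derivative_unique_within[OF _ assms(3)]) (use assms(1,2) in \<open>auto simp: thick_def\<close>)
qed

lemma at_within_openin:
  assumes "openin (top_of_set H) S" "x \<in> S"
  shows "at x within S = at x within H"
proof -
  obtain T where T: "open T" "S = H \<inter> T" using assms(1) by (auto simp: openin_open)
  then show ?thesis using assms(2) by (intro at_within_nhd[of x T]) auto
qed

lemma has_derivative_within_cong:
  assumes "openin (top_of_set H) S" "x \<in> S" "\<And>y. y \<in> S \<Longrightarrow> f y = g y"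
    and "(f has_derivative f') (at x within H)"
  shows "(g has_derivative f') (at x within H)"
  using has_derivative_transform[of x S g f f'] assms at_within_openin[OF assms(1,2)] by simp

lemma dw_cong:
  assumes "openin (top_of_set H) S" "x \<in> S" "\<And>y. y \<in> S \<Longrightarrow> f y = g y"
  shows "dw H f x = dw H g x"
proof -
  have "(f has_derivative f') (at x within H) \<longleftrightarrow> (g has_derivative f') (at x within H)" for f'
    using has_derivative_within_cong[OF assms(1,2)] assms(3) by metis
  then show ?thesis by (simp add: frechet_derivative_def)
qed

text \<open>Near \<open>x\<close> the derivative within \<open>H\<close> is the ordinary derivative
  of a smooth function \<open>g\<close> on an open set, also at edge points of \<open>H\<close>.
  Smoothness and symmetry of derivatives within \<open>H\<close> are pulled back from the open case
  through this statement.\<close>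

lemma smooth_on_extension:
  assumes H: "thick H" "openin (top_of_set H) S" and f: "smooth_on S f" "x \<in> S"
  obtains T g where "open T" "x \<in> T" "\<And>k. Ck_on k g T" "H \<inter> T \<subseteq> S" "\<And>y. y \<in> H \<inter> T \<Longrightarrow> g y = f y"
    "\<And>y. y \<in> H \<inter> T \<Longrightarrow> (f has_derivative dw H f y) (at y within H)"
    "\<And>y. y \<in> H \<inter> T \<Longrightarrow> dw H f y = frechet_derivative g (at y)"
proof -
  from f obtain T0 g where g: "open T0" "x \<in> T0" "\<And>k. Ck_on k g T0" "\<And>y. y \<in> S \<Longrightarrow> y \<in> T0 \<Longrightarrow> g y = f y"
    by (rule smooth_onE) (rule that)
  obtain T1 where T1: "open T1" "S = H \<inter> T1" using H(2) by (auto simp: openin_open)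
  define T where "T = T0 \<inter> T1"
  have T: "open T" "x \<in> T" "H \<inter> T \<subseteq> S" using g T1 f by (auto simp: T_def)
  have ck: "Ck_on k g T" for k by (rule Ck_on_open_subset[OF g(3) g(1)]) (use g T1 in \<open>auto simp: T_def\<close>)
  have eq: "g y = f y" if "y \<in> H \<inter> T" for y using that g(4) T1 by (auto simp: T_def)
  have d: "(f has_derivative frechet_derivative g (at y)) (at y within H)" if y: "y \<in> H \<inter> T" for y
  proof (rule has_derivative_within_cong[of H "H \<inter> T"])
    show "(g has_derivative frechet_derivative g (at y)) (at y within H)"
      by (rule has_derivative_at_withinI, rule Ck_on_Suc_has_derivative[OF ck T(1)]) (use y in auto)
  qed (use T y eq in \<open>auto simp: openin_open\<close>)
  have e: "dw H f y = frechet_derivative g (at y)" if y: "y \<in> H \<inter> T" for y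
    using dw_eqI[OF H(1) _ d[OF y]] y by auto
  show thesis using that[OF T(1,2) ck T(3) eq] d e by simp
qed

lemma smooth_on_has_derivative:
  assumes "thick H" "openin (top_of_set H) S" "smooth_on S f" "x \<in> S"
  shows "(f has_derivative dw H f x) (at x within H)"
proof -
  obtain T where T: "x \<in> T" "\<And>y. y \<in> H \<inter> T \<Longrightarrow> (f has_derivative dw H f y) (at y within H)"
    by (rule smooth_on_extension[OF assms]) blast
  have "x \<in> H" using assms by (meson openin_imp_subset subsetD)
  with T show ?thesis by blast
qed

lemma smooth_on_differentiable:
  assumes "thick H" "openin (top_of_set H) S" "smooth_on S f" "x \<in> S"
  shows "f differentiable (at x within H)"
  using smooth_on_has_derivative[OF assms] by (rule differentiableI)

lemma smooth_on_dw:
  assumes "thick H" "openin (top_of_set H) S" "smooth_on S f"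
  shows "smooth_on S (\<lambda>x. dw H f x v)"
proof (rule smooth_onI)
  fix x assume x: "x \<in> S"
  have sub: "S \<subseteq> H" using assms(2) by (rule openin_imp_subset)
  obtain T g where T: "open T" "x \<in> T" "\<And>k. Ck_on k g T" 
    "\<And>y. y \<in> H \<inter> T \<Longrightarrow> dw H f y = frechet_derivative g (at y)"
    by (rule smooth_on_extension[OF assms x]) blast
  have "Ck_on k (\<lambda>x. frechet_derivative g (at x) v) T" for k using T(3)[of "Suc k"] by simp
  then show "\<exists>T g. open T \<and> x \<in> T \<and> (\<forall>k. Ck_on k g T) \<and> (\<forall>y\<in>S \<inter> T. g y = dw H f y v)"
    using T sub by (intro exI[of _ T] exI[of _ "\<lambda>x. frechet_derivative g (at x) v"]) auto
qed

text \<open>In a relative neighbourhood of \<open>x\<close> the first derivatives within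
  \<open>H\<close> agree with those of the local extension, hence so do the second ones at
  \<open>x\<close>; for the extension the symmetry is known.\<close>

lemma dw_commute:
  fixes f :: "'e::euclidean_space \<Rightarrow> 'f::euclidean_space"
  assumes "thick H" "openin (top_of_set H) S" "smooth_on S f" "x \<in> S"
  shows "dw H (\<lambda>y. dw H f y u) x v = dw H (\<lambda>y. dw H f y v) x u"
proof -
  have x: "x \<in> H" using assms by (meson openin_imp_subset subsetD)
  obtain T g where T: "open T" "x \<in> T" "\<And>k. Ck_on k g T" 
    "\<And>y. y \<in> H \<inter> T \<Longrightarrow> dw H f y = frechet_derivative g (at y)"
    by (rule smooth_on_extension[OF assms]) blast
  have e: "dw H (\<lambda>y. dw H f y u) x = frechet_derivative (\<lambda>y. frechet_derivative g (at y) u) (at x)" for u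
  proof (rule dw_eqI[OF assms(1) x])
    show "((\<lambda>y. dw H f y u) has_derivative frechet_derivative (\<lambda>y. frechet_derivative g (at y) u) (at x)) (at x within H)"
    proof (rule has_derivative_within_cong[of H "H \<inter> T"])
      show "((\<lambda>y. frechet_derivative g (at y) u) has_derivative
          frechet_derivative (\<lambda>y. frechet_derivative g (at y) u) (at x)) (at x within H)"
      proof (rule has_derivative_at_withinI[OF Ck_on_Suc_has_derivative[of 0, OF _ T(1,2)]])
        show "Ck_on (Suc 0) (\<lambda>y. frechet_derivative g (at y) u) T"
          using T(3)[of "Suc (Suc 0)"] unfolding Ck_on.simps(2)[of "Suc 0" g] by blast
      qed
    qed (use T x in \<open>auto simp: openin_open\<close>)
  qed
  show ?thesis unfolding e by (rule Ck_on_mixed_commute[OF T(1,2) T(3)])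
qed

lemma dw_const: "dw H (\<lambda>x. c) x = (\<lambda>v. 0)" if "thick H" "x \<in> H"
  by (rule dw_eqI[OF that]) simp

lemma dw_bounded_bilinear:
  assumes "bounded_bilinear B" "thick H" "x \<in> H" "f differentiable (at x within H)" "g differentiable (at x within H)"
  shows "dw H (\<lambda>x. B (f x) (g x)) x v = B (f x) (dw H g x v) + B (dw H f x v) (g x)"
  using dw_eqI[OF assms(2,3) bounded_bilinear.FDERIV[OF assms(1)]] assms(4,5)[unfolded frechet_derivative_works] by metis

lemma dw_sum:
  assumes "thick H" "x \<in> H" "\<And>i. i \<in> I \<Longrightarrow> f i differentiable (at x within H)"
  shows "dw H (\<lambda>x. \<Sum>i\<in>I. f i x) x v = (\<Sum>i\<in>I. dw H (f i) x v)"
  by (rule fun_cong[OF dw_eqI[OF assms(1,2) has_derivative_sum]])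
    (use assms(3)[unfolded frechet_derivative_works] in auto)

lemma thick_UNIV: "thick UNIV"
  unfolding thick_def using dense_order_class.dense abs_of_pos by (metis UNIV_I)

lemma thick_half_plane: "thick half_plane"
  unfolding thick_def
proof (intro ballI allI impI)
  fix x i :: "real^2" and e :: real
  assume "x \<in> half_plane" "i \<in> Basis" "e > 0"
  then show "\<exists>d. 0 < \<bar>d\<bar> \<and> \<bar>d\<bar> < e \<and> x + d *\<^sub>R i \<in> half_plane"
    by (intro exI[of _ "e/2"]) (auto simp: half_plane_def Basis_vec_def axis_def)
qed

text \<open>Meant for the product of the time line with the half-plane, where time and coordinate
  derivatives have to be exchanged.\<close>

lemma thick_Times:
  fixes H :: "'a::euclidean_space set" and K :: "'b::euclidean_space set"
  assumes "thick H" "thick K"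
  shows "thick (H \<times> K)"
  unfolding thick_def
proof (intro ballI allI impI)
  fix x i :: "'a \<times> 'b" and e :: real
  assume x: "x \<in> H \<times> K" and i: "i \<in> Basis" and e: "e > 0"
  consider j where "i = (j, 0)" "j \<in> Basis" | j where "i = (0, j)" "j \<in> Basis"
    using i by (auto simp: Basis_prod_def)
  then show "\<exists>d. 0 < \<bar>d\<bar> \<and> \<bar>d\<bar> < e \<and> x + d *\<^sub>R i \<in> H \<times> K"
  proof cases
    case 1
    then obtain d where "0 < \<bar>d\<bar>" "\<bar>d\<bar> < e" "fst x + d *\<^sub>R j \<in> H"
      using assms(1) x e unfolding thick_def by (metis mem_Times_iff)
    then show ?thesis using 1 x by (intro exI[of _ d]) (auto simp: mem_Times_iff)
  next
    case 2
    then obtain d where "0 < \<bar>d\<bar>" "\<bar>d\<bar> < e" "snd x + d *\<^sub>R j \<in> K"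
      using assms(2) x e unfolding thick_def by (metis mem_Times_iff)
    then show ?thesis using 2 x by (intro exI[of _ d]) (auto simp: mem_Times_iff)
  qed
qed

text \<open>The time factor is the whole line, so the time slice has an ordinary two-sided
  derivative even when \<open>x\<close> lies on the edge of \<open>H\<close>, while the coordinate
  slice remains a derivative within \<open>H\<close>.\<close>

lemma has_derivative_slice:
  fixes F :: "real \<times> 'e::euclidean_space \<Rightarrow> 'f::real_normed_vector"
  assumes F: "(F has_derivative F') (at (t, x) within UNIV \<times> H)"
  shows "((\<lambda>y. F (t, y)) has_derivative (\<lambda>v. F' (0, v))) (at x within H)"
    and "x \<in> H \<Longrightarrow> ((\<lambda>s. F (s, x)) has_vector_derivative F' (1, 0)) (at t)"
proof -
  have "(Pair t has_derivative (\<lambda>v. (0, v))) (at x within H)"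
    by (auto intro!: derivative_eq_intros)
  from has_derivative_in_compose[OF this, of F F'] has_derivative_subset[OF F, of "Pair t ` H"]
  show "((\<lambda>y. F (t, y)) has_derivative (\<lambda>v. F' (0, v))) (at x within H)"
    by auto
  assume x: "x \<in> H"
  have "((\<lambda>s. (s, x)) has_derivative (\<lambda>s. (s, 0))) (at t)"
    by (auto intro!: derivative_eq_intros)
  from has_derivative_in_compose[OF this, of F F'] has_derivative_subset[OF F, of "range (\<lambda>s. (s, x))"] x
  have "((\<lambda>s. F (s, x)) has_derivative (\<lambda>s. F' (s, 0))) (at t)"
    by auto
  moreover have "(\<lambda>s. F' (s, 0)) = (\<lambda>s. s *\<^sub>R F' (1, 0))"
  proof
    show "F' (s, 0) = s *\<^sub>R F' (1, 0)" for s
      using linear_cmul[OF has_derivative_linear[OF F], of s "(1, 0)"] by simp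
  qed
  ultimately show "((\<lambda>s. F (s, x)) has_vector_derivative F' (1, 0)) (at t)"
    unfolding has_vector_derivative_def by (rule has_derivative_eq_rhs)
qed

lemma smooth_on_snd: "smooth_on S f \<Longrightarrow> smooth_on (UNIV \<times> S) (\<lambda>z :: real \<times> _. f (snd z))"
  by (rule smooth_on_compose[OF smooth_on_bounded_linear[OF bounded_linear_snd smooth_on_id]]) auto

lemma smooth_on_fst: "smooth_on S fst"
  using smooth_on_bounded_linear[OF bounded_linear_fst smooth_on_id] .

section \<open>Charts and transition maps\<close>

lemma vec2_axis: "(u :: real^2) = u $ 1 *\<^sub>R axis 1 1 + u $ 2 *\<^sub>R axis 2 1"
  by (simp add: vec_eq_iff forall_2 axis_def)

lemma linear_vec2: "linear L \<Longrightarrow> L (u :: real^2) = u $ 1 *\<^sub>R L (axis 1 1) + u $ 2 *\<^sub>R L (axis 2 1)"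
  by (subst vec2_axis) (simp add: linear_add linear_cmul)

lemma det_matrix_2: "det (matrix L) =
    L (axis 1 1) $ 1 * L (axis 2 1) $ 2 - L (axis 2 1) $ 1 * L (axis 1 1) $ 2"
  for L :: "real^2 \<Rightarrow> real^2"
  by (simp add: det_2 matrix_def axis_def)

text \<open>The transformation law of 2-forms, for products with vector values: an alternating
  expression in the images of the two basis vectors scales with the determinant. It serves for
  coordinate changes and, later, for passing to principal directions.\<close>

lemma alternating_compose:
  fixes L :: "real^2 \<Rightarrow> real^2"
  assumes B: "bounded_bilinear B" and "linear D" "linear D'"
  shows "B (D (L (axis 1 1))) (D' (L (axis 2 1))) - B (D (L (axis 2 1))) (D' (L (axis 1 1))) =
    det (matrix L) *\<^sub>R (B (D (axis 1 1)) (D' (axis 2 1)) - B (D (axis 2 1)) (D' (axis 1 1)))"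
proof -
  interpret bounded_bilinear B by (rule B)
  have e: "D u = u $ 1 *\<^sub>R D (axis 1 1) + u $ 2 *\<^sub>R D (axis 2 1)"
    "D' u = u $ 1 *\<^sub>R D' (axis 1 1) + u $ 2 *\<^sub>R D' (axis 2 1)" for u
    by (rule linear_vec2, fact)+
  show ?thesis
    unfolding e[of "L _"] det_matrix_2
    by (simp add: add_left add_right scaleR_left scaleR_right algebra_simps)
qed

lemma compact_oriented_surfaceD:
  assumes "compact_oriented_surface M A"
  shows "compact_space M" "Hausdorff_space M" "(\<Union>c\<in>A. fst c) = topspace M"
    "\<And>c. c \<in> A \<Longrightarrow> openin M (fst c)"
    "\<And>c. c \<in> A \<Longrightarrow> homeomorphic_map (subtopology M (fst c)) (top_of_set (chart_image c)) (snd c)"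
    "\<And>c. c \<in> A \<Longrightarrow> openin (top_of_set half_plane) (chart_image c)"
    "\<And>c d. c \<in> A \<Longrightarrow> d \<in> A \<Longrightarrow> oriented_transition c d"
  using assms unfolding compact_oriented_surface_def coordinate_chart_def by blast+

section \<open>Charts, transition maps and coordinate derivatives\<close>

locale surface =
  fixes M :: "'a topology" and A :: "'a chart set"
  assumes surface: "compact_oriented_surface M A"
begin

lemmas surf = compact_oriented_surfaceD[OF surface]

lemma chart_subset: "c \<in> A \<Longrightarrow> fst c \<subseteq> topspace M"
  using surf(4) openin_subset by blast

lemma inj_chart: "c \<in> A \<Longrightarrow> inj_on (snd c) (fst c)"
  using surf(5)[of c] chart_subset[of c] homeomorphic_imp_injective_map
  by (metis inf.absorb2 topspace_subtopology)

lemma chart_inv_chart: "c \<in> A \<Longrightarrow> p \<in> fst c \<Longrightarrow> chart_inv c (snd c p) = p"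
  unfolding chart_inv_def by (simp add: inj_chart)

lemma chart_in_image: "p \<in> fst c \<Longrightarrow> snd c p \<in> chart_image c"
  unfolding chart_image_def by simp

lemma chart_chart_inv: "x \<in> chart_image c \<Longrightarrow> snd c (chart_inv c x) = x"
  unfolding chart_inv_def chart_image_def by (simp add: f_inv_into_f)

lemma chart_inv_in: "x \<in> chart_image c \<Longrightarrow> chart_inv c x \<in> fst c"
  unfolding chart_inv_def chart_image_def by (simp add: inv_into_into)

lemma chart_image_subset: "c \<in> A \<Longrightarrow> chart_image c \<subseteq> half_plane"
  using surf(6) openin_imp_subset by blast

lemma openin_chart_image:
  assumes "c \<in> A" "openin M V"
  shows "openin (top_of_set half_plane) (snd c ` (fst c \<inter> V))"
proof -
  have "openin (subtopology M (fst c)) (fst c \<inter> V)"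
    using assms by (simp add: openin_subtopology_Int2)
  then have "openin (top_of_set (chart_image c)) (snd c ` (fst c \<inter> V))"
    using surf(5)[OF assms(1)] chart_subset[OF assms(1)]
      homeomorphic_map_openness[of "subtopology M (fst c)" "top_of_set (chart_image c)" "snd c" "fst c \<inter> V"]
    by (auto simp: Int_absorb1)
  then show ?thesis using surf(6)[OF assms(1)] openin_trans by blast
qed

lemma openin_chart_preimage:
  assumes "c \<in> A" "openin (top_of_set half_plane) W"
  shows "openin M {p \<in> fst c. snd c p \<in> W}"
proof -
  have "openin (top_of_set (chart_image c)) (chart_image c \<inter> W)"
    using assms chart_image_subset[OF assms(1)]
    by (metis inf_commute openin_subtopology_Int subtopology_subtopology inf.absorb_iff2 inf.absorb2 openin_subtopology_Int2 openin_open)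
  moreover have "continuous_map (subtopology M (fst c)) (top_of_set (chart_image c)) (snd c)"
    using surf(5)[OF assms(1)] homeomorphic_imp_continuous_map by blast
  ultimately have "openin (subtopology M (fst c))
      {p \<in> topspace (subtopology M (fst c)). snd c p \<in> chart_image c \<inter> W}"
    by (rule openin_continuous_map_preimage[rotated])
  moreover have "{p \<in> topspace (subtopology M (fst c)). snd c p \<in> chart_image c \<inter> W} = {p \<in> fst c. snd c p \<in> W}"
    using chart_subset[OF assms(1)] by (auto simp: chart_image_def)
  ultimately show ?thesis using surf(4)[OF assms(1)] by (simp add: openin_open_subtopology)
qed

lemma compact_chart_image:
  assumes "c \<in> A" "K \<subseteq> fst c"
  shows "compact (snd c ` K) \<longleftrightarrow> compactin M K"
proof -
  have "compactin (top_of_set (chart_image c)) (snd c ` K) \<longleftrightarrow> compactin (subtopology M (fst c)) K"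
    using homeomorphic_map_compactness[OF surf(5)[OF assms(1)], of K] assms(2) chart_subset[OF assms(1)] by auto
  then show ?thesis
    using assms(2) by (auto simp: compactin_subtopology chart_image_def)
qed

lemma chart_at: "p \<in> topspace M \<Longrightarrow> chart_at A p \<in> A \<and> p \<in> fst (chart_at A p)"
  unfolding chart_at_def by (rule someI_ex) (use surf(3) in blast)

abbreviation trans :: "'a chart \<Rightarrow> 'a chart \<Rightarrow> real^2 \<Rightarrow> real^2" where
  "trans c d \<equiv> snd d \<circ> chart_inv c"

abbreviation overlap :: "'a chart \<Rightarrow> 'a chart \<Rightarrow> (real^2) set" where
  "overlap c d \<equiv> snd c ` (fst c \<inter> fst d)"

lemma openin_overlap: "c \<in> A \<Longrightarrow> d \<in> A \<Longrightarrow> openin (top_of_set half_plane) (overlap c d)"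
  by (rule openin_chart_image) (use surf(4) in auto)

lemma trans_chart: "c \<in> A \<Longrightarrow> p \<in> fst c \<Longrightarrow> trans c d (snd c p) = snd d p"
  by (simp add: chart_inv_chart)

lemma smooth_trans: "c \<in> A \<Longrightarrow> d \<in> A \<Longrightarrow> smooth_on (overlap c d) (trans c d)"
  using surf(7)[of c d] by (simp add: oriented_transition_def Let_def)

text \<open>The chart image is relatively open in the half-plane, so derivatives within either set
  agree; from here on all charts of the atlas share the thick set \<open>half_plane\<close>.\<close>

lemma coord_deriv_eq:
  assumes "c \<in> A" "p \<in> fst c"
  shows "coord_deriv c f p = dw half_plane (f \<circ> chart_inv c) (snd c p)"
  unfolding coord_deriv_def
  using at_within_openin[OF surf(6)[OF assms(1)] chart_in_image[OF assms(2)]] by simp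

lemma trans_has_derivative:
  assumes "c \<in> A" "d \<in> A" "p \<in> fst c" "p \<in> fst d"
  shows "(trans c d has_derivative coord_deriv c (snd d) p) (at (snd c p) within half_plane)"
  unfolding coord_deriv_eq[OF assms(1,3)]
  by (rule smooth_on_has_derivative[OF thick_half_plane openin_overlap smooth_trans])
    (use assms in auto)

lemma det_trans_pos:
  assumes "c \<in> A" "d \<in> A" "p \<in> fst c" "p \<in> fst d"
  shows "0 < det (matrix (coord_deriv c (snd d) p))"
proof -
  have p: "snd c p \<in> overlap c d" using assms by auto
  then have "0 < det (matrix (frechet_derivative (trans c d) (at (snd c p) within overlap c d)))"
    by (rule bspec[OF conjunct2[OF surf(7)[OF assms(1,2), unfolded oriented_transition_def Let_def]]])
  then show ?thesis
    unfolding at_within_openin[OF openin_overlap[OF assms(1,2)] p] coord_deriv_eq[OF assms(1,3)] .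
qed

lemma linear_trans:
  assumes "c \<in> A" "d \<in> A" "p \<in> fst c" "p \<in> fst d"
  shows "linear (coord_deriv c (snd d) p)"
  using has_derivative_linear[OF trans_has_derivative[OF assms]] .

definition diff_at :: "('a \<Rightarrow> 'f::real_normed_vector) \<Rightarrow> 'a \<Rightarrow> bool" where
  "diff_at f p \<longleftrightarrow> (\<forall>c\<in>A. p \<in> fst c \<longrightarrow> (f \<circ> chart_inv c) differentiable (at (snd c p) within half_plane))"

text \<open>The chain rule is applied within the overlap, which the transition maps into the
  half-plane; relative openness of the overlap then leads back to derivatives within the
  half-plane.\<close>

lemma coord_deriv_change':
  assumes cd: "c \<in> A" "d \<in> A" "p \<in> fst c" "p \<in> fst d"
    and f: "(f \<circ> chart_inv d) differentiable (at (snd d p) within half_plane)"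
  shows "((f \<circ> chart_inv c) has_derivative (\<lambda>u. coord_deriv d f p (coord_deriv c (snd d) p u))) (at (snd c p) within half_plane)"
proof -
  have p: "snd c p \<in> overlap c d" using cd by auto
  have "((f \<circ> chart_inv d) has_derivative coord_deriv d f p) (at (trans c d (snd c p)) within half_plane)"
    using f unfolding coord_deriv_eq[OF cd(2,4)] frechet_derivative_works trans_chart[OF cd(1,3)] .
  moreover have "trans c d ` overlap c d \<subseteq> half_plane"
    using cd chart_image_subset[OF cd(2)] by (auto simp: chart_inv_chart chart_image_def)
  ultimately have "((f \<circ> chart_inv d) has_derivative coord_deriv d f p) (at (trans c d (snd c p)) within trans c d ` overlap c d)"
    using has_derivative_subset by blast
  from has_derivative_in_compose[OF has_derivative_subset[OF trans_has_derivative[OF cd] openin_imp_subset[OF openin_overlap[OF cd(1,2)]]] this]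
  have "((\<lambda>x. (f \<circ> chart_inv d) (trans c d x)) has_derivative (\<lambda>u. coord_deriv d f p (coord_deriv c (snd d) p u))) (at (snd c p) within half_plane)"
    unfolding at_within_openin[OF openin_overlap[OF cd(1,2)] p] .
  then show ?thesis
    by (rule has_derivative_within_cong[OF openin_overlap[OF cd(1,2)] p, rotated])
      (use cd in \<open>auto simp: chart_inv_chart\<close>)
qed

lemma diff_atI:
  assumes "d \<in> A" "p \<in> fst d" "(f \<circ> chart_inv d) differentiable (at (snd d p) within half_plane)"
  shows "diff_at f p"
  unfolding diff_at_def using coord_deriv_change'[OF _ assms(1) _ assms(2,3)] by (blast intro: differentiableI)

lemma diff_atD:
  assumes "diff_at f p" "c \<in> A" "p \<in> fst c"
  shows "(f \<circ> chart_inv c) differentiable (at (snd c p) within half_plane)"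
    "((f \<circ> chart_inv c) has_derivative coord_deriv c f p) (at (snd c p) within half_plane)"
  using assms unfolding diff_at_def by (auto simp: coord_deriv_eq frechet_derivative_works)

lemma linear_coord_deriv: "diff_at f p \<Longrightarrow> c \<in> A \<Longrightarrow> p \<in> fst c \<Longrightarrow> linear (coord_deriv c f p)"
  using diff_atD(2) has_derivative_linear by blast

lemma snd_in_half_plane: "c \<in> A \<Longrightarrow> p \<in> fst c \<Longrightarrow> snd c p \<in> half_plane"
  by (rule subsetD[OF chart_image_subset chart_in_image])

lemma coord_deriv_change:
  assumes "diff_at f p" "c \<in> A" "d \<in> A" "p \<in> fst c" "p \<in> fst d"
  shows "coord_deriv c f p u = coord_deriv d f p (coord_deriv c (snd d) p u)"
  using dw_eqI[OF thick_half_plane snd_in_half_plane[OF assms(2,4)]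
      coord_deriv_change'[OF assms(2-5) diff_atD(1)[OF assms(1,3,5)]]]
  by (simp add: coord_deriv_eq[OF assms(2,4)])

section \<open>Invariance of the boundary\<close>

text \<open>If the point were interior in the chart \<open>d\<close>, the second coordinate of the
  transition from \<open>d\<close> to \<open>c\<close> would attain its minimum 0 there on an open
  set. Its differential would vanish, against the positive Jacobian determinant.\<close>

lemma boundary_chart_change:
  assumes "c \<in> A" "d \<in> A" "p \<in> fst c" "p \<in> fst d" "snd c p $ 2 = 0"
  shows "snd d p $ 2 = 0"
proof (rule ccontr)
  assume "snd d p $ 2 \<noteq> 0"
  then have pos: "snd d p $ 2 > 0"
    using snd_in_half_plane[OF assms(2,4)] by (simp add: half_plane_def)
  obtain T where T: "open T" "overlap d c = half_plane \<inter> T"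
    using openin_overlap[OF assms(2,1)] by (auto simp: openin_open)
  define S where "S = T \<inter> {x. x $ 2 > 0}"
  have S: "open S" "snd d p \<in> S" "S \<subseteq> overlap d c"
    using T pos assms open_halfspace_component_gt_cart by (auto simp: S_def half_plane_def)
  have "at (snd d p) within half_plane = at (snd d p)"
    by (intro at_within_interior interiorI[OF S(1,2)]) (use S(3) T in blast)
  with trans_has_derivative[OF assms(2,1,4,3)]
  have "(trans d c has_derivative coord_deriv d (snd c) p) (at (snd d p))" by simp
  then have "((\<lambda>x. trans d c x $ 2) has_derivative (\<lambda>u. coord_deriv d (snd c) p u $ 2)) (at (snd d p))"
    by (rule bounded_linear.has_derivative[OF bounded_linear_vec_nth])
  then have "(\<lambda>u. coord_deriv d (snd c) p u $ 2) = (\<lambda>v. 0)"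
  proof (rule differential_zero_maxmin[OF S(2,1)])
    show "(\<forall>y\<in>S. trans d c y $ 2 \<le> trans d c (snd d p) $ 2) \<or> (\<forall>y\<in>S. trans d c (snd d p) $ 2 \<le> trans d c y $ 2)"
    proof (intro disjI2 ballI)
      fix y assume "y \<in> S"
      then obtain q where q: "q \<in> fst d" "q \<in> fst c" "y = snd d q" using S by blast
      then show "trans d c (snd d p) $ 2 \<le> trans d c y $ 2"
        using snd_in_half_plane[OF assms(1) q(2)] assms by (simp add: chart_inv_chart half_plane_def)
    qed
  qed
  then show False
    using det_trans_pos[OF assms(2,1,4,3)] by (simp add: det_matrix_2 fun_eq_iff)
qed

text \<open>The Jacobian matrix is upper triangular with positive diagonal: the boundary is
  preserved, so the tangential direction stays tangential; the half-plane is preserved, so the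
  inward derivative is nonnegative; and the positive determinant excludes zero and fixes both
  signs.\<close>

lemma boundary_trans:
  assumes "c \<in> A" "d \<in> A" "p \<in> fst c" "p \<in> fst d" "snd c p $ 2 = 0"
  obtains l m where "l > 0" "m > 0" "coord_deriv c (snd d) p (axis 1 1) = l *\<^sub>R axis 1 1"
    "\<And>u. coord_deriv c (snd d) p u $ 2 = m * u $ 2"
proof -
  define L where "L = coord_deriv c (snd d) p"
  let ?x = "snd c p"
  have lin: "linear L" unfolding L_def by (rule linear_trans[OF assms(1-4)])
  have D: "((\<lambda>x. trans c d x $ 2) has_derivative (\<lambda>u. L u $ 2)) (at ?x within half_plane)"
    unfolding L_def by (rule bounded_linear.has_derivative[OF bounded_linear_vec_nth trans_has_derivative[OF assms(1-4)]])
  \<comment> \<open>Derivative of the second coordinate along a line through the point: two-sided in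
    the boundary direction, one-sided with \<open>S = {0..}\<close> in the inward direction.\<close>
  have line: "((\<lambda>s. trans c d (?x + s *\<^sub>R v) $ 2) has_real_derivative L v $ 2) (at 0 within S)"
    if "\<And>s. s \<in> S \<Longrightarrow> ?x + s *\<^sub>R v \<in> half_plane" for v S
  proof -
    have "((\<lambda>s. ?x + s *\<^sub>R v) has_derivative (\<lambda>s. s *\<^sub>R v)) (at 0 within S)"
      by (auto intro!: derivative_eq_intros)
    from has_derivative_in_compose[OF this, of "\<lambda>x. trans c d x $ 2"] has_derivative_subset[OF D, of "(\<lambda>s. ?x + s *\<^sub>R v) ` S"] that
    have "((\<lambda>s. trans c d (?x + s *\<^sub>R v) $ 2) has_derivative (\<lambda>s. L (s *\<^sub>R v) $ 2)) (at 0 within S)"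
      by auto
    then show ?thesis
      unfolding has_field_derivative_def
      by (rule has_derivative_eq_rhs) (auto simp: linear_cmul[OF lin])
  qed
  obtain T where T: "open T" "overlap c d = half_plane \<inter> T"
    using openin_overlap[OF assms(1,2)] by (auto simp: openin_open)
  have xT: "?x \<in> T" using T assms by blast
  have ev: "\<forall>\<^sub>F s in at 0 within S. ?x + s *\<^sub>R v \<in> T" for v S
  proof -
    have "((\<lambda>s. ?x + s *\<^sub>R v) \<longlongrightarrow> ?x + 0 *\<^sub>R v) (at 0 within S)" by (intro tendsto_intros)
    then show ?thesis using T(1) xT by (simp add: topological_tendstoD)
  qed
  have "L (axis 1 1) $ 2 = 0"
  proof -
    have h: "?x + s *\<^sub>R axis 1 1 \<in> half_plane" for s
      using assms(5) by (simp add: half_plane_def axis_def)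
    have "((\<lambda>s. 0) has_real_derivative L (axis 1 1) $ 2) (at 0)"
    proof (rule has_field_derivative_cong_eventually[THEN iffD1, OF _ _ line[of UNIV "axis 1 1"]])
      show "\<forall>\<^sub>F s in at 0. trans c d (?x + s *\<^sub>R axis 1 1) $ 2 = 0"
        using ev[of "axis 1 1" UNIV]
      proof eventually_elim
        case (elim s)
        then have "?x + s *\<^sub>R axis 1 1 \<in> overlap c d" using h T by blast
        then obtain q where q: "q \<in> fst c" "q \<in> fst d" "?x + s *\<^sub>R axis 1 1 = snd c q" by auto
        have "snd c q $ 2 = 0" using assms(5) unfolding q(3)[symmetric] by (simp add: axis_def)
        then show ?case
          unfolding q(3) using boundary_chart_change[OF assms(1,2) q(1,2)] assms by (simp add: chart_inv_chart q)
      qed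
      show "trans c d (?x + 0 *\<^sub>R axis 1 1) $ 2 = 0"
        using boundary_chart_change[OF assms] assms by (simp add: chart_inv_chart)
    qed (use h in auto)
    then show ?thesis using DERIV_unique DERIV_const by blast
  qed
  moreover have "0 \<le> L (axis 2 1) $ 2"
  proof (rule ccontr)
    assume "\<not> 0 \<le> L (axis 2 1) $ 2"
    moreover have h: "?x + s *\<^sub>R axis 2 1 \<in> half_plane" if "s \<in> {0..}" for s
      using assms(5) that by (simp add: half_plane_def axis_def)
    ultimately obtain e where e: "e > 0"
      "\<forall>h>0. 0 + h \<in> {0..} \<longrightarrow> h < e \<longrightarrow> trans c d (?x + 0 *\<^sub>R axis 2 1) $ 2 > trans c d (?x + (0 + h) *\<^sub>R axis 2 1) $ 2"
      using has_real_derivative_neg_dec_right[OF line[of "{0..}" "axis 2 1"]] by force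
    obtain e' where e': "e' > 0" "\<And>s. s \<in> {0..} \<Longrightarrow> s \<noteq> 0 \<Longrightarrow> dist s 0 < e' \<Longrightarrow> ?x + s *\<^sub>R axis 2 1 \<in> T"
      using ev[of "axis 2 1" "{0..}"] unfolding eventually_at by metis
    \<comment> \<open>Small enough both for the strict decrease and for staying in the overlap,
      where the second coordinate cannot become negative.\<close>
    define s where "s = min e e' / 2"
    have s: "s > 0" "s < e" "s < e'" using e(1) e'(1) by (auto simp: s_def min_def)
    have "?x + s *\<^sub>R axis 2 1 \<in> overlap c d" using h T e'(2)[of s] s by (auto simp: dist_real_def)
    then obtain q where q: "q \<in> fst c" "q \<in> fst d" "?x + s *\<^sub>R axis 2 1 = snd c q" by auto
    have "trans c d (?x + s *\<^sub>R axis 2 1) $ 2 \<ge> 0"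
      unfolding q(3) using snd_in_half_plane[OF assms(2) q(2)] assms by (simp add: chart_inv_chart q half_plane_def)
    moreover have "trans c d ?x $ 2 = 0"
      using boundary_chart_change[OF assms] assms by (simp add: chart_inv_chart)
    moreover have "trans c d ?x $ 2 > trans c d (?x + s *\<^sub>R axis 2 1) $ 2"
      using e(2)[rule_format, of s] s by simp
    ultimately show False by simp
  qed
  moreover have "0 < det (matrix L)" unfolding L_def by (rule det_trans_pos[OF assms(1-4)])
  ultimately have *: "0 < L (axis 1 1) $ 1 * L (axis 2 1) $ 2" "0 \<le> L (axis 2 1) $ 2" "L (axis 1 1) $ 2 = 0"
    by (auto simp: det_matrix_2)
  then have pos: "L (axis 2 1) $ 2 > 0" "L (axis 1 1) $ 1 > 0"
    by (auto simp: zero_less_mult_iff)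
  have "L (axis 1 1) = L (axis 1 1) $ 1 *\<^sub>R axis 1 1"
    using * by (simp add: vec_eq_iff forall_2 axis_def)
  moreover have "L u $ 2 = L (axis 2 1) $ 2 * u $ 2" for u
    using linear_vec2[OF lin, of u] * by simp
  ultimately show thesis using that pos unfolding L_def by blast
qed

end

section \<open>Integration over the half-plane\<close>

lemma continuous_on_local_openin:
  fixes f :: "'a::t2_space \<Rightarrow> 'b::topological_space"
  assumes "\<And>x. x \<in> S \<Longrightarrow> \<exists>W. openin (top_of_set S) W \<and> x \<in> W \<and> continuous_on W f"
  shows "continuous_on S f"
  unfolding continuous_on_eq_continuous_within
proof
  fix x assume "x \<in> S"
  then obtain W where W: "openin (top_of_set S) W" "x \<in> W" "continuous_on W f" using assms by blast
  then have "continuous (at x within W) f" by (simp add: continuous_on_eq_continuous_within)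
  then show "continuous (at x within S) f" by (simp add: at_within_openin[OF W(1,2)])
qed

section \<open>Extension by zero\<close>

text \<open>Chart images are arbitrary relatively open subsets of the half-plane. Extending
  compactly supported integrands by zero reduces integrals over them to boxes, where continuity
  gives integrability.\<close>

definition zero_ext :: "'e set \<Rightarrow> ('e \<Rightarrow> real) \<Rightarrow> 'e \<Rightarrow> real" where
  "zero_ext U f x = (if x \<in> U then f x else 0)"

lemma openin_minus_compact: "compact K \<Longrightarrow> openin (top_of_set H) (H - K)" for H :: "'e::t2_space set"
  using compact_imp_closed[of K] by (auto simp: openin_open intro!: exI[of _ "- K"])

text \<open>The relatively open sets \<open>U\<close> and \<open>H - K\<close> cover
  \<open>H\<close>, and on the second one the extension vanishes.\<close>

lemma continuous_on_zero_ext: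
  fixes U :: "'e::euclidean_space set"
  assumes U: "openin (top_of_set H) U" and K: "compact K" "K \<subseteq> U"
    and f: "continuous_on U f" "\<And>x. x \<in> U - K \<Longrightarrow> f x = 0"
  shows "continuous_on H (zero_ext U f)"
proof (rule continuous_on_local_openin)
  fix x assume x: "x \<in> H"
  show "\<exists>W. openin (top_of_set H) W \<and> x \<in> W \<and> continuous_on W (zero_ext U f)"
  proof (cases "x \<in> U")
    case True
    have "continuous_on U (zero_ext U f)" using f(1) by (rule continuous_on_eq) (simp add: zero_ext_def)
    then show ?thesis using U True by blast
  next
    case False
    have "continuous_on (H - K) (zero_ext U f)"
      by (rule continuous_on_eq[OF continuous_on_const[of _ 0]]) (use f(2) in \<open>auto simp: zero_ext_def\<close>)
    then show ?thesis using openin_minus_compact[OF K(1)] x False K(2) by (intro exI[of _ "H - K"]) auto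
  qed
qed

lemma smooth_on_zero_ext:
  assumes U: "openin (top_of_set H) U" and K: "compact K" "K \<subseteq> U"
    and f: "smooth_on U f" "\<And>x. x \<in> U - K \<Longrightarrow> f x = 0"
  shows "smooth_on H (zero_ext U f)"
proof (rule smooth_on_local_openin)
  fix x assume x: "x \<in> H"
  show "\<exists>W. openin (top_of_set H) W \<and> x \<in> W \<and> smooth_on W (zero_ext U f)"
  proof (cases "x \<in> U")
    case True
    have "smooth_on U (zero_ext U f)" using f(1) by (rule smooth_on_cong) (simp add: zero_ext_def)
    then show ?thesis using U True by blast
  next
    case False
    have "smooth_on (H - K) (zero_ext U f)"
      by (rule smooth_on_cong[OF smooth_on_const[of _ 0]]) (use f(2) in \<open>auto simp: zero_ext_def\<close>)
    then show ?thesis using openin_minus_compact[OF K(1)] x False K(2) by (intro exI[of _ "H - K"]) auto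
  qed
qed

lemma dw_zero:
  assumes "thick H" "openin (top_of_set H) U" "compact K" "\<And>x. x \<in> U - K \<Longrightarrow> f x = 0" "x \<in> U - K"
  shows "dw H f x v = 0"
proof -
  have "x \<in> H" using assms(2,5) openin_imp_subset by blast
  moreover have "openin (top_of_set H) (U - K)"
    using openin_minus_compact[OF assms(3), of U] assms(2) openin_trans by blast
  ultimately show ?thesis
    using dw_cong[of H "U - K" x f "\<lambda>_. 0"] assms by (auto simp: dw_const)
qed

lemma dw_zero_ext:
  assumes "thick H" and U: "openin (top_of_set H) U" and K: "compact K" "K \<subseteq> U"
    and f: "\<And>x. x \<in> U - K \<Longrightarrow> f x = 0" and x: "x \<in> H"
  shows "dw H (zero_ext U f) x v = zero_ext U (\<lambda>x. dw H f x v) x"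
proof (cases "x \<in> U")
  case True
  then show ?thesis using dw_cong[OF U True, of "zero_ext U f" f] by (simp add: zero_ext_def)
next
  case False
  have "dw H (zero_ext U f) x v = 0"
    by (rule dw_zero[of H H K]) (use assms False in \<open>auto simp: zero_ext_def\<close>)
  then show ?thesis using False by (simp add: zero_ext_def)
qed

lemma integral_zero_ext:
  fixes U Q :: "'e::euclidean_space set"
  assumes "\<And>x. x \<in> U - Q \<Longrightarrow> f x = 0"
  shows "integral U f = integral Q (zero_ext U f)"
proof -
  have "integral U f = integral UNIV (\<lambda>x. if x \<in> U then f x else 0)"
    by (simp only: Henstock_Kurzweil_Integration.integral_restrict_UNIV)
  also have "(\<lambda>x. if x \<in> U then f x else 0) = (\<lambda>x. if x \<in> Q then zero_ext U f x else 0)"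
    using assms by (auto simp: zero_ext_def)
  also have "integral UNIV \<dots> = integral Q (zero_ext U f)"
    by (simp only: Henstock_Kurzweil_Integration.integral_restrict_UNIV)
  finally show ?thesis .
qed

section \<open>Half-boxes and iterated integrals\<close>

abbreviation hbox :: "real \<Rightarrow> (real^2) set" where
  "hbox B \<equiv> cbox (vector [-B, 0]) (vector [B, B])"

lemma hbox_iff: "x \<in> hbox B \<longleftrightarrow> -B \<le> x $ 1 \<and> x $ 1 \<le> B \<and> 0 \<le> x $ 2 \<and> x $ 2 \<le> B"
  by (auto simp: mem_box_cart forall_2)

lemma exists_2: "(\<exists>i::2. P i) \<longleftrightarrow> P 1 \<or> P 2"
  using forall_2[of "\<lambda>i. \<not> P i"] by blast

lemma hbox_subset: "hbox B \<subseteq> half_plane"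
  by (auto simp: hbox_iff half_plane_def)

text \<open>Strictness keeps \<open>K\<close> away from the left, right and upper edges; only the
  lower edge, which lies on the boundary line, may be touched, and it will carry the boundary
  term.\<close>

lemma compact_in_hbox:
  assumes "compact K" "K \<subseteq> half_plane"
  obtains B where "B > 0" "K \<subseteq> hbox B" "\<And>x. x \<in> K \<Longrightarrow> \<bar>x $ 1\<bar> < B" "\<And>x. x \<in> K \<Longrightarrow> x $ 2 < B"
proof -
  obtain B where B: "B > 0" "\<And>x. x \<in> K \<Longrightarrow> norm x \<le> B"
    using compact_imp_bounded[OF assms(1)] bounded_pos by blast
  have le: "\<bar>x $ 1\<bar> \<le> B \<and> \<bar>x $ 2\<bar> \<le> B \<and> 0 \<le> x $ 2" if "x \<in> K" for x
    using B(2)[OF that] component_le_norm_cart[of x 1] component_le_norm_cart[of x 2] subsetD[OF assms(2) that]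
    unfolding half_plane_def by simp
  show thesis
  proof (rule that[of "B + 1"])
    show "K \<subseteq> hbox (B + 1)" 
    proof
      show "x \<in> hbox (B + 1)" if "x \<in> K" for x using le[OF that] unfolding hbox_iff by linarith
    qed
    show "\<bar>x $ 1\<bar> < B + 1" "x $ 2 < B + 1" if "x \<in> K" for x using le[OF that] by linarith+
  qed (use B in simp)
qed

lemma absolutely_integrable_zero_ext:
  fixes U :: "(real^2) set" and f :: "real^2 \<Rightarrow> real"
  assumes U: "openin (top_of_set half_plane) U" and K: "compact K" "K \<subseteq> U"
    and f: "continuous_on U f" "\<And>x. x \<in> U - K \<Longrightarrow> f x = 0"
  shows "f absolutely_integrable_on U"
proof -
  have sub: "K \<subseteq> half_plane" using K U openin_imp_subset by blast
  obtain B where B: "K \<subseteq> hbox B" by (rule compact_in_hbox[OF K(1) sub])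
  have "zero_ext U f absolutely_integrable_on hbox B"
    by (rule absolutely_integrable_continuous, rule continuous_on_subset[OF continuous_on_zero_ext[OF assms] hbox_subset])
  then have "(\<lambda>x. if x \<in> hbox B then zero_ext U f x else 0) absolutely_integrable_on UNIV"
    by (simp only: absolutely_integrable_restrict_UNIV)
  moreover have "(\<lambda>x. if x \<in> hbox B then zero_ext U f x else 0) = (\<lambda>x. if x \<in> U then f x else 0)"
    using B f(2) by (auto simp: zero_ext_def fun_eq_iff)
  ultimately show ?thesis by (simp only: absolutely_integrable_restrict_UNIV)
qed

text \<open>The coordinate bijection between \<open>real^2\<close> and
  \<open>real \<times> real\<close> maps boxes to boxes of equal content, so the iterated integrals
  of the product type carry over.\<close>

lemma Fubini_hbox:
  fixes g :: "real^2 \<Rightarrow> real"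
  assumes B: "B > 0" and g: "continuous_on (hbox B) g"
  shows "integral (hbox B) g = integral {-B..B} (\<lambda>s. integral {0..B} (\<lambda>t. g (vector [s, t])))"
    and "integral (hbox B) g = integral {0..B} (\<lambda>t. integral {-B..B} (\<lambda>s. g (vector [s, t])))"
proof -
  let ?v = "\<lambda>z :: real \<times> real. vector [fst z, snd z] :: real^2"
  let ?h = "\<lambda>x :: real^2. (x $ 1, x $ 2)"
  have v_cbox: "?v ` cbox u w = cbox (?v u) (?v w)" for u w
  proof (intro set_eqI iffI)
    fix x assume "x \<in> cbox (?v u) (?v w)"
    then have "?h x \<in> cbox u w" "x = ?v (?h x)"
      by (auto simp: mem_box_cart forall_2 cbox_Pair_eq[of "fst u" "snd u" "fst w" "snd w", simplified] vec_eq_iff)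
    then show "x \<in> ?v ` cbox u w" by blast
  qed (auto simp: mem_box_cart forall_2 cbox_Pair_eq[of "fst u" "snd u" "fst w" "snd w", simplified])
  have h_cbox: "?h ` cbox u w = cbox (?h u) (?h w)" for u w
  proof (intro set_eqI iffI)
    fix z assume "z \<in> cbox (?h u) (?h w)"
    then have "?v z \<in> cbox u w" "z = ?h (?v z)"
      by (auto simp: mem_box_cart forall_2 cbox_Pair_eq)
    then show "z \<in> ?h ` cbox u w" by blast
  qed (auto simp: mem_box_cart forall_2 cbox_Pair_eq)
  have cont: "continuous_on UNIV ?v"
  proof -
    have "?v = (\<lambda>z. fst z *\<^sub>R axis 1 1 + snd z *\<^sub>R axis 2 1)"
      by (auto simp: vec_eq_iff forall_2 axis_def)
    then show ?thesis by (simp only:) (intro continuous_intros)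
  qed
  \<comment> \<open>The factor \<open>1 / 1\<close> is the ratio of contents in the substitution
    rule.\<close>
  have "((\<lambda>z. g (?v z)) has_integral (1 / 1) *\<^sub>R integral (hbox B) g) (?h ` hbox B)"
  proof (rule has_integral_twiddle)
    show "?h (?v z) = z" for z by simp
    show "?v (?h x) = x" for x by (simp add: vec_eq_iff forall_2)
    show "continuous (at z) ?v" for z
      by (rule bspec[OF continuous_on_eq_continuous_at[OF open_UNIV, THEN iffD1, OF cont]]) simp
    show "\<exists>w z. ?v ` cbox a b = cbox w z" for a b using v_cbox by blast
    show "\<exists>w z. ?h ` cbox a b = cbox w z" for a b using h_cbox by blast
    show "measure lborel (?v ` cbox a b) = 1 * measure lborel (cbox a b)" for a b
      unfolding v_cbox content_cbox_if_cart
      by (cases a; cases b) (auto simp: content_Pair UNIV_2 interval_eq_empty_cart exists_2)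
    show "(g has_integral integral (hbox B) g) (hbox B)"
      using integrable_continuous[OF g] by (rule integrable_integral)
  qed simp
  then have I: "integral (hbox B) g = integral (cbox (-B, 0) (B, B)) (\<lambda>z. g (?v z))"
    unfolding h_cbox by (simp add: integral_unique)
  have sub: "?v ` cbox (-B, 0) (B, B) \<subseteq> hbox B" unfolding v_cbox by simp
  have c: "continuous_on (cbox (-B, 0) (B, B)) (\<lambda>z. g (?v z))"
    by (rule continuous_on_compose2[OF g continuous_on_subset[OF cont]]) (use sub in auto)
  show 1: "integral (hbox B) g = integral {-B..B} (\<lambda>s. integral {0..B} (\<lambda>t. g (vector [s, t])))"
    unfolding I using integral_prod_continuous[OF c] by simp
  have "continuous_on (cbox (-B, 0) (B, B)) (\<lambda>(s, t). g (vector [s, t]))"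
    using c by (simp add: case_prod_beta')
  from integral_swap_continuous[OF this]
  show "integral (hbox B) g = integral {0..B} (\<lambda>t. integral {-B..B} (\<lambda>s. g (vector [s, t])))"
    unfolding 1 by simp
qed

lemma half_plane_line:
  fixes f :: "real^2 \<Rightarrow> real"
  assumes "smooth_on half_plane f" "x \<in> half_plane" "s \<in> S" "\<And>s. s \<in> S \<Longrightarrow> x + (s - a) *\<^sub>R v \<in> half_plane"
  shows "((\<lambda>s. f (x + (s - a) *\<^sub>R v)) has_vector_derivative dw half_plane f (x + (s - a) *\<^sub>R v) v) (at s within S)"
proof -
  let ?g = "\<lambda>s. x + (s - a) *\<^sub>R v"
  have D: "(f has_derivative dw half_plane f (?g s)) (at (?g s) within half_plane)"
    by (rule smooth_on_has_derivative[OF thick_half_plane _ assms(1)]) (use assms in auto)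
  have "(?g has_derivative (\<lambda>s. s *\<^sub>R v)) (at s within S)"
    by (auto intro!: derivative_eq_intros)
  from has_derivative_in_compose[OF this, of f] has_derivative_subset[OF D, of "?g ` S"] assms(4)
  have "((\<lambda>s. f (?g s)) has_derivative (\<lambda>h. dw half_plane f (?g s) (h *\<^sub>R v))) (at s within S)"
    by auto
  then show ?thesis
    unfolding has_vector_derivative_def
    by (rule has_derivative_eq_rhs) (auto simp: linear_cmul[OF has_derivative_linear[OF D]])
qed

section \<open>Green's theorem and differentiation under the integral\<close>

text \<open>Green's theorem for the 1-form \<open>P dx_1 + Q dx_2\<close> with compact support.
  Integrating the derivative of \<open>Q\<close> along horizontal lines gives values at the side
  edges, which vanish; integrating that of \<open>P\<close> along vertical lines leaves the lower
  edge, with the sign of the boundary orientation by the first coordinate.\<close>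

lemma Stokes_half_plane:
  fixes P Q :: "real^2 \<Rightarrow> real"
  assumes U: "openin (top_of_set half_plane) U" and K: "compact K" "K \<subseteq> U"
    and P: "smooth_on U P" "\<And>x. x \<in> U - K \<Longrightarrow> P x = 0"
    and Q: "smooth_on U Q" "\<And>x. x \<in> U - K \<Longrightarrow> Q x = 0"
  shows "integral U (\<lambda>x. dw half_plane Q x (axis 1 1) - dw half_plane P x (axis 2 1)) =
    integral {s. vector [s, 0] \<in> U} (\<lambda>s. P (vector [s, 0]))"
proof -
  have sub: "U \<subseteq> half_plane" using U openin_imp_subset by blast
  obtain B where B: "B > 0" "K \<subseteq> hbox B" "\<And>x. x \<in> K \<Longrightarrow> \<bar>x $ 1\<bar> < B" "\<And>x. x \<in> K \<Longrightarrow> x $ 2 < B"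
    by (rule compact_in_hbox[OF K(1) subset_trans[OF K(2) sub]]) (rule that)
  define P' where "P' = zero_ext U P"
  define Q' where "Q' = zero_ext U Q"
  have sP: "smooth_on half_plane P'" unfolding P'_def by (rule smooth_on_zero_ext[OF U K P])
  have sQ: "smooth_on half_plane Q'" unfolding Q'_def by (rule smooth_on_zero_ext[OF U K Q])
  have zP: "P' x = 0" if "x \<notin> K" for x using that P(2) by (auto simp: P'_def zero_ext_def)
  have zQ: "Q' x = 0" if "x \<notin> K" for x using that Q(2) by (auto simp: Q'_def zero_ext_def)
  have c: "continuous_on (hbox B) (\<lambda>x. dw half_plane f x v)" if "smooth_on half_plane f" for f :: "real^2 \<Rightarrow> real" and v
    by (rule continuous_on_subset[OF smooth_on_continuous[OF smooth_on_dw[OF thick_half_plane _ that]] hbox_subset]) simp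
  have line1: "integral {-B..B} (\<lambda>s. dw half_plane f (vector [s, t]) (axis 1 1)) = f (vector [B, t]) - f (vector [-B, t])"
    if f: "smooth_on half_plane f" and t: "t \<ge> 0" for f :: "real^2 \<Rightarrow> real" and t
  proof (rule integral_unique, rule fundamental_theorem_of_calculus)
    fix s assume s: "s \<in> {-B..B}"
    have e: "vector [0, t] + (s - 0) *\<^sub>R (axis 1 1 :: real^2) = vector [s, t]" for s
      by (simp add: vec_eq_iff forall_2 axis_def)
    show "((\<lambda>s. f (vector [s, t])) has_vector_derivative dw half_plane f (vector [s, t]) (axis 1 1)) (at s within {-B..B})"
      using half_plane_line[OF f, of "vector [0, t]" s "{-B..B}" 0 "axis 1 1"] s t
      unfolding e by (simp add: half_plane_def)
  qed (use B in auto)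
  have line2: "integral {0..B} (\<lambda>t. dw half_plane f (vector [s, t]) (axis 2 1)) = f (vector [s, B]) - f (vector [s, 0])"
    if f: "smooth_on half_plane f" for f :: "real^2 \<Rightarrow> real" and s
  proof (rule integral_unique, rule fundamental_theorem_of_calculus)
    fix t assume t: "t \<in> {0..B}"
    have e: "vector [s, 0] + (t - 0) *\<^sub>R (axis 2 1 :: real^2) = vector [s, t]" for t
      by (simp add: vec_eq_iff forall_2 axis_def)
    show "((\<lambda>t. f (vector [s, t])) has_vector_derivative dw half_plane f (vector [s, t]) (axis 2 1)) (at t within {0..B})"
      using half_plane_line[OF f, of "vector [s, 0]" t "{0..B}" 0 "axis 2 1"] t
      unfolding e by (simp add: half_plane_def)
  qed (use B in auto)
  have "integral U (\<lambda>x. dw half_plane Q x (axis 1 1) - dw half_plane P x (axis 2 1)) =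
    integral (hbox B) (zero_ext U (\<lambda>x. dw half_plane Q x (axis 1 1) - dw half_plane P x (axis 2 1)))"
  proof (rule integral_zero_ext)
    fix x assume "x \<in> U - hbox B"
    then have "x \<in> U - K" using B(2) by blast
    then show "dw half_plane Q x (axis 1 1) - dw half_plane P x (axis 2 1) = 0"
      using dw_zero[OF thick_half_plane U K(1) P(2)] dw_zero[OF thick_half_plane U K(1) Q(2)] by simp
  qed
  also have "\<dots> = integral (hbox B) (\<lambda>x. dw half_plane Q' x (axis 1 1) - dw half_plane P' x (axis 2 1))"
    by (rule integral_cong)
      (use hbox_subset dw_zero_ext[OF thick_half_plane U K P(2)] dw_zero_ext[OF thick_half_plane U K Q(2)] in
        \<open>force simp: P'_def Q'_def zero_ext_def\<close>)
  also have "\<dots> = integral (hbox B) (\<lambda>x. dw half_plane Q' x (axis 1 1)) - integral (hbox B) (\<lambda>x. dw half_plane P' x (axis 2 1))"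
    by (intro integral_diff integrable_continuous c sP sQ)
  also have "integral (hbox B) (\<lambda>x. dw half_plane Q' x (axis 1 1)) = integral {0..B} (\<lambda>t. 0)"
    unfolding Fubini_hbox(2)[OF B(1) c[OF sQ]]
  proof (rule integral_cong)
    fix t assume "t \<in> {0..B}"
    then show "integral {-B..B} (\<lambda>s. dw half_plane Q' (vector [s, t]) (axis 1 1)) = 0"
      using line1[OF sQ, of t] zQ[of "vector [B, t]"] zQ[of "vector [-B, t]"] B(3) by fastforce
  qed
  also have "integral (hbox B) (\<lambda>x. dw half_plane P' x (axis 2 1)) = integral {-B..B} (\<lambda>s. - P' (vector [s, 0]))"
    unfolding Fubini_hbox(1)[OF B(1) c[OF sP]]
  proof (rule integral_cong)
    fix s assume "s \<in> {-B..B}"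
    show "integral {0..B} (\<lambda>t. dw half_plane P' (vector [s, t]) (axis 2 1)) = - P' (vector [s, 0])"
      using line2[OF sP, of s] zP[of "vector [s, B]"] B(4) by fastforce
  qed
  also have "integral {0..B} (\<lambda>t. 0) - integral {-B..B} (\<lambda>s. - P' (vector [s, 0])) = integral {-B..B} (\<lambda>s. P' (vector [s, 0]))"
    by simp
  also have "(\<lambda>s. P' (vector [s, 0])) = zero_ext {s. vector [s, 0] \<in> U} (\<lambda>s. P (vector [s, 0]))"
    by (auto simp: P'_def zero_ext_def)
  also have "integral {-B..B} \<dots> = integral {s. vector [s, 0] \<in> U} (\<lambda>s. P (vector [s, 0]))"
  proof (rule integral_zero_ext[symmetric])
    fix s assume "s \<in> {s. vector [s, 0] \<in> U} - {- B..B}"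
    then show "P (vector [s, 0]) = 0"
      using B(3)[of "vector [s, 0]"] P(2)[of "vector [s, 0]"] by fastforce
  qed
  finally show ?thesis .
qed

text \<open>\<open>F\<close> is smooth only on \<open>S\<close>, which may shrink towards time 0 as
  \<open>x\<close> leaves \<open>K\<close>. The tube lemma gives an interval \<open>I\<close> with
  \<open>I \<times> K\<close> inside \<open>S\<close>, and off \<open>K\<close> the weight
  \<open>w\<close> vanishes, so the weighted integrand extended by zero is jointly continuous on
  \<open>I\<close> times the half-plane.\<close>

lemma Leibniz_half_plane:
  fixes F :: "real \<times> (real^2) \<Rightarrow> real"
  assumes U: "openin (top_of_set half_plane) U" and K: "compact K" "K \<subseteq> U"
    and w: "continuous_on U w" "\<And>x. x \<in> U - K \<Longrightarrow> w x = 0"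
    and S: "openin (top_of_set (UNIV \<times> half_plane)) S" "{0} \<times> K \<subseteq> S" "S \<subseteq> UNIV \<times> U"
    and F: "smooth_on S F"
  shows "((\<lambda>t. integral U (\<lambda>x. w x * F (t, x))) has_real_derivative
      integral U (\<lambda>x. w x * dw (UNIV \<times> half_plane) F (0, x) (1, 0))) (at 0)"
proof -
  let ?H = "UNIV \<times> half_plane :: (real \<times> (real^2)) set"
  let ?F' = "\<lambda>z. dw ?H F z (1, 0)"
  have tH: "thick ?H" by (intro thick_Times thick_UNIV thick_half_plane)
  have sub: "U \<subseteq> half_plane" using U openin_imp_subset by blast
  obtain B where B: "B > 0" "K \<subseteq> hbox B"
    by (rule compact_in_hbox[OF K(1) subset_trans[OF K(2) sub]]) (rule that)
  obtain T where T: "open T" "S = ?H \<inter> T" using S(1) by (auto simp: openin_open)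
  obtain X where X: "0 \<in> X" "open X" "X \<times> K \<subseteq> T"
    using Elementary_Topology.tube_lemma[OF K(1) T(1), of 0] S(2) T(2) by blast
  obtain e where e: "e > 0" "ball 0 e \<subseteq> X" using X openE by blast
  define I where "I = ball (0::real) e"
  have I: "open I" "0 \<in> I" "convex I" "I \<times> K \<subseteq> S"
    using e X(3) T K(2) sub by (auto simp: I_def)
  have F': "smooth_on S ?F'" by (rule smooth_on_dw[OF tH S(1) F])
  define g where "g G t x = zero_ext U (\<lambda>x. w x * G (t, x)) x" for G :: "real \<times> (real^2) \<Rightarrow> real" and t x
  \<comment> \<open>Stated for an arbitrary \<open>G\<close> because it is used for \<open>F\<close>
    as well as for its time derivative.\<close>
  have cont: "continuous_on (I \<times> half_plane) (\<lambda>(t, x). g G t x)" if G: "smooth_on S G" for G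
  proof (rule continuous_on_local_openin)
    fix z assume z: "z \<in> I \<times> half_plane"
    show "\<exists>W. openin (top_of_set (I \<times> half_plane)) W \<and> z \<in> W \<and> continuous_on W (\<lambda>(t, x). g G t x)"
    proof (cases "snd z \<in> K")
      case True
      let ?W = "(I \<times> half_plane) \<inter> T"
      have WS: "?W \<subseteq> S" using T by blast
      have "continuous_on ?W (\<lambda>z. w (snd z) * G z)"
        by (intro continuous_on_mult continuous_on_subset[OF smooth_on_continuous[OF G] WS]
            continuous_on_compose2[OF w(1) continuous_on_snd[OF continuous_on_id]])
          (use subset_trans[OF WS S(3)] in auto)
      then have "continuous_on ?W (\<lambda>(t, x). g G t x)"
        by (rule continuous_on_eq) (use WS S(3) in \<open>force simp: g_def zero_ext_def\<close>)
      moreover have "z \<in> ?W" using True z X(3) e by (cases z) (auto simp: I_def)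
      ultimately show ?thesis using T(1) by (intro exI[of _ ?W]) (auto simp: openin_open)
    next
      case False
      let ?W = "I \<times> (half_plane - K)"
      have "continuous_on ?W (\<lambda>(t, x). g G t x)"
        by (rule continuous_on_eq[OF continuous_on_const[of _ 0]]) (use w(2) in \<open>auto simp: g_def zero_ext_def\<close>)
      moreover have "openin (top_of_set (I \<times> half_plane)) ?W"
        by (intro openin_Times openin_minus_compact[OF K(1)]) auto
      ultimately show ?thesis using z False by (intro exI[of _ ?W]) (auto simp: mem_Times_iff)
    qed
  qed
  have slice: "continuous_on (hbox B) (g G t)" if "smooth_on S G" "t \<in> I" for G t
  proof -
    have "continuous_on (hbox B) (Pair t)" by (intro continuous_intros)
    moreover have "Pair t ` hbox B \<subseteq> I \<times> half_plane" using hbox_subset that(2) by auto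
    ultimately show ?thesis using continuous_on_compose2[OF cont[OF that(1)], of "hbox B" "Pair t"] by simp
  qed
  have "((\<lambda>t. integral (hbox B) (g F t)) has_field_derivative integral (hbox B) (g ?F' 0)) (at 0 within I)"
  proof (rule leibniz_rule_field_derivative[OF _ _ _ I(2,3)])
    fix t and x :: "real^2" assume t: "t \<in> I" and x: "x \<in> hbox B"
    show "((\<lambda>t. g F t x) has_field_derivative g ?F' t x) (at t within I)"
    proof (cases "x \<in> K")
      case True
      then have z: "(t, x) \<in> S" "x \<in> half_plane" "x \<in> U" using t I(4) K(2) sub by auto
      from has_derivative_slice(2)[OF smooth_on_has_derivative[OF tH S(1) F z(1)] z(2)]
      have "((\<lambda>t. F (t, x)) has_real_derivative ?F' (t, x)) (at t)"
        by (simp add: has_real_derivative_iff_has_vector_derivative)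
      then have "((\<lambda>t. w x * F (t, x)) has_real_derivative w x * ?F' (t, x)) (at t within I)"
        by (rule has_field_derivative_at_within[OF DERIV_cmult])
      then show ?thesis using z(3) by (simp add: g_def zero_ext_def)
    next
      case False
      then have "(\<lambda>t. g F t x) = (\<lambda>t. 0)" "g ?F' t x = 0" using w(2) by (auto simp: g_def zero_ext_def)
      then show ?thesis by simp
    qed
  next
    show "g F t integrable_on hbox B" if "t \<in> I" for t
      by (rule integrable_continuous, rule slice[OF F that])
    show "continuous_on (I \<times> hbox B) (\<lambda>(t, x). g ?F' t x)"
      by (rule continuous_on_subset[OF cont[OF F']]) (use hbox_subset in auto)
  qed
  then have "((\<lambda>t. integral (hbox B) (g F t)) has_field_derivative integral (hbox B) (g ?F' 0)) (at 0)"
    using at_within_open[OF I(2,1)] by simp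
  moreover have "integral (hbox B) (g G t) = integral U (\<lambda>x. w x * G (t, x))" for G t
  proof -
    have "integral U (\<lambda>x. w x * G (t, x)) = integral (hbox B) (zero_ext U (\<lambda>x. w x * G (t, x)))"
      by (rule integral_zero_ext) (use B(2) w(2) in auto)
    then show ?thesis by (simp add: g_def[abs_def])
  qed
  ultimately show ?thesis by simp
qed

section \<open>Partitions of unity\<close>

text \<open>\<open>bump 0\<close> is the classical \<open>exp (- 1 / t)\<close>, cut off at 0. With
  the powers of \<open>1 / t\<close> the family is closed under differentiation up to linear
  combinations, so one induction over the order treats all members at once.\<close>

definition bump :: "nat \<Rightarrow> real \<Rightarrow> real" where
  "bump n t = (if t \<le> 0 then 0 else inverse t ^ n * exp (- inverse t))"

lemma bump_tendsto_0: "(bump n \<longlongrightarrow> 0) (at 0)"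
proof (rule filterlim_split_at)
  have "((\<lambda>t. inverse t ^ n / exp (inverse t)) \<longlongrightarrow> 0) (at_right (0::real))"
    by (rule filterlim_compose[OF tendsto_power_div_exp_0 filterlim_inverse_at_top_right])
  then show "(bump n \<longlongrightarrow> 0) (at_right 0)"
    by (rule Lim_transform_eventually)
      (auto simp: bump_def eventually_at_filter exp_minus divide_inverse)
  show "(bump n \<longlongrightarrow> 0) (at_left 0)"
    by (rule Lim_transform_eventually[OF tendsto_const[of 0]]) (auto simp: bump_def eventually_at_filter)
qed

lemma bump_has_real_derivative:
  "(bump n has_real_derivative bump (n + 2) t - of_nat n * bump (n + 1) t) (at t)"
proof -
  consider "t < 0" | "t = 0" | "t > 0" by linarith
  then show ?thesis
  proof cases
    case 1
    have "((\<lambda>_. 0) has_real_derivative bump (n + 2) t - of_nat n * bump (n + 1) t) (at t)"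
      using 1 by (simp add: bump_def)
    then show ?thesis
      by (rule has_field_derivative_transform_within_open[of _ _ _ "{..<0}"]) (use 1 in \<open>auto simp: bump_def\<close>)
  next
    case 2
    \<comment> \<open>Away from 0, the difference quotient of \<open>bump n\<close> at 0 is
      \<open>bump (n + 1)\<close>.\<close>
    have "((\<lambda>h. (bump n h - bump n 0) / (h - 0)) \<longlongrightarrow> 0) (at 0)"
      by (rule Lim_transform_eventually[OF bump_tendsto_0[of "n + 1"]])
        (auto simp: bump_def eventually_at_filter field_simps)
    then show ?thesis
      using 2 by (simp add: has_field_derivative_iff bump_def)
  next
    case 3
    \<comment> \<open>The power rule produces the natural number exponent \<open>n - Suc 0\<close>;
      the rewritten form is uniform in \<open>n\<close>, as the factor \<open>of_nat n\<close>
      vanishes for \<open>n = 0\<close>.\<close>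
    have p: "of_nat n * inverse t ^ (n - Suc 0) = of_nat n * (inverse t ^ n * t)"
      using 3 by (cases n) (simp_all add: field_simps)
    have "((\<lambda>t. inverse t ^ n * exp (- inverse t)) has_real_derivative
        (of_nat n * inverse t ^ (n - Suc 0) * - (inverse t * inverse t)) * exp (- inverse t)
        + inverse t ^ n * (exp (- inverse t) * (inverse t * inverse t))) (at t)"
      using 3 by (auto intro!: derivative_eq_intros simp: algebra_simps power2_eq_square)
    also have "(of_nat n * inverse t ^ (n - Suc 0) * - (inverse t * inverse t)) * exp (- inverse t)
        + inverse t ^ n * (exp (- inverse t) * (inverse t * inverse t)) = bump (n + 2) t - of_nat n * bump (n + 1) t"
      unfolding p using 3 by (simp add: bump_def field_simps)
    finally have "((\<lambda>t. inverse t ^ n * exp (- inverse t)) has_real_derivative bump (n + 2) t - of_nat n * bump (n + 1) t) (at t)" .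
    then show ?thesis
      by (rule has_field_derivative_transform_within_open[of _ _ _ "{0<..}"]) (use 3 in \<open>auto simp: bump_def\<close>)
  qed
qed

lemma Ck_on_bump: "Ck_on k (bump n) UNIV"
proof (induction k arbitrary: n)
  case 0
  then show ?case
    using bump_has_real_derivative by (auto simp: continuous_on_eq_continuous_at intro: DERIV_isCont)
next
  case (Suc k)
  show ?case
  proof (rule Ck_onI)
    show "(bump n has_derivative (\<lambda>v. (bump (n + 2) t - of_nat n * bump (n + 1) t) * v)) (at t)" for t
      using bump_has_real_derivative by (simp add: has_field_derivative_def)
    show "Ck_on k (\<lambda>t. (bump (n + 2) t - of_nat n * bump (n + 1) t) * v) UNIV" for v
    proof -
      have "Ck_on k (\<lambda>t. (bump (n + 2) t + (- of_nat n) * bump (n + 1) t) * v) UNIV"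
        by (rule Ck_on_bounded_bilinear[OF bounded_bilinear_mult] Ck_on_add Ck_on_const Suc open_UNIV)+
      then show ?thesis by simp
    qed
  qed simp
qed

lemma bump_pos: "bump n t > 0 \<longleftrightarrow> t > 0"
  by (simp add: bump_def)

lemma bump_nonneg: "bump n t \<ge> 0"
  by (simp add: bump_def)

lemma bump_zero: "t \<le> 0 \<Longrightarrow> bump n t = 0"
  by (simp add: bump_def)

lemma smooth_on_bump: "smooth_on S f \<Longrightarrow> smooth_on S (\<lambda>x. bump n (f x))"
  by (rule smooth_on_compose[of S f UNIV "bump n"]) (auto intro: Ck_on_imp_smooth_on[of UNIV] Ck_on_bump)

section \<open>Bump functions and partitions of unity on the surface\<close>

context surface
begin

lemma smooth_mapD: "smooth_map A f \<Longrightarrow> c \<in> A \<Longrightarrow> smooth_on (chart_image c) (\<lambda>x. f (chart_inv c x))"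
  unfolding smooth_map_def comp_def by blast

lemma smooth_mapI: "(\<And>c. c \<in> A \<Longrightarrow> smooth_on (chart_image c) (\<lambda>x. f (chart_inv c x))) \<Longrightarrow> smooth_map A f"
  unfolding smooth_map_def comp_def by blast

lemma smooth_map_diff_at: "smooth_map A f \<Longrightarrow> p \<in> topspace M \<Longrightarrow> diff_at f p"
  using chart_at[of p] diff_atI[of "chart_at A p" p f]
    smooth_on_differentiable[OF thick_half_plane surf(6), of "chart_at A p" "f \<circ> chart_inv (chart_at A p)"]
    chart_in_image[of p "chart_at A p"]
  unfolding smooth_map_def by blast

lemma smooth_on_coord_deriv:
  assumes "smooth_map A f" "c \<in> A"
  shows "smooth_on (chart_image c) (\<lambda>x. coord_deriv c f (chart_inv c x) v)"
proof (rule smooth_on_cong)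
  show "smooth_on (chart_image c) (\<lambda>x. dw half_plane (f \<circ> chart_inv c) x v)"
    using assms by (intro smooth_on_dw[OF thick_half_plane surf(6)]) (auto simp: smooth_map_def)
  show "dw half_plane (f \<circ> chart_inv c) x v = coord_deriv c f (chart_inv c x) v" if "x \<in> chart_image c" for x
    using coord_deriv_eq[OF assms(2) chart_inv_in[OF that], of f] chart_chart_inv[OF that] by simp
qed

lemma compactin_closedin: "compactin M K \<longleftrightarrow> closedin M K"
  using closedin_compact_space[OF surf(1)] compactin_imp_closedin[OF surf(2)] by blast

lemma coord_deriv_zero:
  assumes "c \<in> A" "p \<in> fst c" "closedin M K" "\<And>q. q \<in> topspace M - K \<Longrightarrow> f q = 0" "p \<notin> K"
  shows "coord_deriv c f p v = 0"
proof -
  let ?W = "snd c ` (fst c \<inter> (topspace M - K))"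
  have "openin (top_of_set half_plane) ?W"
    by (rule openin_chart_image[OF assms(1)]) (use assms(3) in blast)
  moreover have "snd c p \<in> ?W" using assms chart_subset[OF assms(1)] by blast
  moreover have "(f \<circ> chart_inv c) y = 0" if "y \<in> ?W" for y
    using that assms(4) chart_inv_chart[OF assms(1)] by auto
  ultimately have "dw half_plane (f \<circ> chart_inv c) (snd c p) = dw half_plane (\<lambda>_. 0) (snd c p)"
    by (rule dw_cong)
  then show ?thesis
    using coord_deriv_eq[OF assms(1,2), of f] dw_const[OF thick_half_plane snd_in_half_plane[OF assms(1,2)]] by metis
qed

text \<open>A radial bump in the chart \<open>c\<close>, extended by zero. The closed half-ball lies
  in the chart image, so its preimage \<open>K\<close> is compact and hence closed in the Hausdorff
  space \<open>M\<close>. Every point has a neighbourhood either inside \<open>fst c\<close>, where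
  transition maps give smoothness, or off \<open>K\<close>, where the function is zero.\<close>

lemma bump_function:
  assumes c: "c \<in> A" "p \<in> fst c" and V: "openin M V" "p \<in> V"
  obtains \<phi> K W where "smooth_map A \<phi>" "\<And>q. 0 \<le> \<phi> q" "compactin M K" "K \<subseteq> fst c \<inter> V"
    "\<And>q. q \<notin> K \<Longrightarrow> \<phi> q = (0::real)" "openin M W" "p \<in> W" "\<And>q. q \<in> W \<Longrightarrow> \<phi> q > 0"
proof -
  let ?x = "snd c p"
  obtain T where T: "open T" "snd c ` (fst c \<inter> V) = half_plane \<inter> T"
    using openin_chart_image[OF c(1) V(1)] by (auto simp: openin_open)
  then obtain r where r: "r > 0" "cball ?x r \<subseteq> T"
    using c V open_contains_cball by blast
  \<comment> \<open>The squared distance is a polynomial in the coordinates, so the bump is smooth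
    at its centre too.\<close>
  define \<beta> where "\<beta> y = bump 0 (r\<^sup>2 - (y - ?x) \<bullet> (y - ?x))" for y
  have d: "(y - ?x) \<bullet> (y - ?x) = (dist ?x y)\<^sup>2" for y
    by (simp add: dist_norm norm_minus_commute power2_norm_eq_inner)
  have \<beta>_pos: "\<beta> y > 0" if "dist ?x y < r" for y
    using that unfolding \<beta>_def d bump_pos by (simp add: power2_strict_mono)
  have \<beta>_zero: "\<beta> y = 0" if "dist ?x y \<ge> r" for y
    using that r(1) unfolding \<beta>_def d by (intro bump_zero) (simp add: power_mono)
  have \<beta>_smooth: "smooth_on S (\<lambda>y. \<beta> (f y))" if "smooth_on S f" for S and f :: "real^2 \<Rightarrow> real^2"
    unfolding \<beta>_def
    by (rule smooth_on_bump smooth_on_diff smooth_on_const smooth_on_inner that)+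
  define K where "K = {q \<in> fst c. snd c q \<in> cball ?x r}"
  define W where "W = {q \<in> fst c. snd c q \<in> half_plane \<inter> ball ?x r}"
  define \<phi> where "\<phi> q = (if q \<in> fst c then \<beta> (snd c q) else 0)" for q
  \<comment> \<open>Since the ball lies in \<open>T\<close>, each point of the closed half-ball is
    the coordinate of a point of the chart.\<close>
  have sK: "snd c ` K = half_plane \<inter> cball ?x r"
  proof
    show "snd c ` K \<subseteq> half_plane \<inter> cball ?x r" using snd_in_half_plane[OF c(1)] by (auto simp: K_def)
    show "half_plane \<inter> cball ?x r \<subseteq> snd c ` K"
    proof
      fix y assume y: "y \<in> half_plane \<inter> cball ?x r"
      then have "y \<in> snd c ` (fst c \<inter> V)" using T r by blast
      then show "y \<in> snd c ` K" using y by (auto simp: K_def)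
    qed
  qed
  have "closed half_plane"
    unfolding half_plane_def by (rule closed_halfspace_component_ge_cart)
  then have "compact (snd c ` K)" unfolding sK by (simp add: closed_Int_compact)
  then have K: "compactin M K" using compact_chart_image[OF c(1), of K] by (auto simp: K_def)
  have KV: "K \<subseteq> fst c \<inter> V"
  proof
    fix q assume q: "q \<in> K"
    then have "snd c q \<in> snd c ` (fst c \<inter> V)" using sK T r by blast
    then obtain q' where q': "q' \<in> fst c" "q' \<in> V" "snd c q = snd c q'" by blast
    moreover have "q \<in> fst c" using q by (simp add: K_def)
    ultimately show "q \<in> fst c \<inter> V" using inj_onD[OF inj_chart[OF c(1)]] by blast
  qed
  have zero: "\<phi> q = 0" if "q \<notin> K" for q
    using that \<beta>_zero[of "snd c q"] by (auto simp: \<phi>_def K_def not_le)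
  have "smooth_map A \<phi>"
  proof (rule smooth_mapI, rule smooth_on_local_openin)
    fix d y assume dA: "d \<in> A" and y: "y \<in> chart_image d"
    have sub: "openin (top_of_set (chart_image d)) (snd d ` (fst d \<inter> V'))" if "openin M V'" for V'
      using openin_chart_image[OF dA that] openin_subset_trans chart_image_subset[OF dA]
      by (metis chart_image_def image_mono inf_le1)
    show "\<exists>W. openin (top_of_set (chart_image d)) W \<and> y \<in> W \<and> smooth_on W (\<lambda>x. \<phi> (chart_inv d x))"
    proof (cases "chart_inv d y \<in> fst c")
      case True
      have "y = snd d (chart_inv d y)" using chart_chart_inv[OF y] by simp
      then have yW: "y \<in> overlap d c" using True chart_inv_in[OF y] by blast
      have "smooth_on (overlap d c) (\<lambda>x. \<beta> (trans d c x))"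
        by (rule \<beta>_smooth[OF smooth_trans[OF dA c(1)]])
      then have "smooth_on (overlap d c) (\<lambda>x. \<phi> (chart_inv d x))"
        by (rule smooth_on_cong) (auto simp: chart_inv_chart[OF dA] \<phi>_def)
      then show ?thesis using yW sub[OF surf(4)[OF c(1)]] by blast
    next
      case False
      let ?W = "snd d ` (fst d \<inter> (topspace M - K))"
      have "smooth_on ?W (\<lambda>x. \<phi> (chart_inv d x))"
        by (rule smooth_on_cong[OF smooth_on_const[of _ 0]]) (auto simp: chart_inv_chart[OF dA] zero)
      moreover have "y \<in> ?W"
      proof
        show "y = snd d (chart_inv d y)" using chart_chart_inv[OF y] by simp
        show "chart_inv d y \<in> fst d \<inter> (topspace M - K)"
          using False chart_inv_in[OF y] chart_subset[OF dA] KV by blast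
      qed
      moreover have "openin M (topspace M - K)" using K compactin_closedin by blast
      ultimately show ?thesis using sub by blast
    qed
  qed
  moreover have "0 \<le> \<phi> q" for q by (simp add: \<phi>_def \<beta>_def bump_nonneg)
  moreover have "openin M W"
    unfolding W_def by (rule openin_chart_preimage[OF c(1)]) (auto simp: openin_open)
  moreover have "p \<in> W" using r c snd_in_half_plane[OF c] by (simp add: W_def)
  moreover have "\<phi> q > 0" if "q \<in> W" for q using that \<beta>_pos by (auto simp: W_def \<phi>_def)
  ultimately show thesis using that K KV zero by blast
qed

text \<open>The sets on which bump functions are positive cover the compact space. Finitely many
  suffice, and dividing by their sum, which is then positive everywhere, normalises them; the closed
  sets \<open>K\<close> keep the supports inside the charts.\<close>

lemma partition_of_unity_exists: "\<exists>n c \<rho>. partition_of_unity M A n c \<rho>"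
proof -
  define good where "good p \<phi> c K W \<longleftrightarrow> c \<in> A \<and> smooth_map A \<phi> \<and> (\<forall>q. 0 \<le> \<phi> q) \<and> closedin M K \<and> K \<subseteq> fst c \<and>
    (\<forall>q. q \<notin> K \<longrightarrow> \<phi> q = (0::real)) \<and> openin M W \<and> p \<in> W \<and> (\<forall>q\<in>W. \<phi> q > 0)" for p \<phi> c K W
  have "\<forall>p\<in>topspace M. \<exists>\<phi> c K W. good p \<phi> c K W"
  proof
    fix p assume p: "p \<in> topspace M"
    have c: "chart_at A p \<in> A" "p \<in> fst (chart_at A p)" using chart_at[OF p] by auto
    obtain \<phi> K W where 1: "smooth_map A \<phi>" "\<And>q. 0 \<le> \<phi> q" "compactin M K" "K \<subseteq> fst (chart_at A p) \<inter> topspace M"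
      "\<And>q. q \<notin> K \<Longrightarrow> \<phi> q = (0::real)" "openin M W" "p \<in> W" "\<And>q. q \<in> W \<Longrightarrow> \<phi> q > 0"
      by (rule bump_function[OF c openin_topspace p]) (rule that)
    then have "good p \<phi> (chart_at A p) K W" unfolding good_def using c compactin_closedin by simp
    then show "\<exists>\<phi> c K W. good p \<phi> c K W" by blast
  qed
  then obtain \<phi> c K W where g: "\<And>p. p \<in> topspace M \<Longrightarrow> good p (\<phi> p) (c p) (K p) (W p)" by metis
  have "\<exists>\<F>. finite \<F> \<and> \<F> \<subseteq> W ` topspace M \<and> topspace M \<subseteq> \<Union>\<F>"
  proof (rule compactinD[OF surf(1)[unfolded compact_space_def]])
    show "openin M U" if "U \<in> W ` topspace M" for U using that g by (auto simp: good_def)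
    show "topspace M \<subseteq> \<Union> (W ` topspace M)" using g by (auto simp: good_def)
  qed
  then obtain F where F: "finite F" "F \<subseteq> topspace M" "topspace M \<subseteq> \<Union> (W ` F)"
    by (metis finite_subset_image)
  obtain h where h: "bij_betw h {0..<card F} F" using ex_bij_betw_nat_finite[OF F(1)] by blast
  define n where "n = card F"
  have h: "h ` {..<n} = F" using h by (simp add: bij_betw_def n_def atLeast0LessThan)
  define \<Phi> where "\<Phi> q = (\<Sum>i<n. \<phi> (h i) q)" for q
  define \<rho> where "\<rho> i q = inverse (\<Phi> q) * \<phi> (h i) q" for i q
  have hF: "h i \<in> topspace M" if "i < n" for i using that h F(2) by blast
  have gh: "good (h i) (\<phi> (h i)) (c (h i)) (K (h i)) (W (h i))" if "i < n" for i using g[OF hF[OF that]] .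
  have pos: "\<Phi> q > 0" if "q \<in> topspace M" for q
  proof -
    have "q \<in> (\<Union>i<n. W (h i))" using subsetD[OF F(3) that] unfolding h[symmetric] image_image .
    then obtain i where i: "i < n" "q \<in> W (h i)" by blast
    show ?thesis unfolding \<Phi>_def
      by (rule sum_pos2[of _ i]) (use i gh in \<open>auto simp: good_def\<close>)
  qed
  have smooth: "smooth_on (chart_image d) (\<lambda>x. \<phi> (h i) (chart_inv d x))" if "i < n" "d \<in> A" for i d
    by (rule smooth_mapD[OF _ that(2)]) (use gh[OF that(1)] in \<open>simp add: good_def\<close>)
  have "smooth_map A (\<rho> i)" if i: "i < n" for i
  proof (rule smooth_mapI)
    fix d assume d: "d \<in> A"
    have "\<Phi> (chart_inv d x) \<noteq> 0" if "x \<in> chart_image d" for x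
      using pos[of "chart_inv d x"] chart_inv_in[OF that] chart_subset[OF d] by (auto simp: less_le)
    then show "smooth_on (chart_image d) (\<lambda>x. \<rho> i (chart_inv d x))"
      unfolding \<rho>_def \<Phi>_def
      by (intro smooth_on_mult smooth_on_inverse smooth_on_sum smooth[OF _ d]) (use i in auto)
  qed
  moreover have "M closure_of {p \<in> topspace M. \<rho> i p \<noteq> 0} \<subseteq> fst (c (h i))" if i: "i < n" for i
  proof -
    have "{p \<in> topspace M. \<rho> i p \<noteq> 0} \<subseteq> K (h i)" using gh[OF i] by (auto simp: \<rho>_def good_def)
    then have "M closure_of {p \<in> topspace M. \<rho> i p \<noteq> 0} \<subseteq> K (h i)"
      using gh[OF i] by (intro closure_of_minimal) (auto simp: good_def)
    then show ?thesis using gh[OF i] by (auto simp: good_def)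
  qed
  moreover have "(\<Sum>i<n. \<rho> i p) = 1" if "p \<in> topspace M" for p
    using pos[OF that] by (simp add: \<rho>_def \<Phi>_def sum_distrib_left[symmetric])
  moreover have "0 \<le> \<rho> i p" if "i < n" "p \<in> topspace M" for i p
    using pos[OF that(2)] gh[OF that(1)] by (auto simp: \<rho>_def good_def)
  ultimately have "partition_of_unity M A n (\<lambda>i. c (h i)) \<rho>"
    unfolding partition_of_unity_def using gh by (auto simp: good_def)
  then show ?thesis by blast
qed

section \<open>The chosen partition and integrals in a single chart\<close>

text \<open>Names for the partition that the definitions of the integrals select; all integrals over
  \<open>M\<close> and its boundary below refer to this one.\<close>

definition pn :: nat where "pn = fst (some_partition M A)"
definition pc :: "nat \<Rightarrow> 'a chart" where "pc = fst (snd (some_partition M A))"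
definition \<rho> :: "nat \<Rightarrow> 'a \<Rightarrow> real" where "\<rho> = snd (snd (some_partition M A))"

lemma some_partition_eq: "some_partition M A = (pn, pc, \<rho>)"
  by (simp add: pn_def pc_def \<rho>_def)

lemma partition: "partition_of_unity M A pn pc \<rho>"
proof -
  have "(\<lambda>(n, c, \<rho>). partition_of_unity M A n c \<rho>) (some_partition M A)"
    unfolding some_partition_def by (rule someI_ex) (use partition_of_unity_exists in auto)
  then show ?thesis by (simp add: some_partition_eq)
qed

definition supp :: "nat \<Rightarrow> 'a set" where
  "supp i = M closure_of {p \<in> topspace M. \<rho> i p \<noteq> 0}"

lemma pc: "i < pn \<Longrightarrow> pc i \<in> A"
  and \<rho>_smooth: "i < pn \<Longrightarrow> smooth_map A (\<rho> i)"
  and \<rho>_nonneg: "i < pn \<Longrightarrow> p \<in> topspace M \<Longrightarrow> 0 \<le> \<rho> i p"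
  and supp_subset: "i < pn \<Longrightarrow> supp i \<subseteq> fst (pc i)"
  and sum_\<rho>: "p \<in> topspace M \<Longrightarrow> (\<Sum>i<pn. \<rho> i p) = 1"
  using partition unfolding partition_of_unity_def supp_def by auto

lemma closedin_supp: "closedin M (supp i)" and compactin_supp: "compactin M (supp i)"
  by (simp_all add: supp_def compactin_closedin)

lemma \<rho>_zero: "p \<in> topspace M \<Longrightarrow> p \<notin> supp i \<Longrightarrow> \<rho> i p = 0"
  unfolding supp_def using closure_of_subset[of "{p \<in> topspace M. \<rho> i p \<noteq> 0}" M] by blast

text \<open>Plain Lebesgue measure in the chart: the integrand is a coefficient with respect to this
  chart and has to contain the area factor already.\<close>

definition cint :: "'a chart \<Rightarrow> ('a \<Rightarrow> real) \<Rightarrow> real" where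
  "cint c f = integral (chart_image c) (\<lambda>x. f (chart_inv c x))"

lemma cint_cong: "(\<And>p. p \<in> fst c \<Longrightarrow> f p = g p) \<Longrightarrow> cint c f = cint c g"
  unfolding cint_def by (rule integral_cong) (simp add: chart_inv_in)

lemma cint_absolutely_integrable:
  fixes f :: "'a \<Rightarrow> real"
  assumes "c \<in> A" "compactin M K" "K \<subseteq> fst c" "continuous_on (chart_image c) (\<lambda>x. f (chart_inv c x))"
    "\<And>p. p \<in> fst c - K \<Longrightarrow> f p = 0"
  shows "(\<lambda>x. f (chart_inv c x)) absolutely_integrable_on chart_image c"
proof (rule absolutely_integrable_zero_ext[OF surf(6)[OF assms(1)] _ _ assms(4)])
  show "compact (snd c ` K)" using compact_chart_image assms by blast
  show "snd c ` K \<subseteq> chart_image c" using assms(3) by (auto simp: chart_image_def)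
  fix x assume x: "x \<in> chart_image c - snd c ` K"
  then have "chart_inv c x \<in> fst c" using chart_inv_in by blast
  moreover have "chart_inv c x \<notin> K" using x chart_chart_inv[of x c] by (metis DiffD1 DiffD2 image_eqI)
  ultimately show "f (chart_inv c x) = 0" using assms(5) by blast
qed

text \<open>The substitution rule is used for maps into \<open>real^1\<close>; \<open>vec\<close>
  and the first component convert from and to real functions.\<close>

lemma change_of_variables_real:
  fixes S :: "(real^2) set" and f :: "real^2 \<Rightarrow> real"
  assumes S: "S \<in> sets lebesgue" and g: "\<And>x. x \<in> S \<Longrightarrow> (g has_derivative g' x) (at x within S)" "inj_on g S"
    and f: "f absolutely_integrable_on g ` S"
  shows "integral S (\<lambda>x. \<bar>det (matrix (g' x))\<bar> * f (g x)) = integral (g ` S) f"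
proof -
  have v: "bounded_linear (vec :: real \<Rightarrow> real^1)"
    by (intro linear_conv_bounded_linear[THEN iffD1] linearI) (simp_all add: vec_eq_iff)
  have c: "bounded_linear (\<lambda>x :: real^1. x $ 1)" by (rule bounded_linear_vec_nth)
  have "((vec :: real \<Rightarrow> real^1) \<circ> f) absolutely_integrable_on g ` S"
    by (rule absolutely_integrable_linear[OF f v])
  then have *: "(\<lambda>x. \<bar>det (matrix (g' x))\<bar> *\<^sub>R (vec \<circ> f) (g x) :: real^1) absolutely_integrable_on S"
    "integral S (\<lambda>x. \<bar>det (matrix (g' x))\<bar> *\<^sub>R (vec \<circ> f) (g x) :: real^1) = integral (g ` S) (vec \<circ> f)"
    using has_absolute_integral_change_of_variables[OF S g, of "vec \<circ> f :: _ \<Rightarrow> real^1" "integral (g ` S) (vec \<circ> f)"] by auto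
  have "integral S ((\<lambda>x :: real^1. x $ 1) \<circ> (\<lambda>x. \<bar>det (matrix (g' x))\<bar> *\<^sub>R (vec \<circ> f) (g x))) = integral (g ` S) (vec \<circ> f :: _ \<Rightarrow> real^1) $ 1"
    using integral_linear[OF set_lebesgue_integral_eq_integral(1)[OF *(1)] c] *(2) by simp
  also have "integral (g ` S) (vec \<circ> f :: _ \<Rightarrow> real^1) = vec (integral (g ` S) f)"
    by (rule integral_linear[OF set_lebesgue_integral_eq_integral(1)[OF f] v])
  finally show ?thesis by (simp add: comp_def)
qed

text \<open>The coefficient of a 2-form picks up the Jacobian determinant. In an oriented atlas this
  is positive and therefore equals the absolute value in the substitution rule. The common compact
  set \<open>K\<close> confines both integrals to the overlap.\<close>

lemma cint_change:
  assumes c: "c \<in> A" "d \<in> A" and K: "compactin M K" "K \<subseteq> fst c \<inter> fst d"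
    and z: "\<And>p. p \<in> fst c - K \<Longrightarrow> f p = 0" "\<And>p. p \<in> fst d - K \<Longrightarrow> g p = 0"
    and fg: "\<And>p. p \<in> fst c \<inter> fst d \<Longrightarrow> f p = det (matrix (coord_deriv c (snd d) p)) * g p"
    and cont: "continuous_on (chart_image d) (\<lambda>x. g (chart_inv d x))"
  shows "cint c f = cint d g"
proof -
  have img: "trans c d ` overlap c d = overlap d c"
    using chart_inv_chart[OF c(1)] by (force simp: image_iff)
  have sub: "overlap d c \<subseteq> chart_image d" by (auto simp: chart_image_def)
  have restr: "cint c' h = integral (overlap c' d') (\<lambda>x. h (chart_inv c' x))"
    if "c' \<in> A" "\<And>p. p \<in> fst c' - K \<Longrightarrow> h p = 0" "K \<subseteq> fst c' \<inter> fst d'" for c' d' h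
  proof -
    have "cint c' h = integral (overlap c' d') (zero_ext (chart_image c') (\<lambda>x. h (chart_inv c' x)))"
      unfolding cint_def
    proof (rule integral_zero_ext)
      fix x assume x: "x \<in> chart_image c' - overlap c' d'"
      then have "chart_inv c' x \<in> fst c'" using chart_inv_in by blast
      moreover have "chart_inv c' x \<notin> fst d'"
        using x \<open>chart_inv c' x \<in> fst c'\<close> chart_chart_inv[of x c'] by (metis DiffD1 DiffD2 IntI image_eqI)
      ultimately show "h (chart_inv c' x) = 0" using that by blast
    qed
    also have "\<dots> = integral (overlap c' d') (\<lambda>x. h (chart_inv c' x))"
      by (rule integral_cong) (auto simp: zero_ext_def chart_image_def)
    finally show ?thesis .
  qed
  have "cint c f = integral (overlap c d) (\<lambda>x. f (chart_inv c x))" by (rule restr[OF c(1) z(1) K(2)])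
  also have "\<dots> = integral (overlap c d) (\<lambda>x. \<bar>det (matrix (coord_deriv c (snd d) (chart_inv c x)))\<bar> * g (chart_inv d (trans c d x)))"
  proof (rule integral_cong)
    fix x assume "x \<in> overlap c d"
    then obtain p where p: "p \<in> fst c" "p \<in> fst d" "x = snd c p" by blast
    then show "f (chart_inv c x) = \<bar>det (matrix (coord_deriv c (snd d) (chart_inv c x)))\<bar> * g (chart_inv d (trans c d x))"
      using fg[of p] det_trans_pos[OF c p(1,2)] by (simp add: chart_inv_chart[OF c(1)] chart_inv_chart[OF c(2)])
  qed
  also have "\<dots> = integral (trans c d ` overlap c d) (\<lambda>x. g (chart_inv d x))"
  proof (rule change_of_variables_real)
    have "half_plane \<in> sets lebesgue"
      unfolding half_plane_def by (rule lebesgue_closedin[of UNIV]) (auto intro: closed_halfspace_component_ge_cart)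
    then show "overlap c d \<in> sets lebesgue" using lebesgue_openin openin_overlap[OF c] by blast
    show "inj_on (trans c d) (overlap c d)"
      by (rule inj_on_inverseI[of _ "trans d c"]) (auto simp: chart_inv_chart[OF c(1)] chart_inv_chart[OF c(2)])
    show "(trans c d has_derivative coord_deriv c (snd d) (chart_inv c x)) (at x within overlap c d)"
      if "x \<in> overlap c d" for x
      using that trans_has_derivative[OF c] at_within_openin[OF openin_overlap[OF c] that]
      by (auto simp: chart_inv_chart[OF c(1)])
    show "(\<lambda>x. g (chart_inv d x)) absolutely_integrable_on trans c d ` overlap c d"
      unfolding img
    proof (rule absolutely_integrable_zero_ext[OF openin_overlap[OF c(2,1)]])
      show "compact (snd d ` K)" using compact_chart_image[OF c(2)] K by blast
      show "snd d ` K \<subseteq> overlap d c" using K by blast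
      show "continuous_on (overlap d c) (\<lambda>x. g (chart_inv d x))" by (rule continuous_on_subset[OF cont sub])
      show "g (chart_inv d x) = 0" if "x \<in> overlap d c - snd d ` K" for x
      proof -
        from that obtain p where p: "p \<in> fst d" "p \<notin> K" "x = snd d p" by blast
        then show ?thesis using z(2)[of p] by (simp add: chart_inv_chart[OF c(2)])
      qed
    qed
  qed
  also have "\<dots> = integral (overlap d c) (\<lambda>x. g (chart_inv d x))" by (simp only: img)
  also have "\<dots> = cint d g" by (rule restr[OF c(2) z(2), symmetric]) (use K in auto)
  finally show ?thesis .
qed


subsection \<open>Stokes' theorem\<close>

lemma surface_integral_eq:
  "surface_integral M A r f = (\<Sum>i<pn. cint (pc i) (\<lambda>p. \<rho> i p * f p *
     norm (cross3 (coord_deriv (pc i) r p (axis 1 1)) (coord_deriv (pc i) r p (axis 2 1)))))"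
  by (simp add: surface_integral_def some_partition_eq Let_def cint_def)

definition bint :: "'a chart \<Rightarrow> ('a \<Rightarrow> real) \<Rightarrow> real" where
  "bint c f = integral {s. vector [s, 0] \<in> chart_image c} (\<lambda>s. f (chart_inv c (vector [s, 0])))"

lemma boundary_integral_eq:
  "boundary_integral M A r f = (\<Sum>i<pn. bint (pc i) (\<lambda>p. \<rho> i p * f p * norm (coord_deriv (pc i) r p (axis 1 1))))"
  by (simp add: boundary_integral_def some_partition_eq Let_def bint_def)

lemma bint_cong: 
  assumes "\<And>p. p \<in> fst c \<Longrightarrow> snd c p $ 2 = 0 \<Longrightarrow> f p = g p"
  shows "bint c f = bint c g"
  unfolding bint_def
proof (rule integral_cong)
  fix s assume "s \<in> {s. vector [s, 0] \<in> chart_image c}"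
  then show "f (chart_inv c (vector [s, 0])) = g (chart_inv c (vector [s, 0]))"
    by (intro assms) (simp_all add: chart_inv_in chart_chart_inv)
qed

abbreviation pd :: "'a chart \<Rightarrow> 2 \<Rightarrow> ('a \<Rightarrow> 'f::real_normed_vector) \<Rightarrow> 'a \<Rightarrow> 'f" where
  "pd c i f p \<equiv> coord_deriv c f p (axis i 1)"

text \<open>Coefficient of \<open>dF \<and> dG\<close> in the chart, values being multiplied by the
  inner product.\<close>

definition wedge :: "'a chart \<Rightarrow> ('a \<Rightarrow> 'f::euclidean_space) \<Rightarrow> ('a \<Rightarrow> 'f) \<Rightarrow> 'a \<Rightarrow> real" where
  "wedge c F G p = pd c 1 F p \<bullet> pd c 2 G p - pd c 2 F p \<bullet> pd c 1 G p"

text \<open>Coefficient of \<open>du \<and> (F \<bullet> dG)\<close>: the term that arises beside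
  \<open>u (dF \<and> dG)\<close> when the 1-form \<open>u (F \<bullet> dG)\<close> is
  differentiated.\<close>

definition wedge1 :: "'a chart \<Rightarrow> ('a \<Rightarrow> real) \<Rightarrow> ('a \<Rightarrow> 'f::euclidean_space) \<Rightarrow> ('a \<Rightarrow> 'f) \<Rightarrow> 'a \<Rightarrow> real" where
  "wedge1 c u F G p = pd c 1 u p * (F p \<bullet> pd c 2 G p) - pd c 2 u p * (F p \<bullet> pd c 1 G p)"

lemma wedge1_change:
  assumes "smooth_map A u" "smooth_map A G" "c \<in> A" "d \<in> A" "p \<in> fst c" "p \<in> fst d"
  shows "wedge1 c u F G p = det (matrix (coord_deriv c (snd d) p)) * wedge1 d u F G p"
proof -
  have p: "p \<in> topspace M" using chart_subset assms by blast
  have B: "bounded_bilinear (\<lambda>a b. a * (F p \<bullet> b))"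
    by (intro bounded_bilinear.comp[OF bounded_bilinear_mult bounded_linear_ident bounded_linear_inner_right])
  have l: "linear (coord_deriv d u p)" "linear (coord_deriv d G p)"
    by (rule linear_coord_deriv[OF smooth_map_diff_at]; fact assms p)+
  show ?thesis
    unfolding wedge1_def
    unfolding coord_deriv_change[OF smooth_map_diff_at[OF assms(1) p] assms(3-6)]
      coord_deriv_change[OF smooth_map_diff_at[OF assms(2) p] assms(3-6)]
    using alternating_compose[OF B l, of "coord_deriv c (snd d) p"] by simp
qed

lemma wedge1_zero:
  assumes "c \<in> A" "p \<in> fst c" "i < pn" "p \<notin> supp i"
  shows "wedge1 c (\<rho> i) F G p = 0"
proof -
  have "coord_deriv c (\<rho> i) p v = 0" for v
    by (rule coord_deriv_zero[OF assms(1,2) closedin_supp _ assms(4)]) (simp add: \<rho>_zero)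
  then show ?thesis by (simp add: wedge1_def)
qed

lemma sum_wedge1:
  assumes "c \<in> A" "p \<in> fst c"
  shows "(\<Sum>i<pn. wedge1 c (\<rho> i) F G p) = 0"
proof -
  have "(\<Sum>i<pn. coord_deriv c (\<rho> i) p v) = 0" for v
  proof -
    have d: "(\<rho> i \<circ> chart_inv c) differentiable (at (snd c p) within half_plane)" if "i \<in> {..<pn}" for i
      using diff_atD(1)[OF smooth_map_diff_at[OF \<rho>_smooth]] that assms chart_subset by blast
    have h: "snd c p \<in> half_plane" by (rule snd_in_half_plane[OF assms])
    have "(\<Sum>i<pn. coord_deriv c (\<rho> i) p v) = dw half_plane (\<lambda>x. \<Sum>i<pn. (\<rho> i \<circ> chart_inv c) x) (snd c p) v"
      unfolding coord_deriv_eq[OF assms] by (rule dw_sum[OF thick_half_plane h d, symmetric])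
    also have "dw half_plane (\<lambda>x. \<Sum>i<pn. (\<rho> i \<circ> chart_inv c) x) (snd c p) = dw half_plane (\<lambda>x. 1) (snd c p)"
    proof (rule dw_cong[OF surf(6)[OF assms(1)] chart_in_image[OF assms(2)]])
      fix y assume "y \<in> chart_image c"
      then have "chart_inv c y \<in> topspace M" using chart_inv_in chart_subset[OF assms(1)] by blast
      then show "(\<Sum>i<pn. (\<rho> i \<circ> chart_inv c) y) = 1" using sum_\<rho> by simp
    qed
    also have "\<dots> = (\<lambda>v. 0)" by (rule dw_const[OF thick_half_plane h])
    finally show ?thesis .
  qed
  then have "(\<Sum>i<pn. pd c 1 (\<rho> i) p) = 0" "(\<Sum>i<pn. pd c 2 (\<rho> i) p) = 0" by blast+
  then show ?thesis
    by (simp add: wedge1_def sum_subtractf sum_distrib_right[symmetric])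
qed

lemma smooth_wedge1:
  assumes "smooth_map A u" "smooth_map A F" "smooth_map A G" "c \<in> A"
  shows "smooth_on (chart_image c) (\<lambda>x. wedge1 c u F G (chart_inv c x))"
  unfolding wedge1_def
  by (rule smooth_on_diff smooth_on_mult smooth_on_inner smooth_on_coord_deriv smooth_mapD assms)+

lemma smooth_wedge:
  assumes "smooth_map A F" "smooth_map A G" "c \<in> A"
  shows "smooth_on (chart_image c) (\<lambda>x. wedge c F G (chart_inv c x))"
  unfolding wedge_def
  by (rule smooth_on_diff smooth_on_inner smooth_on_coord_deriv assms)+

lemma cint_sum:
  assumes "finite I" "\<And>i. i \<in> I \<Longrightarrow> (\<lambda>x. f i (chart_inv c x)) absolutely_integrable_on chart_image c"
  shows "cint c (\<lambda>p. \<Sum>i\<in>I. f i p) = (\<Sum>i\<in>I. cint c (f i))"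
  unfolding cint_def
  by (rule Henstock_Kurzweil_Integration.integral_sum[OF assms(1)]) (rule set_lebesgue_integral_eq_integral(1)[OF assms(2)])

lemma cint_add:
  assumes "(\<lambda>x. f (chart_inv c x)) absolutely_integrable_on chart_image c"
    "(\<lambda>x. g (chart_inv c x)) absolutely_integrable_on chart_image c"
  shows "cint c (\<lambda>p. f p + g p) = cint c f + cint c g"
  unfolding cint_def
  by (rule Henstock_Kurzweil_Integration.integral_add; rule set_lebesgue_integral_eq_integral(1)) fact+

text \<open>The partition functions add up to one, so their differentials cancel; to add them up, all
  integrals have to be moved to a common chart.\<close>

lemma sum_cint_wedge1:
  assumes F: "smooth_map A F" and G: "smooth_map A G"
  shows "(\<Sum>i<pn. cint (pc i) (wedge1 (pc i) (\<rho> i) F G)) = 0"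
proof -
  let ?h = "\<lambda>i j c p. \<rho> j p * wedge1 c (\<rho> i) F G p"
  have sm: "smooth_on (chart_image c) (\<lambda>x. ?h i j c (chart_inv c x))" if "i < pn" "j < pn" "c \<in> A" for i j c
    by (rule smooth_on_mult smooth_mapD \<rho>_smooth smooth_wedge1 that F G)+
  have zero: "?h i j c p = 0" if "c \<in> A" "p \<in> fst c" "p \<notin> supp i \<inter> supp j" "i < pn" for i j c p
  proof (cases "p \<in> supp i")
    case True
    then have "\<rho> j p = 0" using that \<rho>_zero chart_subset by blast
    then show ?thesis by simp
  next
    case False
    then show ?thesis by (simp add: wedge1_zero[OF that(1,2,4)])
  qed
  have K: "compactin M (supp i \<inter> supp j)" for i j
    by (simp add: compactin_closedin closedin_supp closedin_Int)
  have int1: "(\<lambda>x. ?h i j (pc i) (chart_inv (pc i) x)) absolutely_integrable_on chart_image (pc i)" if "i < pn" "j < pn" for i j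
  proof (rule cint_absolutely_integrable[OF pc[OF that(1)] compactin_supp[of i] supp_subset[OF that(1)]])
    show "continuous_on (chart_image (pc i)) (\<lambda>x. ?h i j (pc i) (chart_inv (pc i) x))"
      by (rule smooth_on_continuous[OF sm[OF that pc[OF that(1)]]])
    show "?h i j (pc i) p = 0" if "p \<in> fst (pc i) - supp i" for p
      by (rule zero) (use that \<open>i < pn\<close> pc in auto)
  qed
  have int2: "(\<lambda>x. ?h i j (pc j) (chart_inv (pc j) x)) absolutely_integrable_on chart_image (pc j)" if "i < pn" "j < pn" for i j
  proof (rule cint_absolutely_integrable[OF pc[OF that(2)] compactin_supp[of j] supp_subset[OF that(2)]])
    show "continuous_on (chart_image (pc j)) (\<lambda>x. ?h i j (pc j) (chart_inv (pc j) x))"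
      by (rule smooth_on_continuous[OF sm[OF that pc[OF that(2)]]])
    show "?h i j (pc j) p = 0" if "p \<in> fst (pc j) - supp j" for p
      by (rule zero) (use that \<open>i < pn\<close> \<open>j < pn\<close> pc in auto)
  qed
  \<comment> \<open>The inserted factor \<open>\<Sum>j<pn. \<rho> j p = 1\<close> confines each term
    to \<open>supp i \<inter> supp j\<close>, where both charts \<open>pc i\<close> and
    \<open>pc j\<close> are available.\<close>
  have "(\<Sum>i<pn. cint (pc i) (wedge1 (pc i) (\<rho> i) F G)) = (\<Sum>i<pn. cint (pc i) (\<lambda>p. \<Sum>j<pn. ?h i j (pc i) p))"
  proof (rule sum.cong[OF refl], rule cint_cong)
    fix i p assume "i \<in> {..<pn}" "p \<in> fst (pc i)"
    then have "p \<in> topspace M" using chart_subset[OF pc] by blast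
    then show "wedge1 (pc i) (\<rho> i) F G p = (\<Sum>j<pn. ?h i j (pc i) p)"
      by (simp add: sum_distrib_right[symmetric] sum_\<rho>)
  qed
  also have "\<dots> = (\<Sum>i<pn. \<Sum>j<pn. cint (pc i) (?h i j (pc i)))"
    by (intro sum.cong refl cint_sum int1) auto
  also have "\<dots> = (\<Sum>i<pn. \<Sum>j<pn. cint (pc j) (?h i j (pc j)))"
  proof (intro sum.cong refl)
    fix i j assume "i \<in> {..<pn}" "j \<in> {..<pn}"
    then have ij: "i < pn" "j < pn" by auto
    show "cint (pc i) (?h i j (pc i)) = cint (pc j) (?h i j (pc j))"
    proof (rule cint_change[OF pc[OF ij(1)] pc[OF ij(2)] K[of i j]])
      show "supp i \<inter> supp j \<subseteq> fst (pc i) \<inter> fst (pc j)" using supp_subset ij by blast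
      show "?h i j (pc i) p = 0" if "p \<in> fst (pc i) - supp i \<inter> supp j" for p
        by (rule zero) (use that ij pc in auto)
      show "?h i j (pc j) p = 0" if "p \<in> fst (pc j) - supp i \<inter> supp j" for p
        by (rule zero) (use that ij pc in auto)
      show "?h i j (pc i) p = det (matrix (coord_deriv (pc i) (snd (pc j)) p)) * ?h i j (pc j) p"
        if "p \<in> fst (pc i) \<inter> fst (pc j)" for p
        using wedge1_change[OF \<rho>_smooth[OF ij(1)] G pc[OF ij(1)] pc[OF ij(2)], of p F] that by simp
      show "continuous_on (chart_image (pc j)) (\<lambda>x. ?h i j (pc j) (chart_inv (pc j) x))"
        by (rule smooth_on_continuous[OF sm[OF ij pc[OF ij(2)]]])
    qed
  qed
  also have "\<dots> = (\<Sum>j<pn. \<Sum>i<pn. cint (pc j) (?h i j (pc j)))" by (rule sum.swap)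
  also have "\<dots> = (\<Sum>j<pn. cint (pc j) (\<lambda>p. \<Sum>i<pn. ?h i j (pc j) p))"
    by (intro sum.cong refl cint_sum[symmetric] int2) auto
  also have "\<dots> = (\<Sum>j<pn. cint (pc j) (\<lambda>p. 0))"
    by (intro sum.cong refl cint_cong) (simp add: sum_distrib_left[symmetric] sum_wedge1[OF pc])
  also have "\<dots> = 0" by (simp add: cint_def)
  finally show ?thesis .
qed

text \<open>In each chart Green's theorem is applied to the 1-form
  \<open>\<rho> i (F \<bullet> dG)\<close>. Second derivatives of \<open>G\<close> cancel by
  symmetry, so its differential is \<open>\<rho> i (dF \<and> dG)\<close> plus a term with the
  differential of \<open>\<rho> i\<close>; the latter terms cancel in the sum over
  \<open>i\<close>.\<close>

theorem Stokes:
  assumes F: "smooth_map A F" and G: "smooth_map A G"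
  shows "(\<Sum>i<pn. cint (pc i) (\<lambda>p. \<rho> i p * wedge (pc i) F G p)) =
    (\<Sum>i<pn. bint (pc i) (\<lambda>p. \<rho> i p * (F p \<bullet> pd (pc i) 1 G p)))"
proof -
  have local: "cint (pc i) (\<lambda>p. \<rho> i p * wedge (pc i) F G p) + cint (pc i) (wedge1 (pc i) (\<rho> i) F G)
      = bint (pc i) (\<lambda>p. \<rho> i p * (F p \<bullet> pd (pc i) 1 G p))" if i: "i < pn" for i
  proof -
    define c where "c = pc i"
    define U where "U = chart_image c"
    define u where "u x = \<rho> i (chart_inv c x)" for x
    define f where "f x = F (chart_inv c x)" for x
    define g where "g x = G (chart_inv c x)" for x
    have c: "c \<in> A" using pc[OF i] by (simp add: c_def)
    have U: "openin (top_of_set half_plane) U" unfolding U_def by (rule surf(6)[OF c])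
    have su: "smooth_on U u" "smooth_on U f" "smooth_on U g"
      unfolding U_def u_def f_def g_def using smooth_mapD[OF _ c] \<rho>_smooth[OF i] F G by auto
    define K where "K = snd c ` supp i"
    have K: "compact K" "K \<subseteq> U"
      using compact_chart_image[OF c] compactin_supp supp_subset[OF i] by (auto simp: K_def U_def c_def chart_image_def)
    have zu: "u x = 0" if "x \<in> U - K" for x
      unfolding u_def
    proof (rule \<rho>_zero)
      show "chart_inv c x \<in> topspace M" using that chart_inv_in[of x c] chart_subset[OF c] by (auto simp: U_def)
      show "chart_inv c x \<notin> supp i" using that chart_chart_inv[of x c] unfolding K_def U_def by (metis DiffD1 DiffD2 image_eqI)
    qed
    have cd: "coord_deriv c h (chart_inv c x) v = dw half_plane (\<lambda>x. h (chart_inv c x)) x v" if "x \<in> U" for h :: "'a \<Rightarrow> 'z::real_normed_vector" and x v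
      using coord_deriv_eq[OF c chart_inv_in, of x h] chart_chart_inv[of x c] that by (simp add: U_def comp_def)
    \<comment> \<open>The \<open>j\<close>-th coefficient of the 1-form
      \<open>\<rho> i (F \<bullet> dG)\<close> in this chart.\<close>
    let ?P = "\<lambda>j x. u x * (f x \<bullet> dw half_plane g x (axis j 1))"
    have sP: "smooth_on U (?P j)" for j
      by (rule smooth_on_mult smooth_on_inner su smooth_on_dw[OF thick_half_plane U])+
    have dP: "dw half_plane (?P j) x v = u x * (f x \<bullet> dw half_plane (\<lambda>x. dw half_plane g x (axis j 1)) x v)
        + u x * (dw half_plane f x v \<bullet> dw half_plane g x (axis j 1))
        + dw half_plane u x v * (f x \<bullet> dw half_plane g x (axis j 1))" if x: "x \<in> U" for x v j
    proof -
      have h: "x \<in> half_plane" using x U openin_imp_subset by blast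
      have d: "h differentiable (at x within half_plane)" if "smooth_on U h" for h :: "real^2 \<Rightarrow> 'z::real_normed_vector"
        by (rule smooth_on_differentiable[OF thick_half_plane U that x])
      have sg: "smooth_on U (\<lambda>x. dw half_plane g x (axis j 1))" by (rule smooth_on_dw[OF thick_half_plane U su(3)])
      show ?thesis
        unfolding dw_bounded_bilinear[OF bounded_bilinear_mult thick_half_plane h d[OF su(1)] d[OF smooth_on_inner[OF su(2) sg]]]
          dw_bounded_bilinear[OF bounded_bilinear_inner thick_half_plane h d[OF su(2)] d[OF sg]]
        by (simp add: algebra_simps)
    qed
    have "integral U (\<lambda>x. dw half_plane (?P 2) x (axis 1 1) - dw half_plane (?P 1) x (axis 2 1)) =
        integral {s. vector [s, 0] \<in> U} (\<lambda>s. ?P 1 (vector [s, 0]))"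
      by (rule Stokes_half_plane[OF U K sP _ sP]) (simp_all add: zu)
    also have "integral {s. vector [s, 0] \<in> U} (\<lambda>s. ?P 1 (vector [s, 0])) = bint c (\<lambda>p. \<rho> i p * (F p \<bullet> pd c 1 G p))"
      unfolding bint_def U_def[symmetric]
      by (rule integral_cong) (simp add: cd u_def f_def g_def[abs_def])
    also have "integral U (\<lambda>x. dw half_plane (?P 2) x (axis 1 1) - dw half_plane (?P 1) x (axis 2 1)) =
        cint c (\<lambda>p. \<rho> i p * wedge c F G p + wedge1 c (\<rho> i) F G p)"
      unfolding cint_def U_def[symmetric]
    proof (rule integral_cong)
      fix x assume x: "x \<in> U"
      have "dw half_plane (\<lambda>x. dw half_plane g x (axis 2 1)) x (axis 1 1) = dw half_plane (\<lambda>x. dw half_plane g x (axis 1 1)) x (axis 2 1)"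
        by (rule dw_commute[OF thick_half_plane U su(3) x])
      then show "dw half_plane (?P 2) x (axis 1 1) - dw half_plane (?P 1) x (axis 2 1) =
          \<rho> i (chart_inv c x) * wedge c F G (chart_inv c x) + wedge1 c (\<rho> i) F G (chart_inv c x)"
        unfolding dP[OF x] wedge_def wedge1_def cd[OF x]
        by (simp add: u_def[abs_def] f_def[abs_def] g_def[abs_def] algebra_simps)
    qed
    also have "\<dots> = cint c (\<lambda>p. \<rho> i p * wedge c F G p) + cint c (wedge1 c (\<rho> i) F G)"
    proof (rule cint_add)
      show "(\<lambda>x. \<rho> i (chart_inv c x) * wedge c F G (chart_inv c x)) absolutely_integrable_on chart_image c"
      proof (rule cint_absolutely_integrable[OF c compactin_supp[of i]])
        show "supp i \<subseteq> fst c" using supp_subset[OF i] by (simp add: c_def)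
        show "continuous_on (chart_image c) (\<lambda>x. \<rho> i (chart_inv c x) * wedge c F G (chart_inv c x))"
          by (rule smooth_on_continuous) (rule smooth_on_mult smooth_mapD \<rho>_smooth smooth_wedge i c F G)+
        show "\<rho> i p * wedge c F G p = 0" if "p \<in> fst c - supp i" for p
          using that \<rho>_zero[of p i] chart_subset[OF c] by auto
      qed
      show "(\<lambda>x. wedge1 c (\<rho> i) F G (chart_inv c x)) absolutely_integrable_on chart_image c"
      proof (rule cint_absolutely_integrable[OF c compactin_supp[of i]])
        show "supp i \<subseteq> fst c" using supp_subset[OF i] by (simp add: c_def)
        show "continuous_on (chart_image c) (\<lambda>x. wedge1 c (\<rho> i) F G (chart_inv c x))"
          by (rule smooth_on_continuous) (rule smooth_wedge1[OF \<rho>_smooth[OF i] F G c])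
        show "wedge1 c (\<rho> i) F G p = 0" if "p \<in> fst c - supp i" for p
          using that wedge1_zero[OF c _ i] by auto
      qed
    qed
    finally show ?thesis unfolding c_def by simp
  qed
  have "(\<Sum>i<pn. cint (pc i) (\<lambda>p. \<rho> i p * wedge (pc i) F G p)) =
      (\<Sum>i<pn. cint (pc i) (\<lambda>p. \<rho> i p * wedge (pc i) F G p) + cint (pc i) (wedge1 (pc i) (\<rho> i) F G))"
    by (simp add: sum.distrib sum_cint_wedge1[OF F G])
  also have "\<dots> = (\<Sum>i<pn. bint (pc i) (\<lambda>p. \<rho> i p * (F p \<bullet> pd (pc i) 1 G p)))"
    by (intro sum.cong refl local) simp
  finally show ?thesis .
qed

end

section \<open>Curvatures\<close>

lemma independent_pair_iff:
  fixes u w :: "real^2"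
  shows "u \<noteq> w \<and> independent {u, w} \<longleftrightarrow> u $ 1 * w $ 2 - w $ 1 * u $ 2 \<noteq> 0" (is "?L \<longleftrightarrow> ?d \<noteq> 0")
proof
  assume L: ?L
  have comb: "x = 0 \<and> y = 0" if "x *\<^sub>R u + y *\<^sub>R w = 0" for x y
  proof -
    have *: "\<forall>c. (\<Sum>v\<in>{u, w}. c v *\<^sub>R v) = 0 \<longrightarrow> (\<forall>v\<in>{u, w}. c v = 0)"
      using L unfolding independent_explicit by blast
    have "\<forall>v\<in>{u, w}. (if v = u then x else y) = 0"
      by (rule *[THEN spec, THEN mp]) (use that L in auto)
    then show ?thesis using L by auto
  qed
  show "?d \<noteq> 0"
  proof
    assume "?d = 0"
    then have "(w $ 1) *\<^sub>R u + (- u $ 1) *\<^sub>R w = 0" "(w $ 2) *\<^sub>R u + (- u $ 2) *\<^sub>R w = 0"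
      by (auto simp: vec_eq_iff forall_2 algebra_simps)
    from comb[OF this(1)] comb[OF this(2)] have "w = 0" by (simp add: vec_eq_iff forall_2)
    then show False using comb[of 0 1] by simp
  qed
next
  assume d: "?d \<noteq> 0"
  then have ne: "u \<noteq> w" by (auto simp: algebra_simps)
  have "c u = 0 \<and> c w = 0" if "c u *\<^sub>R u + c w *\<^sub>R w = 0" for c :: "real^2 \<Rightarrow> real"
  proof -
    have e: "c u * u $ 1 + c w * w $ 1 = 0" "c u * u $ 2 + c w * w $ 2 = 0"
      using that by (auto simp: vec_eq_iff forall_2)
    \<comment> \<open>Cramer's rule for the coefficients of a vanishing combination.\<close>
    have "c u * ?d = (c u * u $ 1 + c w * w $ 1) * w $ 2 - (c u * u $ 2 + c w * w $ 2) * w $ 1"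
      "c w * ?d = (c u * u $ 2 + c w * w $ 2) * u $ 1 - (c u * u $ 1 + c w * w $ 1) * u $ 2"
      by (simp_all add: algebra_simps)
    then show ?thesis using d unfolding e by simp
  qed
  then show ?L using ne by (auto simp: independent_explicit)
qed

text \<open>Cramer's rule in the basis \<open>r1\<close>, \<open>r2\<close>,
  \<open>cross3 r1 r2\<close>, whose determinant is the squared length of the cross product; the
  normal component vanishes by assumption.\<close>

lemma tangent_span:
  fixes X r1 r2 :: "real^3"
  assumes "cross3 r1 r2 \<noteq> 0" "X \<bullet> cross3 r1 r2 = 0"
  obtains x y where "X = x *\<^sub>R r1 + y *\<^sub>R r2"
proof -
  let ?n = "cross3 r1 r2"
  have "(?n \<bullet> ?n) *\<^sub>R X = (?n \<bullet> cross3 X r2) *\<^sub>R r1 + (?n \<bullet> cross3 r1 X) *\<^sub>R r2 + (X \<bullet> ?n) *\<^sub>R ?n"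
    by (simp add: vec_eq_iff forall_3 inner_vec_def sum_3 cross_components algebra_simps)
  then have "(?n \<bullet> ?n) *\<^sub>R X = (?n \<bullet> cross3 X r2) *\<^sub>R r1 + (?n \<bullet> cross3 r1 X) *\<^sub>R r2"
    using assms(2) by simp
  then have "inverse (?n \<bullet> ?n) *\<^sub>R ((?n \<bullet> ?n) *\<^sub>R X) =
      inverse (?n \<bullet> ?n) *\<^sub>R ((?n \<bullet> cross3 X r2) *\<^sub>R r1 + (?n \<bullet> cross3 r1 X) *\<^sub>R r2)" by simp
  then have "X = (inverse (?n \<bullet> ?n) * (?n \<bullet> cross3 X r2)) *\<^sub>R r1 + (inverse (?n \<bullet> ?n) * (?n \<bullet> cross3 r1 X)) *\<^sub>R r2"
    using assms(1) by (simp add: scaleR_add_right)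
  then show thesis using that by blast
qed

lemma tangent_zero:
  fixes X r1 r2 :: "real^3"
  assumes "cross3 r1 r2 \<noteq> 0" "X \<bullet> cross3 r1 r2 = 0" "X \<bullet> r1 = 0" "X \<bullet> r2 = 0"
  shows "X = 0"
proof -
  obtain x y where X: "X = x *\<^sub>R r1 + y *\<^sub>R r2" using tangent_span assms by blast
  have "X \<bullet> X = X \<bullet> (x *\<^sub>R r1 + y *\<^sub>R r2)" using X by simp
  also have "\<dots> = 0" using assms by (simp add: inner_add_right)
  finally show ?thesis by simp
qed

text \<open>A self-adjoint operator on a tangent plane has a basis of eigenvectors; after orthogonalising
  the coordinate basis the eigenvalues solve a quadratic equation with nonnegative discriminant.\<close>

lemma principal_directions_exist:
  fixes D S :: "real^2 \<Rightarrow> real^3"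
  assumes lin: "linear D" "linear S"
    and n: "cross3 (D (axis 1 1)) (D (axis 2 1)) \<noteq> 0"
    and S: "S (axis 1 1) \<bullet> cross3 (D (axis 1 1)) (D (axis 2 1)) = 0" "S (axis 2 1) \<bullet> cross3 (D (axis 1 1)) (D (axis 2 1)) = 0"
    and sym: "S (axis 1 1) \<bullet> D (axis 2 1) = S (axis 2 1) \<bullet> D (axis 1 1)"
  shows "\<exists>k1 k2 u1 u2. u1 \<noteq> u2 \<and> independent {u1, u2} \<and> S u1 = - k1 *\<^sub>R D u1 \<and> S u2 = - k2 *\<^sub>R D u2"
proof -
  define r1 where "r1 = D (axis 1 1)"
  \<comment> \<open>Gram-Schmidt: \<open>f\<close> makes \<open>r2\<close> orthogonal to
    \<open>r1\<close>, and \<open>s2\<close> is the same combination of the values of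
    \<open>S\<close>.\<close>
  define f where "f = (r1 \<bullet> D (axis 2 1)) / (r1 \<bullet> r1)"
  define r2 where "r2 = D (axis 2 1) - f *\<^sub>R r1"
  define s1 where "s1 = S (axis 1 1)"
  define s2 where "s2 = S (axis 2 1) - f *\<^sub>R s1"
  have cr: "cross3 (D (axis 1 1)) (D (axis 2 1)) = cross3 r1 r2"
    by (simp add: r1_def r2_def Cross3.right_diff_distrib cross_mult_right)
  have n0: "cross3 r1 r2 \<noteq> 0" using n cr by simp
  then have r: "r1 \<noteq> 0" "r2 \<noteq> 0" by auto
  have orth: "r1 \<bullet> r2 = 0" using r by (simp add: r2_def f_def inner_diff_right)
  have sn: "s1 \<bullet> cross3 r1 r2 = 0" "s2 \<bullet> cross3 r1 r2 = 0"
    using S unfolding cr s1_def s2_def by (simp_all add: inner_diff_left)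
  have sy: "s1 \<bullet> r2 = s2 \<bullet> r1"
    using sym unfolding s1_def s2_def r2_def r1_def by (simp add: inner_diff_left inner_diff_right)
  define p where "p = r1 \<bullet> r1"
  define q where "q = r2 \<bullet> r2"
  define \<alpha> where "\<alpha> = - (s1 \<bullet> r1)"
  define \<beta> where "\<beta> = - (s1 \<bullet> r2)"
  define \<gamma> where "\<gamma> = - (s2 \<bullet> r2)"
  have pq: "p > 0" "q > 0" using r by (auto simp: p_def q_def)
  \<comment> \<open>The coordinate vector that \<open>D\<close> maps to
    \<open>x r1 + y r2\<close>.\<close>
  define u :: "real \<Rightarrow> real \<Rightarrow> real^2" where "u x y = vector [x - y * f, y]" for x y
  have Du: "D (u x y) = x *\<^sub>R r1 + y *\<^sub>R r2" for x y
    using linear_vec2[OF lin(1), of "u x y"] by (simp add: u_def r1_def[symmetric] r2_def algebra_simps)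
  have Su: "S (u x y) = x *\<^sub>R s1 + y *\<^sub>R s2" for x y
    using linear_vec2[OF lin(2), of "u x y"] by (simp add: u_def s1_def[symmetric] s2_def algebra_simps)
  \<comment> \<open>In the orthogonal basis the eigenvalue equation has the symmetric matrix with
    entries \<open>\<alpha>, \<beta>, \<gamma>\<close> on one side and \<open>k\<close> times the
    diagonal metric \<open>p, q\<close> on the other. Testing against \<open>r1\<close> and
    \<open>r2\<close> suffices because all vectors are tangential.\<close>
  have eig: "S (u x y) = - k *\<^sub>R D (u x y)"
    if "\<alpha> * x + \<beta> * y = k * p * x" "\<beta> * x + \<gamma> * y = k * q * y" for x y k
  proof -
    have "S (u x y) + k *\<^sub>R D (u x y) = 0"
    proof (rule tangent_zero[OF n0])
      show "(S (u x y) + k *\<^sub>R D (u x y)) \<bullet> cross3 r1 r2 = 0"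
        unfolding Du Su using sn by (simp add: inner_add_left dot_cross_self)
      show "(S (u x y) + k *\<^sub>R D (u x y)) \<bullet> r1 = 0"
        unfolding Du Su using that(1) orth sy
        by (simp add: inner_add_left inner_commute[of r2 r1] \<alpha>_def \<beta>_def p_def algebra_simps)
      show "(S (u x y) + k *\<^sub>R D (u x y)) \<bullet> r2 = 0"
        unfolding Du Su using that(2) orth
        by (simp add: inner_add_left \<gamma>_def \<beta>_def q_def algebra_simps)
    qed
    then show ?thesis by (simp add: eq_neg_iff_add_eq_0)
  qed
  show ?thesis
  proof (cases "\<beta> = 0")
    case True
    have "S (u 1 0) = - (\<alpha> / p) *\<^sub>R D (u 1 0)" "S (u 0 1) = - (\<gamma> / q) *\<^sub>R D (u 0 1)"
      by (rule eig; use True pq in simp)+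
    moreover have "u 1 0 \<noteq> u 0 1 \<and> independent {u 1 0, u 0 1}"
      unfolding independent_pair_iff by (simp add: u_def)
    ultimately show ?thesis by blast
  next
    case False
    \<comment> \<open>The discriminant of
      \<open>(k p - \<alpha>) (k q - \<gamma>) = \<beta>^2\<close> as a quadratic in
      \<open>k\<close>. The values 1 and -1 of \<open>e\<close> select its roots, which are distinct
      for \<open>\<beta> \<noteq> 0\<close>, and \<open>(\<beta>, k p - \<alpha>)\<close> is an
      eigenvector.\<close>
    define d where "d = (\<alpha> * q - \<gamma> * p)\<^sup>2 + 4 * p * q * \<beta>\<^sup>2"
    have d: "d > 0" using False pq by (simp add: d_def add_nonneg_pos)
    define k where "k e = (\<alpha> * q + \<gamma> * p + e * sqrt d) / (2 * p * q)" for e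
    have root: "(k e * p - \<alpha>) * (k e * q - \<gamma>) = \<beta>\<^sup>2" if "e\<^sup>2 = 1" for e
    proof -
      have 1: "2 * q * (k e * p - \<alpha>) = e * sqrt d - (\<alpha> * q - \<gamma> * p)"
        "2 * p * (k e * q - \<gamma>) = e * sqrt d + (\<alpha> * q - \<gamma> * p)"
        using pq by (simp_all add: k_def field_simps)
      have "4 * p * q * ((k e * p - \<alpha>) * (k e * q - \<gamma>)) = (2 * q * (k e * p - \<alpha>)) * (2 * p * (k e * q - \<gamma>))"
        by (simp add: algebra_simps)
      also have "\<dots> = e\<^sup>2 * (sqrt d)\<^sup>2 - (\<alpha> * q - \<gamma> * p)\<^sup>2"
        unfolding 1 by (simp add: power2_eq_square algebra_simps)
      also have "\<dots> = 4 * p * q * \<beta>\<^sup>2" using that d by (simp add: d_def)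
      finally show ?thesis using pq by simp
    qed
    have "S (u \<beta> (k e * p - \<alpha>)) = - k e *\<^sub>R D (u \<beta> (k e * p - \<alpha>))" if "e\<^sup>2 = 1" for e
      by (rule eig) (use root[OF that] in \<open>simp_all add: algebra_simps power2_eq_square\<close>)
    then have "S (u \<beta> (k 1 * p - \<alpha>)) = - k 1 *\<^sub>R D (u \<beta> (k 1 * p - \<alpha>))"
      "S (u \<beta> (k (-1) * p - \<alpha>)) = - k (-1) *\<^sub>R D (u \<beta> (k (-1) * p - \<alpha>))" by simp_all
    moreover have "u \<beta> (k 1 * p - \<alpha>) \<noteq> u \<beta> (k (-1) * p - \<alpha>) \<and> independent {u \<beta> (k 1 * p - \<alpha>), u \<beta> (k (-1) * p - \<alpha>)}"
    proof -
      have "k 1 - k (-1) = sqrt d / (p * q)" using pq by (simp add: k_def field_simps)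
      then have "k 1 \<noteq> k (-1)" using d pq by auto
      moreover have "u \<beta> y $ 1 * u \<beta> y' $ 2 - u \<beta> y' $ 1 * u \<beta> y $ 2 = \<beta> * (y' - y)" for y y'
        by (simp add: u_def algebra_simps)
      ultimately show ?thesis unfolding independent_pair_iff using False pq by simp
    qed
    ultimately show ?thesis by blast
  qed
qed

lemma scaleR_double_cancel:
  fixes x y :: "'v::real_vector"
  assumes "x + x = s *\<^sub>R (y + y)"
  shows "x = s *\<^sub>R y"
proof -
  have "2 *\<^sub>R x = 2 *\<^sub>R (s *\<^sub>R y)" using assms by (simp only: scaleR_2 scaleR_add_right)
  then show ?thesis by (rule scaleR_left_imp_eq[rotated]) simp
qed

text \<open>Trace and determinant of the shape operator, written with cross products. In the basis
  \<open>u1\<close>, \<open>u2\<close> both identities are immediate, and the alternation law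
  divides out the determinant of the change of basis. When the normal vector is nonzero, they also
  determine \<open>k1 + k2\<close> and \<open>k1 * k2\<close>.\<close>

lemma principal_curvature_sums:
  fixes D S :: "real^2 \<Rightarrow> real^3"
  assumes lin: "linear D" "linear S" and u: "u1 \<noteq> u2" "independent {u1, u2}"
    and S: "S u1 = - k1 *\<^sub>R D u1" "S u2 = - k2 *\<^sub>R D u2"
  shows "cross3 (S (axis 1 1)) (D (axis 2 1)) + cross3 (D (axis 1 1)) (S (axis 2 1)) =
      - (k1 + k2) *\<^sub>R cross3 (D (axis 1 1)) (D (axis 2 1))"
    and "cross3 (S (axis 1 1)) (S (axis 2 1)) = (k1 * k2) *\<^sub>R cross3 (D (axis 1 1)) (D (axis 2 1))"
proof -
  define L where "L u = u $ 1 *\<^sub>R u1 + u $ 2 *\<^sub>R u2" for u :: "real^2"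
  have L: "L (axis 1 1) = u1" "L (axis 2 1) = u2" by (simp_all add: L_def axis_def)
  define \<delta> where "\<delta> = det (matrix L)"
  have \<delta>: "\<delta> \<noteq> 0"
    using independent_pair_iff[of u1 u2] u by (simp add: \<delta>_def det_matrix_2 L)
  note alt = alternating_compose[OF bounded_bilinear_cross3, of _ _ L, unfolded L \<delta>_def[symmetric]]
  have DD: "cross3 (D u1) (D u2) = \<delta> *\<^sub>R cross3 (D (axis 1 1)) (D (axis 2 1))"
  proof -
    have "cross3 (D u1) (D u2) + cross3 (D u1) (D u2) =
        \<delta> *\<^sub>R (cross3 (D (axis 1 1)) (D (axis 2 1)) + cross3 (D (axis 1 1)) (D (axis 2 1)))"
      using alt[OF lin(1,1)]
      by (simp only: cross_skew[of "D u2" "D u1"] cross_skew[of "D (axis 2 1)" "D (axis 1 1)"] diff_minus_eq_add)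
    then show ?thesis by (rule scaleR_double_cancel)
  qed
  have SS: "cross3 (S u1) (S u2) = \<delta> *\<^sub>R cross3 (S (axis 1 1)) (S (axis 2 1))"
  proof -
    have "cross3 (S u1) (S u2) + cross3 (S u1) (S u2) =
        \<delta> *\<^sub>R (cross3 (S (axis 1 1)) (S (axis 2 1)) + cross3 (S (axis 1 1)) (S (axis 2 1)))"
      using alt[OF lin(2,2)]
      by (simp only: cross_skew[of "S u2" "S u1"] cross_skew[of "S (axis 2 1)" "S (axis 1 1)"] diff_minus_eq_add)
    then show ?thesis by (rule scaleR_double_cancel)
  qed
  have "\<delta> *\<^sub>R (cross3 (S (axis 1 1)) (D (axis 2 1)) + cross3 (D (axis 1 1)) (S (axis 2 1)))
      = cross3 (S u1) (D u2) - cross3 (S u2) (D u1)"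
    using alt[OF lin(2,1)] cross_skew[of "S (axis 2 1)" "D (axis 1 1)"] by simp
  also have "\<dots> = - (k1 + k2) *\<^sub>R cross3 (D u1) (D u2)"
    unfolding S using cross_skew[of "D u2" "D u1"] by (simp add: cross_mult_left algebra_simps)
  also have "\<dots> = \<delta> *\<^sub>R (- (k1 + k2) *\<^sub>R cross3 (D (axis 1 1)) (D (axis 2 1)))"
    unfolding DD by (simp add: algebra_simps)
  finally show "cross3 (S (axis 1 1)) (D (axis 2 1)) + cross3 (D (axis 1 1)) (S (axis 2 1)) =
      - (k1 + k2) *\<^sub>R cross3 (D (axis 1 1)) (D (axis 2 1))"
    by (rule scaleR_left_imp_eq[OF \<delta>])
  have "\<delta> *\<^sub>R cross3 (S (axis 1 1)) (S (axis 2 1)) = cross3 (S u1) (S u2)" by (rule SS[symmetric])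
  also have "\<dots> = (k1 * k2) *\<^sub>R cross3 (D u1) (D u2)" unfolding S by (simp add: cross_mult_left cross_mult_right)
  also have "\<dots> = \<delta> *\<^sub>R ((k1 * k2) *\<^sub>R cross3 (D (axis 1 1)) (D (axis 2 1)))" unfolding DD by simp
  finally have "\<delta> *\<^sub>R cross3 (S (axis 1 1)) (S (axis 2 1)) = \<delta> *\<^sub>R ((k1 * k2) *\<^sub>R cross3 (D (axis 1 1)) (D (axis 2 1)))" .
  then show "cross3 (S (axis 1 1)) (S (axis 2 1)) = (k1 * k2) *\<^sub>R cross3 (D (axis 1 1)) (D (axis 2 1))"
    by (rule scaleR_left_imp_eq[OF \<delta>])
qed

section \<open>Unit normal and curvatures of a smooth map\<close>

context surface
begin

abbreviation nrm :: "'a chart \<Rightarrow> ('a \<Rightarrow> real^3) \<Rightarrow> 'a \<Rightarrow> real^3" where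
  "nrm c r p \<equiv> cross3 (pd c 1 r p) (pd c 2 r p)"

text \<open>Symmetrised so that the anticommutativity of \<open>cross3\<close> produces the
  alternating expression; for \<open>g = f\<close> it is twice the normal vector.\<close>

lemma cross_change:
  assumes "diff_at f p" "diff_at g p" "c \<in> A" "d \<in> A" "p \<in> fst c" "p \<in> fst d"
  shows "cross3 (pd c 1 f p) (pd c 2 g p) + cross3 (pd c 1 g p) (pd c 2 f p) =
    det (matrix (coord_deriv c (snd d) p)) *\<^sub>R (cross3 (pd d 1 f p) (pd d 2 g p) + cross3 (pd d 1 g p) (pd d 2 f p))"
  using alternating_compose[OF bounded_bilinear_cross3 linear_coord_deriv[OF assms(1,4,6)] linear_coord_deriv[OF assms(2,4,6)],
      of "coord_deriv c (snd d) p"]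
  unfolding coord_deriv_change[OF assms(1,3-6)] coord_deriv_change[OF assms(2,3-6)]
  by (simp add: cross_skew[of "coord_deriv d g p _" "coord_deriv d f p _"])

lemma cross_change_self:
  assumes "diff_at f p" "c \<in> A" "d \<in> A" "p \<in> fst c" "p \<in> fst d"
  shows "nrm c f p = det (matrix (coord_deriv c (snd d) p)) *\<^sub>R nrm d f p"
  by (rule scaleR_double_cancel[OF cross_change[OF assms(1,1,2-5)]])

lemma unit_normal_chart:
  assumes "smooth_map A r" "c \<in> A" "p \<in> fst c"
  shows "unit_normal A r p = sgn (nrm c r p)"
proof -
  have p: "p \<in> topspace M" using assms chart_subset by blast
  have ca: "chart_at A p \<in> A" "p \<in> fst (chart_at A p)" using chart_at[OF p] by auto
  show ?thesis
    unfolding unit_normal_def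
    using cross_change_self[OF smooth_map_diff_at[OF assms(1) p] ca(1) assms(2) ca(2) assms(3)]
      det_trans_pos[OF ca(1) assms(2) ca(2) assms(3)]
    by (simp add: sgn_scaleR)
qed

lemma nrm_nonzero_change:
  assumes "smooth_map A r" "c \<in> A" "d \<in> A" "p \<in> fst c" "p \<in> fst d"
  shows "nrm c r p \<noteq> 0 \<longleftrightarrow> nrm d r p \<noteq> 0"
proof -
  have "p \<in> topspace M" using assms chart_subset by blast
  then show ?thesis
    using cross_change_self[OF smooth_map_diff_at[OF assms(1)] assms(2-5)] det_trans_pos[OF assms(2-5)] by simp
qed

lemma coord_deriv_coords:
  assumes "c \<in> A" "x \<in> chart_image c"
  shows "coord_deriv c f (chart_inv c x) v = dw half_plane (\<lambda>x. f (chart_inv c x)) x v"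
  using coord_deriv_eq[OF assms(1) chart_inv_in[OF assms(2)], of f] chart_chart_inv[OF assms(2)]
  by (simp add: comp_def)

text \<open>The maps \<open>R + t V\<close> are merely smooth, so normals and curvatures are studied
  for smooth maps at the points of this relatively open set.\<close>

definition regular_set :: "'a chart \<Rightarrow> ('a \<Rightarrow> real^3) \<Rightarrow> (real^2) set" where
  "regular_set c r = {x \<in> chart_image c. nrm c r (chart_inv c x) \<noteq> 0}"

lemma openin_regular_set:
  assumes "smooth_map A r" "c \<in> A"
  shows "openin (top_of_set half_plane) (regular_set c r)"
proof -
  have "continuous_on (chart_image c) (\<lambda>x. nrm c r (chart_inv c x))"
    by (rule smooth_on_continuous) (rule smooth_on_cross3 smooth_on_coord_deriv assms)+
  then have "openin (top_of_set (chart_image c)) (chart_image c \<inter> (\<lambda>x. nrm c r (chart_inv c x)) -` (- {0}))"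
    by (rule continuous_openin_preimage_gen) (simp add: open_Compl)
  moreover have "chart_image c \<inter> (\<lambda>x. nrm c r (chart_inv c x)) -` (- {0}) = regular_set c r"
    by (auto simp: regular_set_def)
  ultimately show ?thesis using openin_trans surf(6)[OF assms(2)] by metis
qed

lemma smooth_on_unit_normal:
  assumes "smooth_map A r" "c \<in> A"
  shows "smooth_on (regular_set c r) (\<lambda>x. unit_normal A r (chart_inv c x))"
proof (rule smooth_on_cong)
  show "smooth_on (regular_set c r) (\<lambda>x. sgn (nrm c r (chart_inv c x)))"
    by (rule smooth_on_sgn, rule smooth_on_subset[of "chart_image c"])
      (rule smooth_on_cross3 smooth_on_coord_deriv assms | auto simp: regular_set_def)+
  show "sgn (nrm c r (chart_inv c x)) = unit_normal A r (chart_inv c x)" if "x \<in> regular_set c r" for x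
    using unit_normal_chart[OF assms(1,2) chart_inv_in] that by (simp add: regular_set_def)
qed

lemma diff_at_unit_normal:
  assumes "smooth_map A r" "c \<in> A" "p \<in> fst c" "nrm c r p \<noteq> 0"
  shows "diff_at (unit_normal A r) p"
proof (rule diff_atI[OF assms(2,3)])
  have "snd c p \<in> regular_set c r"
    using assms by (simp add: regular_set_def chart_in_image chart_inv_chart)
  from smooth_on_differentiable[OF thick_half_plane openin_regular_set[OF assms(1,2)] smooth_on_unit_normal[OF assms(1,2)] this]
  show "(unit_normal A r \<circ> chart_inv c) differentiable (at (snd c p) within half_plane)" by (simp add: comp_def)
qed

text \<open>The last two facts come from differentiating \<open>N \<bullet> N = 1\<close> and
  \<open>N \<bullet> r_u = 0\<close>; symmetry of the second derivatives of \<open>r\<close> turns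
  the latter into symmetry of the second fundamental form.\<close>

lemma normal_frame:
  assumes r: "smooth_map A r" and c: "c \<in> A" "p \<in> fst c" and n: "nrm c r p \<noteq> 0"
  shows "unit_normal A r p \<bullet> unit_normal A r p = 1"
    and "nrm c r p = norm (nrm c r p) *\<^sub>R unit_normal A r p"
    and "unit_normal A r p \<bullet> coord_deriv c r p v = 0"
    and "unit_normal A r p \<bullet> coord_deriv c (unit_normal A r) p v = 0"
    and "pd c 1 (unit_normal A r) p \<bullet> pd c 2 r p = pd c 2 (unit_normal A r) p \<bullet> pd c 1 r p"
proof -
  let ?N = "unit_normal A r"
  let ?V = "regular_set c r"
  let ?r = "\<lambda>x. r (chart_inv c x)" and ?\<nu> = "\<lambda>x. ?N (chart_inv c x)"
  have N: "?N q = sgn (nrm c r q)" if "q \<in> fst c" for q by (rule unit_normal_chart[OF r c(1) that])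
  show *: "nrm c r p = norm (nrm c r p) *\<^sub>R ?N p" unfolding N[OF c(2)] by (simp add: sgn_div_norm n)
  have unit: "?N q \<bullet> ?N q = 1" if "q \<in> fst c" "nrm c r q \<noteq> 0" for q
    using that by (simp add: N norm_eq_1[symmetric] norm_sgn)
  then show "?N p \<bullet> ?N p = 1" using c n by blast
  \<comment> \<open>Valid on the whole chart: where the cross product vanishes, so does the normal
    by \<open>sgn 0 = 0\<close>.\<close>
  have orth: "?N q \<bullet> coord_deriv c r q v = 0" if q: "q \<in> fst c" for q v
  proof -
    have "diff_at r q" using smooth_map_diff_at[OF r] chart_subset c(1) q by blast
    from linear_vec2[OF linear_coord_deriv[OF this c(1) q], of v] show ?thesis
      by (simp add: N[OF q] sgn_div_norm inner_add_right dot_cross_self)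
  qed
  then show "?N p \<bullet> coord_deriv c r p v = 0" using c by blast
  define x where "x = snd c p"
  have px: "p = chart_inv c x" using c by (simp add: x_def chart_inv_chart)
  have x: "x \<in> ?V" "x \<in> chart_image c"
    using c n by (simp_all add: x_def regular_set_def chart_in_image chart_inv_chart)
  have h: "x \<in> half_plane" using x chart_image_subset c by blast
  have V: "openin (top_of_set half_plane) ?V" by (rule openin_regular_set[OF r c(1)])
  have s\<nu>: "smooth_on ?V ?\<nu>" by (rule smooth_on_unit_normal[OF r c(1)])
  have sr: "smooth_on (chart_image c) ?r" by (rule smooth_mapD[OF r c(1)])
  have sdr: "smooth_on (chart_image c) (\<lambda>x. dw half_plane ?r x v)" for v
    by (rule smooth_on_dw[OF thick_half_plane surf(6)[OF c(1)] sr])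
  note d\<nu> = smooth_on_differentiable[OF thick_half_plane V s\<nu> x(1)]
  note ddr = smooth_on_differentiable[OF thick_half_plane surf(6)[OF c(1)] sdr x(2)]
  note inner_rule = dw_bounded_bilinear[OF bounded_bilinear_inner thick_half_plane h]
  have "dw half_plane (\<lambda>x. ?\<nu> x \<bullet> ?\<nu> x) x = dw half_plane (\<lambda>x. 1) x"
    by (rule dw_cong[OF V x(1)]) (auto simp: regular_set_def unit chart_inv_in)
  then have "dw half_plane (\<lambda>x. ?\<nu> x \<bullet> ?\<nu> x) x v = 0" using dw_const[OF thick_half_plane h] by metis
  then have "?\<nu> x \<bullet> dw half_plane ?\<nu> x v = 0"
    unfolding inner_rule[OF d\<nu> d\<nu>] by (simp add: inner_commute)
  then show "?N p \<bullet> coord_deriv c ?N p v = 0"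
    unfolding px coord_deriv_coords[OF c(1) x(2)] .
  \<comment> \<open>The relation \<open>N \<bullet> r_u = 0\<close>, differentiated in the direction
    \<open>v\<close>.\<close>
  have second: "?\<nu> x \<bullet> dw half_plane (\<lambda>x. dw half_plane ?r x u) x v + dw half_plane ?\<nu> x v \<bullet> dw half_plane ?r x u = 0" for u v
  proof -
    have "dw half_plane (\<lambda>x. ?\<nu> x \<bullet> dw half_plane ?r x u) x = dw half_plane (\<lambda>x. 0) x"
      by (rule dw_cong[OF surf(6)[OF c(1)] x(2)])
        (use orth in \<open>simp add: coord_deriv_coords[OF c(1), symmetric] chart_inv_in\<close>)
    then have "dw half_plane (\<lambda>x. ?\<nu> x \<bullet> dw half_plane ?r x u) x v = 0" using dw_const[OF thick_half_plane h] by metis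
    then show ?thesis unfolding inner_rule[OF d\<nu> ddr] .
  qed
  have "dw half_plane ?\<nu> x v \<bullet> dw half_plane ?r x u = dw half_plane ?\<nu> x u \<bullet> dw half_plane ?r x v" for u v
    using second[of u v] second[of v u] dw_commute[OF thick_half_plane surf(6)[OF c(1)] sr x(2), of u v] by simp
  then show "pd c 1 ?N p \<bullet> pd c 2 r p = pd c 2 ?N p \<bullet> pd c 1 r p"
    unfolding px coord_deriv_coords[OF c(1) x(2)] .
qed

text \<open>The definite descriptions are resolved in the chart \<open>chart_at A p\<close>:
  principal directions exist there, and the cross product identities fix the sum and the product of
  the curvatures. Both sides scale with the same determinant, which gives the identities in every
  chart.\<close>

lemma curvatures:
  assumes r: "smooth_map A r" and c: "c \<in> A" "p \<in> fst c" and n: "nrm c r p \<noteq> 0"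
  shows "cross3 (pd c 1 (unit_normal A r) p) (pd c 2 r p) + cross3 (pd c 1 r p) (pd c 2 (unit_normal A r) p)
      = - (2 * mean_curvature A r p) *\<^sub>R nrm c r p"
    and "nrm c (unit_normal A r) p = gauss_curvature A r p *\<^sub>R nrm c r p"
proof -
  let ?N = "unit_normal A r" and ?d = "chart_at A p"
  have p: "p \<in> topspace M" using c chart_subset by blast
  have d: "?d \<in> A" "p \<in> fst ?d" using chart_at[OF p] by auto
  have nd: "nrm ?d r p \<noteq> 0" using nrm_nonzero_change[OF r c(1) d(1) c(2) d(2)] n by blast
  have dr: "diff_at r p" by (rule smooth_map_diff_at[OF r p])
  have dN: "diff_at ?N p" by (rule diff_at_unit_normal[OF r c n])
  note lin = linear_coord_deriv[OF dr d] linear_coord_deriv[OF dN d]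
  note fr = normal_frame[OF r d nd]
  have tan: "coord_deriv ?d ?N p v \<bullet> nrm ?d r p = 0" for v
    by (subst fr(2)) (use fr(4)[of v] in \<open>simp add: inner_commute\<close>)
  obtain k1 k2 u1 u2 where k: "u1 \<noteq> u2" "independent {u1, u2}"
    "coord_deriv ?d ?N p u1 = - k1 *\<^sub>R coord_deriv ?d r p u1" "coord_deriv ?d ?N p u2 = - k2 *\<^sub>R coord_deriv ?d r p u2"
    using principal_directions_exist[OF lin nd tan tan fr(5)] by blast
  have ex: "principal_curvatures A r p k1 k2" unfolding principal_curvatures_def using k by blast
  have sums: "cross3 (pd ?d 1 ?N p) (pd ?d 2 r p) + cross3 (pd ?d 1 r p) (pd ?d 2 ?N p) = - (l1 + l2) *\<^sub>R nrm ?d r p"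
    "nrm ?d ?N p = (l1 * l2) *\<^sub>R nrm ?d r p" if "principal_curvatures A r p l1 l2" for l1 l2
    using that principal_curvature_sums[OF lin] unfolding principal_curvatures_def by blast+
  have uniq: "l1 + l2 = k1 + k2" "l1 * l2 = k1 * k2" if "principal_curvatures A r p l1 l2" for l1 l2
    using sums[OF that] sums[OF ex] nd by simp_all
  have m: "mean_curvature A r p = (k1 + k2) / 2"
    unfolding mean_curvature_def
  proof (rule the_equality)
    fix h assume "\<exists>l1 l2. principal_curvatures A r p l1 l2 \<and> h = (l1 + l2) / 2"
    then obtain l1 l2 where "principal_curvatures A r p l1 l2" "h = (l1 + l2) / 2" by blast
    then show "h = (k1 + k2) / 2" using uniq(1) by simp
  qed (use ex in blast)
  have g: "gauss_curvature A r p = k1 * k2"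
    unfolding gauss_curvature_def
  proof (rule the_equality)
    fix h assume "\<exists>l1 l2. principal_curvatures A r p l1 l2 \<and> h = l1 * l2"
    then obtain l1 l2 where "principal_curvatures A r p l1 l2" "h = l1 * l2" by blast
    then show "h = k1 * k2" using uniq(2) by simp
  qed (use ex in blast)
  have m2: "2 * mean_curvature A r p = k1 + k2" unfolding m by simp
  have d_eq: "cross3 (pd ?d 1 ?N p) (pd ?d 2 r p) + cross3 (pd ?d 1 r p) (pd ?d 2 ?N p)
      = - (2 * mean_curvature A r p) *\<^sub>R nrm ?d r p" "nrm ?d ?N p = gauss_curvature A r p *\<^sub>R nrm ?d r p"
    unfolding m2 g by (rule sums[OF ex])+
  show "cross3 (pd c 1 ?N p) (pd c 2 r p) + cross3 (pd c 1 r p) (pd c 2 ?N p) = - (2 * mean_curvature A r p) *\<^sub>R nrm c r p"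
    unfolding cross_change[OF dN dr c(1) d(1) c(2) d(2)] cross_change_self[OF dr c(1) d(1) c(2) d(2)] d_eq by simp
  show "nrm c ?N p = gauss_curvature A r p *\<^sub>R nrm c r p"
    unfolding cross_change_self[OF dN c(1) d(1) c(2) d(2)] cross_change_self[OF dr c(1) d(1) c(2) d(2)] d_eq by simp
qed

end

section \<open>Variation of the density\<close>

lemma smooth_on_Pair: "smooth_on S f \<Longrightarrow> smooth_on S g \<Longrightarrow> smooth_on S (\<lambda>x. (f x, g x))"
proof -
  assume fg: "smooth_on S f" "smooth_on S g"
  have 1: "bounded_linear (\<lambda>x. (x, 0))" and 2: "bounded_linear (\<lambda>x. (0, x))"
    by (intro bounded_linear_Pair bounded_linear_ident bounded_linear_zero)+
  show ?thesis
    using smooth_on_add[OF smooth_on_bounded_linear[OF 1 fg(1)] smooth_on_bounded_linear[OF 2 fg(2)]] by simp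
qed

section \<open>Pointwise algebra of the first variation\<close>

text \<open>Pointwise form of moving \<open>d\<close> from \<open>V\<close> to \<open>X\<close>;
  second derivatives do not occur. Being purely algebraic, it also applies with the derivatives of
  \<open>N\<close> in place of \<open>r1\<close> and \<open>r2\<close>, and with \<open>W\<close> in
  place of \<open>V\<close>.\<close>

lemma triple_product_expand:
  fixes X X1 X2 V V1 V2 r1 r2 :: "real^3"
  shows "X \<bullet> (cross3 V1 r2 + cross3 r1 V2) =
    (cross3 X1 V + cross3 X V1) \<bullet> r2 - (cross3 X2 V + cross3 X V2) \<bullet> r1 + V \<bullet> (cross3 X1 r2 + cross3 r1 X2)"
  by (simp add: inner_vec_def sum_3 cross_components algebra_simps)

text \<open>On the left stands the product rule for the densities; \<open>e\<close> is the constant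
  c of the functional, as \<open>c\<close> will denote charts. Each expansion leaves a multiple of
  \<open>J (V \<bullet> N)\<close>: \<open>2 k\<close> from \<open>N1\<close> and \<open>N2\<close>,
  \<open>- 2 h\<close> from the area, and \<open>2 + 1\<close> from the volume, where the 3 cancels
  the factor \<open>1 / 3\<close>. The expansion for \<open>W\<close> leaves a multiple of
  \<open>W \<bullet> N = 0\<close>.\<close>

lemma variation_algebra:
  fixes N R V W r1 r2 N1 N2 V1 V2 W1 W2 :: "real^3" and a b e h k J :: real
  assumes n: "cross3 r1 r2 = J *\<^sub>R N" and WN: "W \<bullet> N = 0"
    and h: "cross3 N1 r2 + cross3 r1 N2 = - (2 * h) *\<^sub>R cross3 r1 r2"
    and k: "cross3 N1 N2 = k *\<^sub>R cross3 r1 r2"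
  shows "(- a / 2 * (W \<bullet> (cross3 N1 r2 + cross3 r1 N2) + N \<bullet> ((cross3 W1 r2 + cross3 N1 V2) + (cross3 V1 N2 + cross3 r1 W2)))
      + b * (W \<bullet> cross3 r1 r2 + N \<bullet> (cross3 V1 r2 + cross3 r1 V2)))
      + e / 3 * (V \<bullet> cross3 r1 r2 + R \<bullet> (cross3 V1 r2 + cross3 r1 V2)) =
    - ((a * k + 2 * b * h - e) * (V \<bullet> N) * J)
      + ((b *\<^sub>R (cross3 N1 V + cross3 N V1) + (e / 3) *\<^sub>R (cross3 r1 V + cross3 R V1) + (- a / 2) *\<^sub>R (cross3 N1 W + cross3 N W1)) \<bullet> r2
       - (b *\<^sub>R (cross3 N2 V + cross3 N V2) + (e / 3) *\<^sub>R (cross3 r2 V + cross3 R V2) + (- a / 2) *\<^sub>R (cross3 N2 W + cross3 N W2)) \<bullet> r1)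
      + (((- a / 2) *\<^sub>R (cross3 N1 V + cross3 N V1)) \<bullet> N2 - ((- a / 2) *\<^sub>R (cross3 N2 V + cross3 N V2)) \<bullet> N1)"
proof -
  note T = triple_product_expand
  have Wn: "W \<bullet> cross3 r1 r2 = 0" unfolding n using WN by simp
  have Wh: "W \<bullet> (cross3 N1 r2 + cross3 r1 N2) = 0" unfolding h n using WN by simp
  have 1: "N \<bullet> (cross3 W1 r2 + cross3 r1 W2) =
      (cross3 N1 W + cross3 N W1) \<bullet> r2 - (cross3 N2 W + cross3 N W2) \<bullet> r1"
    using T[of N W1 r2 r1 W2 N1 W N2] Wh by simp
  have 2: "N \<bullet> (cross3 V1 N2 + cross3 N1 V2) =
      (cross3 N1 V + cross3 N V1) \<bullet> N2 - (cross3 N2 V + cross3 N V2) \<bullet> N1 + 2 * (k * J * (V \<bullet> N))"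
    using T[of N V1 N2 N1 V2 N1 V N2] unfolding k n inner_add_right by simp
  have 3: "N \<bullet> (cross3 V1 r2 + cross3 r1 V2) =
      (cross3 N1 V + cross3 N V1) \<bullet> r2 - (cross3 N2 V + cross3 N V2) \<bullet> r1 - 2 * (h * J * (V \<bullet> N))"
    using T[of N V1 r2 r1 V2 N1 V N2] unfolding h n by simp
  have 4: "R \<bullet> (cross3 V1 r2 + cross3 r1 V2) =
      (cross3 r1 V + cross3 R V1) \<bullet> r2 - (cross3 r2 V + cross3 R V2) \<bullet> r1 + 2 * (J * (V \<bullet> N))"
    using T[of R V1 r2 r1 V2 r1 V r2] unfolding n inner_add_right by simp
  have 5: "V \<bullet> cross3 r1 r2 = J * (V \<bullet> N)" unfolding n by simp
  have 6: "N \<bullet> ((cross3 W1 r2 + cross3 N1 V2) + (cross3 V1 N2 + cross3 r1 W2)) =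
      N \<bullet> (cross3 W1 r2 + cross3 r1 W2) + N \<bullet> (cross3 V1 N2 + cross3 N1 V2)"
    by (simp add: inner_add_right)
  show ?thesis
    unfolding 6 1 2 3 4 5 Wn Wh by (simp add: inner_add_left algebra_simps)
qed

text \<open>If the cross product vanished, the part of the second vector orthogonal to the first
  would have zero cross product with it as well, hence be zero, against injectivity.\<close>

lemma inj_imp_cross3_nonzero:
  fixes D :: "real^2 \<Rightarrow> real^3"
  assumes "linear D" "inj D"
  shows "cross3 (D (axis 1 1)) (D (axis 2 1)) \<noteq> 0"
proof
  let ?r1 = "D (axis 1 1)" and ?r2 = "D (axis 2 1)"
  assume z: "cross3 ?r1 ?r2 = 0"
  have inj: "u = 0" if "D u = 0" for u using that assms by (simp add: linear_injective_0)
  have ax: "axis 1 1 \<noteq> (0 :: real^2)" by (simp add: axis_eq_0_iff)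
  then have r1: "?r1 \<noteq> 0" using inj by blast
  define f where "f = (?r1 \<bullet> ?r2) / (?r1 \<bullet> ?r1)"
  have "?r1 \<bullet> (?r2 - f *\<^sub>R ?r1) = 0" "cross3 ?r1 (?r2 - f *\<^sub>R ?r1) = 0"
    using r1 z by (simp_all add: f_def inner_diff_right Cross3.right_diff_distrib cross_mult_right)
  then have "?r2 - f *\<^sub>R ?r1 = 0" using norm_and_cross_eq_0 r1 by blast
  then have "D (axis 2 1 - f *\<^sub>R axis 1 1) = 0"
    using assms(1) by (simp add: linear_diff linear_cmul)
  from inj[OF this] show False by (auto simp: vec_eq_iff forall_2 axis_def)
qed

abbreviation HT :: "(real \<times> (real^2)) set" where
  "HT \<equiv> UNIV \<times> half_plane"

lemma thick_HT: "thick HT"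
  by (intro thick_Times thick_UNIV thick_half_plane)

lemma dw_slice:
  assumes "openin (top_of_set HT) S" "smooth_on S \<Phi>" "(t, x) \<in> S"
  shows "dw HT \<Phi> (t, x) (0, v) = dw half_plane (\<lambda>y. \<Phi> (t, y)) x v"
    and "((\<lambda>s. \<Phi> (s, x)) has_vector_derivative dw HT \<Phi> (t, x) (1, 0)) (at t)"
proof -
  have x: "x \<in> half_plane" using assms openin_imp_subset by blast
  note D = smooth_on_has_derivative[OF thick_HT assms]
  show "dw HT \<Phi> (t, x) (0, v) = dw half_plane (\<lambda>y. \<Phi> (t, y)) x v"
    by (rule fun_cong[OF dw_eqI[OF thick_half_plane x has_derivative_slice(1)[OF D], symmetric]])
  show "((\<lambda>s. \<Phi> (s, x)) has_vector_derivative dw HT \<Phi> (t, x) (1, 0)) (at t)"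
    by (rule has_derivative_slice(2)[OF D x])
qed

section \<open>Calculus of coordinate derivatives on the surface\<close>

context surface
begin

lemma coord_deriv_eqI:
  assumes "c \<in> A" "p \<in> fst c" "((\<lambda>x. f (chart_inv c x)) has_derivative f') (at (snd c p) within half_plane)"
  shows "coord_deriv c f p = f'"
  using dw_eqI[OF thick_half_plane snd_in_half_plane[OF assms(1,2)] assms(3)]
  by (simp add: coord_deriv_eq[OF assms(1,2)] comp_def)

lemma coord_deriv_bilinear:
  assumes "bounded_bilinear B" "diff_at f p" "diff_at g p" "c \<in> A" "p \<in> fst c"
  shows "coord_deriv c (\<lambda>q. B (f q) (g q)) p v = B (f p) (coord_deriv c g p v) + B (coord_deriv c f p v) (g p)"
  using fun_cong[OF coord_deriv_eqI[OF assms(4,5) bounded_bilinear.FDERIV[OF assms(1)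
    diff_atD(2)[OF assms(2,4,5), unfolded comp_def] diff_atD(2)[OF assms(3-5), unfolded comp_def]]]]
  by (simp add: chart_inv_chart[OF assms(4,5)])

lemma coord_deriv_add:
  assumes "diff_at f p" "diff_at g p" "c \<in> A" "p \<in> fst c"
  shows "coord_deriv c (\<lambda>q. f q + g q) p v = coord_deriv c f p v + coord_deriv c g p v"
  using fun_cong[OF coord_deriv_eqI[OF assms(3,4) has_derivative_add[OF
    diff_atD(2)[OF assms(1,3,4), unfolded comp_def] diff_atD(2)[OF assms(2-4), unfolded comp_def]]]] .

lemma coord_deriv_scaleR:
  assumes "diff_at f p" "c \<in> A" "p \<in> fst c"
  shows "coord_deriv c (\<lambda>q. s *\<^sub>R f q) p v = s *\<^sub>R coord_deriv c f p v"
  using fun_cong[OF coord_deriv_eqI[OF assms(2,3) has_derivative_scaleR_right[OF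
    diff_atD(2)[OF assms, unfolded comp_def]]]] .

lemma coord_deriv_Pair:
  assumes "diff_at f p" "diff_at g p" "c \<in> A" "p \<in> fst c"
  shows "coord_deriv c (\<lambda>q. (f q, g q)) p v = (coord_deriv c f p v, coord_deriv c g p v)"
  using fun_cong[OF coord_deriv_eqI[OF assms(3,4) has_derivative_Pair[OF
    diff_atD(2)[OF assms(1,3,4), unfolded comp_def] diff_atD(2)[OF assms(2-4), unfolded comp_def]]]] .

lemma smooth_map_add: "smooth_map A f \<Longrightarrow> smooth_map A g \<Longrightarrow> smooth_map A (\<lambda>q. f q + g q)"
  by (rule smooth_mapI, rule smooth_on_add; erule (1) smooth_mapD)

lemma smooth_map_bilinear: "bounded_bilinear B \<Longrightarrow> smooth_map A f \<Longrightarrow> smooth_map A g \<Longrightarrow> smooth_map A (\<lambda>q. B (f q) (g q))"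
  by (rule smooth_mapI, rule smooth_on_bounded_bilinear, assumption; erule (1) smooth_mapD)

lemma smooth_map_const: "smooth_map A (\<lambda>q. k)"
  by (rule smooth_mapI) (rule smooth_on_const)

lemma smooth_map_Pair: "smooth_map A f \<Longrightarrow> smooth_map A g \<Longrightarrow> smooth_map A (\<lambda>q. (f q, g q))"
  by (rule smooth_mapI, rule smooth_on_Pair; erule (1) smooth_mapD)

lemmas smooth_map_cross3 = smooth_map_bilinear[OF bounded_bilinear_cross3]
lemmas smooth_map_scaleR = smooth_map_bilinear[OF bounded_bilinear_scaleR]
lemmas smooth_map_inner = smooth_map_bilinear[OF bounded_bilinear_inner]
lemmas coord_deriv_cross3 = coord_deriv_bilinear[OF bounded_bilinear_cross3]

end

section \<open>The immersion, its variation and the variation of the normal\<close>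

locale immersed_surface = surface M A for M :: "'a topology" and A :: "'a chart set" +
  fixes R :: "'a \<Rightarrow> real^3"
  assumes immersion: "smooth_immersion M A R"
begin

lemma smooth_R: "smooth_map A R"
  using immersion by (simp add: smooth_immersion_def)

lemma nrm_R:
  assumes "c \<in> A" "p \<in> fst c"
  shows "nrm c R p \<noteq> 0"
proof -
  have p: "p \<in> topspace M" using assms chart_subset by blast
  have d: "chart_at A p \<in> A" "p \<in> fst (chart_at A p)" using chart_at[OF p] by auto
  have "inj (differential A R p)" using immersion p by (simp add: smooth_immersion_def)
  with linear_coord_deriv[OF smooth_map_diff_at[OF smooth_R p] d] have "nrm (chart_at A p) R p \<noteq> 0"
    by (rule inj_imp_cross3_nonzero)
  then show ?thesis using nrm_nonzero_change[OF smooth_R assms(1) d(1) assms(2) d(2)] by blast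
qed

abbreviation N :: "'a \<Rightarrow> real^3" where "N \<equiv> unit_normal A R"

lemma smooth_N: "smooth_map A N"
proof (rule smooth_mapI)
  fix c assume c: "c \<in> A"
  have "regular_set c R = chart_image c" using nrm_R[OF c chart_inv_in] by (auto simp: regular_set_def)
  then show "smooth_on (chart_image c) (\<lambda>x. N (chart_inv c x))" using smooth_on_unit_normal[OF smooth_R c] by simp
qed

end

locale variation = immersed_surface M A R for M :: "'a topology" and A :: "'a chart set" and R :: "'a \<Rightarrow> real^3" +
  fixes V :: "'a \<Rightarrow> real^3"
  assumes smooth_V: "smooth_map A V"
begin

definition Rt :: "real \<Rightarrow> 'a \<Rightarrow> real^3" where "Rt t = (\<lambda>p. R p + t *\<^sub>R V p)"

lemma smooth_Rt: "smooth_map A (Rt t)"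
  unfolding Rt_def by (intro smooth_map_add smooth_map_scaleR smooth_R smooth_V smooth_map_const)

lemma coord_deriv_Rt:
  assumes "c \<in> A" "p \<in> fst c"
  shows "coord_deriv c (Rt t) p v = coord_deriv c R p v + t *\<^sub>R coord_deriv c V p v"
proof -
  have p: "p \<in> topspace M" using assms chart_subset by blast
  note d = smooth_map_diff_at[OF smooth_R p] smooth_map_diff_at[OF smooth_V p]
    smooth_map_diff_at[OF smooth_map_scaleR[OF smooth_map_const smooth_V] p]
  show ?thesis
    unfolding Rt_def coord_deriv_add[OF d(1) d(3) assms] coord_deriv_scaleR[OF d(2) assms] ..
qed

text \<open>The suffix \<open>h\<close> marks functions of time and coordinates \<open>(t, x)\<close> belonging to \<open>R + t V\<close> in a fixed
  chart.  They are smooth jointly in \<open>(t, x)\<close>, so that mixed derivatives in \<open>t\<close> and \<open>x\<close> commute, but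
  only on the set \<open>reg c\<close> where the varied map is still immersed.\<close>

definition rh :: "'a chart \<Rightarrow> real \<times> (real^2) \<Rightarrow> real^3" where
  "rh c z = Rt (fst z) (chart_inv c (snd z))"

definition rdh :: "'a chart \<Rightarrow> 2 \<Rightarrow> real \<times> (real^2) \<Rightarrow> real^3" where
  "rdh c i z = pd c i (Rt (fst z)) (chart_inv c (snd z))"

definition reg :: "'a chart \<Rightarrow> (real \<times> (real^2)) set" where
  "reg c = {z. snd z \<in> chart_image c \<and> cross3 (rdh c 1 z) (rdh c 2 z) \<noteq> 0}"

definition Nh :: "'a chart \<Rightarrow> real \<times> (real^2) \<Rightarrow> real^3" where
  "Nh c z = sgn (cross3 (rdh c 1 z) (rdh c 2 z))"

lemma smooth_on_rh: "c \<in> A \<Longrightarrow> smooth_on (UNIV \<times> chart_image c) (rh c)"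
  unfolding rh_def Rt_def
  by (rule smooth_on_add smooth_on_scaleR smooth_on_fst
      smooth_on_snd[where f = "\<lambda>x. R (chart_inv c x)"] smooth_on_snd[where f = "\<lambda>x. V (chart_inv c x)"]
      smooth_mapD smooth_R smooth_V | assumption)+

lemma rdh_eq: "c \<in> A \<Longrightarrow> snd z \<in> chart_image c \<Longrightarrow>
    rdh c i z = pd c i R (chart_inv c (snd z)) + fst z *\<^sub>R pd c i V (chart_inv c (snd z))"
  unfolding rdh_def using coord_deriv_Rt chart_inv_in by blast

lemma smooth_on_rdh: 
  assumes "c \<in> A"
  shows "smooth_on (UNIV \<times> chart_image c) (rdh c i)"
proof (rule smooth_on_cong)
  show "smooth_on (UNIV \<times> chart_image c) (\<lambda>z. pd c i R (chart_inv c (snd z)) + fst z *\<^sub>R pd c i V (chart_inv c (snd z)))"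
    by (rule smooth_on_add smooth_on_scaleR smooth_on_fst
      smooth_on_snd[where f = "\<lambda>x. pd c i R (chart_inv c x)"] smooth_on_snd[where f = "\<lambda>x. pd c i V (chart_inv c x)"]
      smooth_on_coord_deriv smooth_R smooth_V assms)+
qed (use rdh_eq[OF assms] in auto)

lemma openin_HT_chart: "c \<in> A \<Longrightarrow> openin (top_of_set HT) (UNIV \<times> chart_image c)"
  by (rule openin_Times) (use surf(6) in auto)

lemma openin_reg:
  assumes c: "c \<in> A"
  shows "openin (top_of_set HT) (reg c)"
proof -
  have "continuous_on (UNIV \<times> chart_image c) (\<lambda>z. cross3 (rdh c 1 z) (rdh c 2 z))"
    by (rule smooth_on_continuous) (rule smooth_on_cross3 smooth_on_rdh c)+
  then have "openin (top_of_set (UNIV \<times> chart_image c))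
      ((UNIV \<times> chart_image c) \<inter> (\<lambda>z. cross3 (rdh c 1 z) (rdh c 2 z)) -` (- {0}))"
    by (rule continuous_openin_preimage_gen) (simp add: open_Compl)
  moreover have "(UNIV \<times> chart_image c) \<inter> (\<lambda>z. cross3 (rdh c 1 z) (rdh c 2 z)) -` (- {0}) = reg c"
    by (auto simp: reg_def)
  ultimately have "openin (top_of_set (UNIV \<times> chart_image c)) (reg c)" by simp
  then show ?thesis by (rule openin_trans[OF _ openin_HT_chart[OF c]])
qed

lemma reg_subset: "reg c \<subseteq> UNIV \<times> chart_image c"
  by (auto simp: reg_def)

lemma reg_0: "c \<in> A \<Longrightarrow> x \<in> chart_image c \<Longrightarrow> (0, x) \<in> reg c"
  using nrm_R[of c "chart_inv c x"] chart_inv_in[of x c] by (simp add: reg_def rdh_eq)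

lemma smooth_on_Nh: 
  assumes c: "c \<in> A"
  shows "smooth_on (reg c) (Nh c)"
  unfolding Nh_def
  by (rule smooth_on_sgn smooth_on_cross3 smooth_on_subset[OF smooth_on_rdh reg_subset] c | simp add: reg_def)+

lemma Nh_eq:
  assumes "c \<in> A" "x \<in> chart_image c"
  shows "Nh c (t, x) = unit_normal A (Rt t) (chart_inv c x)"
  unfolding Nh_def rdh_def using unit_normal_chart[OF smooth_Rt assms(1) chart_inv_in[OF assms(2)]] by simp

lemma dw_Nh:
  assumes c: "c \<in> A" and z: "(t, x) \<in> reg c"
  shows "dw HT (Nh c) (t, x) (0, v) = coord_deriv c (unit_normal A (Rt t)) (chart_inv c x) v"
proof -
  have x: "x \<in> chart_image c" using z by (simp add: reg_def)
  have "dw half_plane (\<lambda>y. Nh c (t, y)) x = dw half_plane (\<lambda>y. unit_normal A (Rt t) (chart_inv c y)) x"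
    by (rule dw_cong[OF surf(6)[OF c] x]) (rule Nh_eq[OF c])
  then show ?thesis
    using dw_slice(1)[OF openin_reg[OF c] smooth_on_Nh[OF c] z, of v] coord_deriv_coords[OF c x] by metis
qed

text \<open>The variation of the normal. No chart enters the definition, so this is a map on
  \<open>M\<close> and \<open>F\<close> below is globally defined.\<close>

definition W :: "'a \<Rightarrow> real^3" where
  "W p = vector_derivative (\<lambda>t. unit_normal A (Rt t) p) (at 0)"

lemma W_eq:
  assumes c: "c \<in> A" and x: "x \<in> chart_image c"
  shows "((\<lambda>t. Nh c (t, x)) has_vector_derivative W (chart_inv c x)) (at 0)"
    and "W (chart_inv c x) = dw HT (Nh c) (0, x) (1, 0)"
proof -
  note D = dw_slice(2)[OF openin_reg[OF c] smooth_on_Nh[OF c] reg_0[OF c x]]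
  show e: "W (chart_inv c x) = dw HT (Nh c) (0, x) (1, 0)"
    unfolding W_def using vector_derivative_at[OF D] by (simp add: Nh_eq[OF c x])
  show "((\<lambda>t. Nh c (t, x)) has_vector_derivative W (chart_inv c x)) (at 0)" unfolding e by (rule D)
qed

lemma smooth_W: "smooth_map A W"
proof (rule smooth_mapI)
  fix c assume c: "c \<in> A"
  have "smooth_on (chart_image c) (\<lambda>x. dw HT (Nh c) (0, x) (1, 0))"
    by (rule smooth_on_compose[of _ "\<lambda>x. (0, x)" "reg c" "\<lambda>z. dw HT (Nh c) z (1, 0)"])
      (intro smooth_on_Pair smooth_on_const smooth_on_id smooth_on_dw[OF thick_HT openin_reg[OF c] smooth_on_Nh[OF c]] reg_0[OF c] | assumption)+
  then show "smooth_on (chart_image c) (\<lambda>x. W (chart_inv c x))"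
    by (rule smooth_on_cong) (simp add: W_eq(2)[OF c])
qed

text \<open>The variation commutes with coordinate derivatives: \<open>Nh\<close> is smooth jointly
  in time and coordinates on \<open>reg c\<close>, and mixed derivatives within \<open>HT\<close>
  are symmetric there.\<close>

lemma dw_Nh_has_vector_derivative:
  assumes c: "c \<in> A" and x: "x \<in> chart_image c"
  shows "((\<lambda>t. dw HT (Nh c) (t, x) (0, v)) has_vector_derivative coord_deriv c W (chart_inv c x) v) (at 0)"
proof -
  note o = openin_reg[OF c] and s = smooth_on_Nh[OF c] and z = reg_0[OF c x]
  have "coord_deriv c W (chart_inv c x) v = dw half_plane (\<lambda>y. W (chart_inv c y)) x v"
    by (rule coord_deriv_coords[OF c x])
  also have "dw half_plane (\<lambda>y. W (chart_inv c y)) x = dw half_plane (\<lambda>y. dw HT (Nh c) (0, y) (1, 0)) x"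
    by (rule dw_cong[OF surf(6)[OF c] x]) (rule W_eq(2)[OF c])
  also have "dw half_plane (\<lambda>y. dw HT (Nh c) (0, y) (1, 0)) x v = dw HT (\<lambda>z. dw HT (Nh c) z (1, 0)) (0, x) (0, v)"
    by (rule dw_slice(1)[OF o smooth_on_dw[OF thick_HT o s] z, symmetric])
  also have "\<dots> = dw HT (\<lambda>z. dw HT (Nh c) z (0, v)) (0, x) (1, 0)"
    by (rule dw_commute[OF thick_HT o s z])
  finally have "coord_deriv c W (chart_inv c x) v = dw HT (\<lambda>z. dw HT (Nh c) z (0, v)) (0, x) (1, 0)" .
  then show ?thesis using dw_slice(2)[OF o smooth_on_dw[OF thick_HT o s, of "(0, v)"] z] by metis
qed

lemma Rt_0: "Rt 0 = R" by (simp add: Rt_def)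

text \<open>Time derivative of \<open>N \<bullet> N = 1\<close>. The relation holds at those times
  at which the varied map is regular at this point, an open set containing 0.\<close>

lemma W_N:
  assumes "c \<in> A" "p \<in> fst c"
  shows "W p \<bullet> N p = 0"
proof -
  define x where "x = snd c p"
  have x: "x \<in> chart_image c" "p = chart_inv c x" using assms by (simp_all add: x_def chart_in_image chart_inv_chart)
  have D: "((\<lambda>t. Nh c (t, x) \<bullet> Nh c (t, x)) has_vector_derivative
      (Nh c (0, x) \<bullet> W p + W p \<bullet> Nh c (0, x))) (at 0)"
    unfolding x(2) by (rule bounded_bilinear.has_vector_derivative[OF bounded_bilinear_inner W_eq(1)[OF assms(1) x(1)] W_eq(1)[OF assms(1) x(1)]])
  have "open {t. (t, x) \<in> reg c}"
  proof -
    obtain T where T: "open T" "reg c = HT \<inter> T" using openin_reg[OF assms(1)] by (auto simp: openin_open)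
    have "{t. (t, x) \<in> reg c} = (\<lambda>t. (t, x)) -` T"
      using T x chart_image_subset[OF assms(1)] by auto
    moreover have "open ((\<lambda>t. (t, x)) -` T)" by (intro open_vimage T continuous_intros)
    ultimately show ?thesis by simp
  qed
  moreover have "0 \<in> {t. (t, x) \<in> reg c}" using reg_0[OF assms(1) x(1)] by simp
  moreover have "Nh c (t, x) \<bullet> Nh c (t, x) = 1" if "t \<in> {t. (t, x) \<in> reg c}" for t
    using that by (simp add: reg_def Nh_def norm_eq_1[symmetric] norm_sgn)
  ultimately have "((\<lambda>t. 1) has_vector_derivative (Nh c (0, x) \<bullet> W p + W p \<bullet> Nh c (0, x))) (at 0)"
    by (rule has_vector_derivative_transform_within_open[OF D])
  then have "Nh c (0, x) \<bullet> W p + W p \<bullet> Nh c (0, x) = 0"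
    using vector_derivative_unique_at has_vector_derivative_const by blast
  then show ?thesis using Nh_eq[OF assms(1) x(1), of 0] by (simp add: Rt_0 x(2) inner_commute)
qed

text \<open>The densities of \<open>a H + b\<close> and of \<open>R \<bullet> N\<close> as triple
  products: neither a norm nor a definite description has to be differentiated, only multilinear
  expressions. In the second one the normal has disappeared altogether.\<close>

definition \<Phi>1 :: "real \<Rightarrow> real \<Rightarrow> 'a chart \<Rightarrow> real \<times> (real^2) \<Rightarrow> real" where
  "\<Phi>1 a b c z = - a / 2 * (Nh c z \<bullet> (cross3 (dw HT (Nh c) z (0, axis 1 1)) (rdh c 2 z) + cross3 (rdh c 1 z) (dw HT (Nh c) z (0, axis 2 1))))
     + b * (Nh c z \<bullet> cross3 (rdh c 1 z) (rdh c 2 z))"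

definition \<Phi>2 :: "'a chart \<Rightarrow> real \<times> (real^2) \<Rightarrow> real" where
  "\<Phi>2 c z = rh c z \<bullet> cross3 (rdh c 1 z) (rdh c 2 z)"

lemma smooth_on_\<Phi>:
  assumes c: "c \<in> A"
  shows "smooth_on (reg c) (\<Phi>1 a b c)" "smooth_on (reg c) (\<Phi>2 c)"
proof -
  note s = smooth_on_subset[OF smooth_on_rdh[OF c] reg_subset] smooth_on_subset[OF smooth_on_rh[OF c] reg_subset]
    smooth_on_Nh[OF c] smooth_on_dw[OF thick_HT openin_reg[OF c] smooth_on_Nh[OF c]]
  show "smooth_on (reg c) (\<Phi>1 a b c)"
    unfolding \<Phi>1_def
    by (rule smooth_on_add smooth_on_mult smooth_on_inner smooth_on_cross3 smooth_on_const s)+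
  show "smooth_on (reg c) (\<Phi>2 c)"
    unfolding \<Phi>2_def by (rule smooth_on_inner smooth_on_cross3 s)+
qed

lemma \<Phi>_eq:
  assumes c: "c \<in> A" and z: "(t, x) \<in> reg c"
  defines "p \<equiv> chart_inv c x"
  shows "(a * mean_curvature A (Rt t) p + b) * norm (nrm c (Rt t) p) = \<Phi>1 a b c (t, x)"
    and "(Rt t p \<bullet> unit_normal A (Rt t) p) * norm (nrm c (Rt t) p) = \<Phi>2 c (t, x)"
proof -
  have x: "x \<in> chart_image c" using z by (simp add: reg_def)
  have p: "p \<in> fst c" unfolding p_def by (rule chart_inv_in[OF x])
  have n: "nrm c (Rt t) p \<noteq> 0" using z by (simp add: reg_def rdh_def p_def)
  note fr = normal_frame[OF smooth_Rt c p n]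
  have Nn: "unit_normal A (Rt t) p \<bullet> nrm c (Rt t) p = norm (nrm c (Rt t) p)"
    by (subst fr(2)) (simp add: fr(1))
  show "(a * mean_curvature A (Rt t) p + b) * norm (nrm c (Rt t) p) = \<Phi>1 a b c (t, x)"
    unfolding \<Phi>1_def dw_Nh[OF c z] rdh_def Nh_eq[OF c x] fst_conv snd_conv p_def[symmetric]
      curvatures(1)[OF smooth_Rt c p n] inner_scaleR_right Nn
    by (simp add: algebra_simps)
  have "Rt t p \<bullet> nrm c (Rt t) p = (Rt t p \<bullet> unit_normal A (Rt t) p) * norm (nrm c (Rt t) p)"
    by (subst fr(2)) simp
  then show "(Rt t p \<bullet> unit_normal A (Rt t) p) * norm (nrm c (Rt t) p) = \<Phi>2 c (t, x)"
    by (simp add: \<Phi>2_def rh_def rdh_def p_def)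
qed

lemma dw_\<Phi>:
  assumes c: "c \<in> A" and x: "x \<in> chart_image c"
  defines "p \<equiv> chart_inv c x"
  shows "dw HT (\<Phi>1 a b c) (0, x) (1, 0) =
      - a / 2 * (N p \<bullet> ((cross3 (pd c 1 N p) (pd c 2 V p) + cross3 (pd c 1 W p) (pd c 2 R p))
          + (cross3 (pd c 1 R p) (pd c 2 W p) + cross3 (pd c 1 V p) (pd c 2 N p)))
        + W p \<bullet> (cross3 (pd c 1 N p) (pd c 2 R p) + cross3 (pd c 1 R p) (pd c 2 N p)))
      + b * (N p \<bullet> (cross3 (pd c 1 R p) (pd c 2 V p) + cross3 (pd c 1 V p) (pd c 2 R p)) + W p \<bullet> nrm c R p)" (is "?d1 = ?e1")
    and "dw HT (\<Phi>2 c) (0, x) (1, 0) =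
      R p \<bullet> (cross3 (pd c 1 R p) (pd c 2 V p) + cross3 (pd c 1 V p) (pd c 2 R p)) + V p \<bullet> nrm c R p" (is "?d2 = ?e2")
proof -
  have p: "p \<in> fst c" unfolding p_def by (rule chart_inv_in[OF x])
  note z = reg_0[OF c x]
  note cr = bounded_bilinear.has_vector_derivative[OF bounded_bilinear_cross3]
    and inn = bounded_bilinear.has_vector_derivative[OF bounded_bilinear_inner]
  have v0: "Nh c (0, x) = N p" "rdh c i (0, x) = pd c i R p" "dw HT (Nh c) (0, x) (0, v) = coord_deriv c N p v" "rh c (0, x) = R p" for i v
    using Nh_eq[OF c x, of 0] dw_Nh[OF c z] by (simp_all add: Rt_0 rdh_def rh_def p_def)
  have dr: "((\<lambda>t. rdh c i (t, x)) has_vector_derivative pd c i V p) (at 0)" for i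
    unfolding rdh_eq[OF c, of "(_, x)", unfolded snd_conv, OF x] fst_conv snd_conv p_def[symmetric]
    by (auto intro!: derivative_eq_intros)
  have drh: "((\<lambda>t. rh c (t, x)) has_vector_derivative V p) (at 0)"
    unfolding rh_def Rt_def fst_conv snd_conv p_def[symmetric] by (auto intro!: derivative_eq_intros)
  note dN = W_eq(1)[OF c x, folded p_def] and ddN = dw_Nh_has_vector_derivative[OF c x, folded p_def]
  have "((\<lambda>t. \<Phi>1 a b c (t, x)) has_vector_derivative ?e1) (at 0)"
    unfolding \<Phi>1_def
    by (rule has_vector_derivative_eq_rhs,
        rule has_vector_derivative_add[OF has_vector_derivative_mult_right[OF inn[OF dN has_vector_derivative_add[OF cr[OF ddN dr] cr[OF dr ddN]]]]
          has_vector_derivative_mult_right[OF inn[OF dN cr[OF dr dr]]]])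
      (simp add: v0)
  then show "?d1 = ?e1"
    using dw_slice(2)[OF openin_reg[OF c] smooth_on_\<Phi>(1)[OF c] z] vector_derivative_unique_at by blast
  have "((\<lambda>t. \<Phi>2 c (t, x)) has_vector_derivative ?e2) (at 0)"
    unfolding \<Phi>2_def
    by (rule has_vector_derivative_eq_rhs, rule inn[OF drh cr[OF dr dr]]) (simp add: v0)
  then show "?d2 = ?e2"
    using dw_slice(2)[OF openin_reg[OF c] smooth_on_\<Phi>(2)[OF c] z] vector_derivative_unique_at by blast
qed

definition F :: "real \<Rightarrow> real \<Rightarrow> real \<Rightarrow> 'a \<Rightarrow> real^3" where
  "F a b e p = b *\<^sub>R cross3 (N p) (V p) + (e / 3) *\<^sub>R cross3 (R p) (V p) + (- a / 2) *\<^sub>R cross3 (N p) (W p)"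

definition G :: "real \<Rightarrow> 'a \<Rightarrow> real^3" where
  "G a p = (- a / 2) *\<^sub>R cross3 (N p) (V p)"

lemma smooth_F: "smooth_map A (F a b e)" and smooth_G: "smooth_map A (G a)"
  unfolding F_def G_def
  by (intro smooth_map_add smooth_map_scaleR smooth_map_cross3 smooth_map_const smooth_N smooth_V smooth_R smooth_W)+

lemma coord_deriv_FG:
  assumes c: "c \<in> A" "p \<in> fst c"
  shows "coord_deriv c (F a b e) p v = b *\<^sub>R (cross3 (coord_deriv c N p v) (V p) + cross3 (N p) (coord_deriv c V p v))
      + (e / 3) *\<^sub>R (cross3 (coord_deriv c R p v) (V p) + cross3 (R p) (coord_deriv c V p v))
      + (- a / 2) *\<^sub>R (cross3 (coord_deriv c N p v) (W p) + cross3 (N p) (coord_deriv c W p v))"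
    and "coord_deriv c (G a) p v = (- a / 2) *\<^sub>R (cross3 (coord_deriv c N p v) (V p) + cross3 (N p) (coord_deriv c V p v))"
proof -
  have p: "p \<in> topspace M" using c chart_subset by blast
  note sm = smooth_N smooth_V smooth_R smooth_W
  have d: "diff_at N p" "diff_at V p" "diff_at R p" "diff_at W p"
    using smooth_map_diff_at[OF _ p] sm by blast+
  have dx: "diff_at (\<lambda>q. cross3 (f q) (g q)) p" "diff_at (\<lambda>q. k *\<^sub>R cross3 (f q) (g q)) p"
    if "smooth_map A f" "smooth_map A g" for f g k
    by (rule smooth_map_diff_at[OF _ p]; intro smooth_map_scaleR smooth_map_cross3 smooth_map_const that)+
  have ds: "diff_at (\<lambda>q. b *\<^sub>R cross3 (N q) (V q) + (e / 3) *\<^sub>R cross3 (R q) (V q)) p"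
    by (rule smooth_map_diff_at[OF _ p]) (intro smooth_map_add smooth_map_scaleR smooth_map_cross3 smooth_map_const sm)
  show "coord_deriv c (F a b e) p v = b *\<^sub>R (cross3 (coord_deriv c N p v) (V p) + cross3 (N p) (coord_deriv c V p v))
      + (e / 3) *\<^sub>R (cross3 (coord_deriv c R p v) (V p) + cross3 (R p) (coord_deriv c V p v))
      + (- a / 2) *\<^sub>R (cross3 (coord_deriv c N p v) (W p) + cross3 (N p) (coord_deriv c W p v))"
    unfolding F_def
      coord_deriv_add[OF ds dx(2)[OF sm(1,4)] c] coord_deriv_add[OF dx(2)[OF sm(1,2)] dx(2)[OF sm(3,2)] c]
      coord_deriv_scaleR[OF dx(1)[OF sm(1,2)] c] coord_deriv_scaleR[OF dx(1)[OF sm(3,2)] c] coord_deriv_scaleR[OF dx(1)[OF sm(1,4)] c]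
      coord_deriv_cross3[OF d(1,2) c] coord_deriv_cross3[OF d(3,2) c] coord_deriv_cross3[OF d(1,4) c]
    by (simp add: add.commute)
  show "coord_deriv c (G a) p v = (- a / 2) *\<^sub>R (cross3 (coord_deriv c N p v) (V p) + cross3 (N p) (coord_deriv c V p v))"
    unfolding G_def coord_deriv_scaleR[OF dx(1)[OF sm(1,2)] c] coord_deriv_cross3[OF d(1,2) c]
    by (simp add: add.commute)
qed

text \<open>Pairing unites the two exact terms: for the inner product of pairs, the wedge of
  \<open>(F, G)\<close> with \<open>(R, N)\<close> is \<open>dF \<and> dR + dG \<and> dN\<close>, so
  a single application of Stokes' theorem will do.\<close>

lemma density_variation:
  assumes c: "c \<in> A" and x: "x \<in> chart_image c"
  defines "p \<equiv> chart_inv c x"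
  shows "dw HT (\<Phi>1 a b c) (0, x) (1, 0) + e / 3 * dw HT (\<Phi>2 c) (0, x) (1, 0) =
    - ((a * gauss_curvature A R p + 2 * b * mean_curvature A R p - e) * normal_part A R V p * norm (nrm c R p))
    + wedge c (\<lambda>q. (F a b e q, G a q)) (\<lambda>q. (R q, N q)) p"
proof -
  have p: "p \<in> fst c" unfolding p_def by (rule chart_inv_in[OF x])
  have pM: "p \<in> topspace M" using p c chart_subset by blast
  note n = nrm_R[OF c p]
  note d = smooth_map_diff_at[OF smooth_F pM] smooth_map_diff_at[OF smooth_G pM]
    smooth_map_diff_at[OF smooth_R pM] smooth_map_diff_at[OF smooth_N pM]
  show ?thesis
    unfolding dw_\<Phi>[OF c x, folded p_def] wedge_def coord_deriv_Pair[OF d(1,2) c p] coord_deriv_Pair[OF d(3,4) c p]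
      inner_Pair coord_deriv_FG[OF c p] normal_part_def
    using variation_algebra[OF normal_frame(2)[OF smooth_R c p n] W_N[OF c p] curvatures[OF smooth_R c p n],
        where a = a and b = b and e = e and V = "V p" and R = "R p" and ?W1.0 = "pd c 1 W p" and ?W2.0 = "pd c 2 W p"
          and ?V1.0 = "pd c 1 V p" and ?V2.0 = "pd c 2 V p"]
    by (simp add: add_ac)
qed

end

section \<open>First variation of the energy\<close>

text \<open>\<open>S T + T S = (tr S) T\<close> for the shape operator \<open>S\<close> and the rotation \<open>T\<close> by a right angle,
  evaluated at \<open>r1\<close>.\<close>

lemma shape_operator_rotation:
  fixes r1 r2 N N1 N2 :: "real^3"
  assumes n: "cross3 r1 r2 \<noteq> 0" and n1: "N1 \<bullet> cross3 r1 r2 = 0" "N2 \<bullet> cross3 r1 r2 = 0"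
    and sym: "N1 \<bullet> r2 = N2 \<bullet> r1"
    and h: "cross3 N1 r2 + cross3 r1 N2 = - (2 * h) *\<^sub>R cross3 r1 r2"
  shows "(r1 \<bullet> r2) *\<^sub>R N1 - (r1 \<bullet> r1) *\<^sub>R N2 + cross3 N1 (cross3 r1 r2) = - (2 * h) *\<^sub>R cross3 r1 (cross3 r1 r2)"
proof -
  obtain \<alpha> \<beta> where N1: "N1 = \<alpha> *\<^sub>R r1 + \<beta> *\<^sub>R r2" by (rule tangent_span[OF n n1(1)])
  obtain \<gamma> \<delta> where N2: "N2 = \<gamma> *\<^sub>R r1 + \<delta> *\<^sub>R r2" by (rule tangent_span[OF n n1(2)])
  have "cross3 N1 r2 + cross3 r1 N2 = (\<alpha> + \<delta>) *\<^sub>R cross3 r1 r2"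
    unfolding N1 N2 by (simp add: cross_add_left cross_add_right cross_mult_left cross_mult_right algebra_simps)
  \<comment> \<open>\<open>N1\<close> and \<open>N2\<close> are minus the shape operator applied to
    \<open>r1\<close> and \<open>r2\<close>, so their coefficient matrix has trace
    \<open>- 2 h\<close>.\<close>
  then have tr: "\<alpha> + \<delta> = - (2 * h)" using h n by (metis scaleR_right_imp_eq)
  have s: "\<alpha> * (r1 \<bullet> r2) + \<beta> * (r2 \<bullet> r2) = \<gamma> * (r1 \<bullet> r1) + \<delta> * (r1 \<bullet> r2)"
    using sym unfolding N1 N2 by (simp add: inner_add_left inner_commute[of r2 r1])
  have "(r1 \<bullet> r2) *\<^sub>R N1 - (r1 \<bullet> r1) *\<^sub>R N2 + cross3 N1 (cross3 r1 r2) =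
      ((\<alpha> * (r1 \<bullet> r2) + \<beta> * (r2 \<bullet> r2)) + (r1 \<bullet> r2) * \<alpha> - (r1 \<bullet> r1) * \<gamma>) *\<^sub>R r1
      - ((\<alpha> + \<delta>) * (r1 \<bullet> r1)) *\<^sub>R r2"
    unfolding Lagrange N1 N2 by (simp add: inner_add_left inner_commute[of r2 r1] vec_eq_iff algebra_simps)
  also have "\<dots> = ((\<alpha> + \<delta>) * (r1 \<bullet> r2)) *\<^sub>R r1 - ((\<alpha> + \<delta>) * (r1 \<bullet> r1)) *\<^sub>R r2"
    unfolding s by (simp add: algebra_simps)
  also have "\<dots> = - (2 * h) *\<^sub>R cross3 r1 (cross3 r1 r2)"
    unfolding Lagrange tr by (simp add: algebra_simps)
  finally show ?thesis .
qed

text \<open>Of \<open>W\<close> only the product with \<open>\<tau> = r1 \<times> N\<close> is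
  needed. Since \<open>J \<tau> = (r1 \<bullet> r2) r1 - (r1 \<bullet> r1) r2\<close>, it is
  determined by the products of \<open>W\<close> with \<open>r1\<close> and \<open>r2\<close>.
  Adding the gradient \<open>g\<close> cancels the derivatives of \<open>V\<close> and leaves
  \<open>V \<bullet> N1\<close> and \<open>V \<bullet> N2\<close>, which the identity for the shape
  operator turns into the mean curvature term.\<close>

lemma boundary_algebra:
  fixes N R V W g r1 r2 N1 N2 V1 V2 :: "real^3" and a b e h J :: real
  assumes n: "cross3 r1 r2 = J *\<^sub>R N" "J > 0" and NN: "N \<bullet> N = 1" "N \<bullet> r1 = 0" "N \<bullet> r2 = 0" "N \<bullet> N1 = 0" "N \<bullet> N2 = 0"
    and sym: "N1 \<bullet> r2 = N2 \<bullet> r1"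
    and h: "cross3 N1 r2 + cross3 r1 N2 = - (2 * h) *\<^sub>R cross3 r1 r2"
    and W: "W \<bullet> r1 = - (N \<bullet> V1)" "W \<bullet> r2 = - (N \<bullet> V2)"
    and g: "g \<bullet> r1 = V1 \<bullet> N + V \<bullet> N1" "g \<bullet> r2 = V2 \<bullet> N + V \<bullet> N2"
  shows "(b *\<^sub>R cross3 N V + (e / 3) *\<^sub>R cross3 R V + (- a / 2) *\<^sub>R cross3 N W) \<bullet> r1 + ((- a / 2) *\<^sub>R cross3 N V) \<bullet> N1 =
    (a *\<^sub>R ((1/2) *\<^sub>R g + h *\<^sub>R (V - (V \<bullet> N) *\<^sub>R N)) + b *\<^sub>R (V - (V \<bullet> N) *\<^sub>R N)
      + (e/3) *\<^sub>R ((R \<bullet> N) *\<^sub>R (V - (V \<bullet> N) *\<^sub>R N) - (V \<bullet> N) *\<^sub>R R)) \<bullet> cross3 r1 N"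
proof -
  let ?\<tau> = "cross3 r1 N"
  have n0: "cross3 r1 r2 \<noteq> 0" using n NN(1) by auto
  have nN: "X \<bullet> cross3 r1 r2 = J * (X \<bullet> N)" for X unfolding n by simp
  have N\<tau>: "N \<bullet> ?\<tau> = 0" by (simp add: dot_cross_self)
  have J\<tau>: "J *\<^sub>R ?\<tau> = cross3 r1 (cross3 r1 r2)" unfolding n by (simp add: cross_mult_right)
  have Wg: "(W + g) \<bullet> r1 = V \<bullet> N1" "(W + g) \<bullet> r2 = V \<bullet> N2"
    using W g by (simp_all add: inner_add_left inner_commute[of V1 N] inner_commute[of V2 N])
  have "J * ((W + g) \<bullet> ?\<tau>) = (W + g) \<bullet> (J *\<^sub>R ?\<tau>)" by simp
  also have "\<dots> = (r1 \<bullet> r2) * ((W + g) \<bullet> r1) - (r1 \<bullet> r1) * ((W + g) \<bullet> r2)"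
    unfolding J\<tau> Lagrange by (simp add: inner_diff_right)
  also have "\<dots> = V \<bullet> ((r1 \<bullet> r2) *\<^sub>R N1 - (r1 \<bullet> r1) *\<^sub>R N2)"
    unfolding Wg by (simp add: inner_diff_right)
  finally have 1: "J * ((W + g) \<bullet> ?\<tau>) = V \<bullet> ((r1 \<bullet> r2) *\<^sub>R N1 - (r1 \<bullet> r1) *\<^sub>R N2)" .
  have 2: "J * (V \<bullet> cross3 N1 N) = V \<bullet> cross3 N1 (cross3 r1 r2)"
    unfolding n by (simp add: cross_mult_right)
  have "J * ((W + g) \<bullet> ?\<tau> + V \<bullet> cross3 N1 N) =
      V \<bullet> ((r1 \<bullet> r2) *\<^sub>R N1 - (r1 \<bullet> r1) *\<^sub>R N2 + cross3 N1 (cross3 r1 r2))"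
    unfolding distrib_left 1 2 inner_add_right ..
  also have "\<dots> = V \<bullet> (- (2 * h) *\<^sub>R (J *\<^sub>R ?\<tau>))"
    using shape_operator_rotation[OF n0 _ _ sym h] NN unfolding nN J\<tau> by (simp add: inner_commute)
  also have "\<dots> = J * (- (2 * h) * (V \<bullet> ?\<tau>))" by simp
  finally have "J * ((W + g) \<bullet> ?\<tau> + V \<bullet> cross3 N1 N) = J * (- (2 * h) * (V \<bullet> ?\<tau>))" .
  then have key: "(W + g) \<bullet> ?\<tau> + V \<bullet> cross3 N1 N = - (2 * h) * (V \<bullet> ?\<tau>)"
    by (rule mult_left_cancel[THEN iffD1, rotated]) (use n(2) in simp)
  have b1: "cross3 N V \<bullet> r1 = V \<bullet> ?\<tau>" "cross3 N W \<bullet> r1 = W \<bullet> ?\<tau>" "cross3 N V \<bullet> N1 = V \<bullet> cross3 N1 N"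
    by (simp_all add: inner_vec_def sum_3 cross_components algebra_simps)
  \<comment> \<open>Expansion of \<open>(R \<times> V) \<bullet> (N \<times> \<tau>)\<close>, where
    \<open>N \<times> \<tau> = r1\<close>.\<close>
  have b2: "cross3 R V \<bullet> r1 = (R \<bullet> N) * (V \<bullet> ?\<tau>) - (V \<bullet> N) * (R \<bullet> ?\<tau>)"
  proof -
    have "(R \<bullet> N) * (V \<bullet> ?\<tau>) - (V \<bullet> N) * (R \<bullet> ?\<tau>) = (N \<bullet> N) * (cross3 R V \<bullet> r1) - (N \<bullet> r1) * (cross3 R V \<bullet> N)"
      by (simp add: inner_vec_def sum_3 cross_components algebra_simps)
    then show ?thesis using NN by simp
  qed
  have key': "- a / 2 * (W \<bullet> ?\<tau>) + - a / 2 * (V \<bullet> cross3 N1 N) = a * (1/2 * (g \<bullet> ?\<tau>) + h * (V \<bullet> ?\<tau>))"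
  proof -
    have "V \<bullet> cross3 N1 N = - (2 * h) * (V \<bullet> ?\<tau>) - W \<bullet> ?\<tau> - g \<bullet> ?\<tau>"
      using key by (simp add: inner_add_left)
    then show ?thesis by (simp only:) (simp add: algebra_simps)
  qed
  show ?thesis
    unfolding inner_add_left inner_scaleR_left inner_diff_left b1 b2 N\<tau>
    using key' by (simp add: algebra_simps)
qed

text \<open>The second coordinates are eliminated by a combination of \<open>m\<close> and
  \<open>m'\<close>, which is then a multiple of \<open>D (axis 1 1)\<close> and orthogonal to it,
  hence zero. Equal lengths and equal signs do the rest.\<close>

lemma outward_conormal_unique:
  fixes D :: "real^2 \<Rightarrow> real^3"
  assumes D: "linear D" "cross3 (D (axis 1 1)) (D (axis 2 1)) \<noteq> 0"
    and m: "norm m = 1" "m \<bullet> D (axis 1 1) = 0" "m = D u" "u $ 2 < 0"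
    and m': "norm m' = 1" "m' \<bullet> D (axis 1 1) = 0" "m' = D u'" "u' $ 2 < 0"
  shows "m = m'"
proof -
  let ?z = "u' $ 2 *\<^sub>R m - u $ 2 *\<^sub>R m'"
  let ?k = "u' $ 2 * u $ 1 - u $ 2 * u' $ 1"
  have e: "?z = ?k *\<^sub>R D (axis 1 1)"
    unfolding m(3) m'(3) linear_vec2[OF D(1), of u] linear_vec2[OF D(1), of u'] by (simp add: algebra_simps)
  have "?z \<bullet> ?z = ?z \<bullet> (?k *\<^sub>R D (axis 1 1))" using e by simp
  also have "\<dots> = 0" using m(2) m'(2) by (simp add: inner_diff_left)
  finally have z: "u' $ 2 *\<^sub>R m = u $ 2 *\<^sub>R m'" by simp
  then have "norm (u' $ 2 *\<^sub>R m) = norm (u $ 2 *\<^sub>R m')" by simp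
  then have "u' $ 2 = u $ 2" using m m' by simp
  then show ?thesis using z m(4) by simp
qed

section \<open>Surface gradient and outward conormal\<close>

context immersed_surface
begin

text \<open>The definite description is resolved by an explicit tangent vector in
  \<open>chart_at A p\<close>; uniqueness holds because a tangent vector orthogonal to both
  coordinate directions is zero.\<close>

lemma surface_gradient:
  assumes f: "smooth_map A f" and c: "c \<in> A" "p \<in> fst c"
  shows "surface_gradient A R f p \<bullet> coord_deriv c R p u = coord_deriv c f p u"
    and "surface_gradient A R f p \<bullet> N p = 0"
proof -
  let ?d = "chart_at A p"
  have p: "p \<in> topspace M" using c chart_subset by blast
  have d: "?d \<in> A" "p \<in> fst ?d" using chart_at[OF p] by auto
  note dR = smooth_map_diff_at[OF smooth_R p] and df = smooth_map_diff_at[OF f p]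
  note lin = linear_coord_deriv[OF dR d] linear_coord_deriv[OF df d]
  note n0 = nrm_R[OF d]
  let ?r1 = "pd ?d 1 R p" and ?r2 = "pd ?d 2 R p" and ?n = "nrm ?d R p"
  let ?P = "\<lambda>w. w \<in> range (differential A R p) \<and> (\<forall>u. w \<bullet> differential A R p u = differential A f p u)"
  \<comment> \<open>For \<open>n = r1 \<times> r2\<close>, the vectors \<open>r2 \<times> n\<close>
    and \<open>n \<times> r1\<close> divided by \<open>n \<bullet> n\<close> are the dual basis of
    \<open>r1\<close>, \<open>r2\<close> in the tangent plane.\<close>
  define w where "w = inverse (?n \<bullet> ?n) *\<^sub>R (pd ?d 1 f p *\<^sub>R cross3 ?r2 ?n + pd ?d 2 f p *\<^sub>R cross3 ?n ?r1)"
  have wn: "w \<bullet> ?n = 0" by (simp add: w_def inner_add_left dot_cross_self)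
  obtain x y where xy: "w = x *\<^sub>R ?r1 + y *\<^sub>R ?r2" by (rule tangent_span[OF n0 wn])
  have "w = coord_deriv ?d R p (vector [x, y])" using linear_vec2[OF lin(1), of "vector [x, y]"] xy by simp
  moreover have c1: "cross3 ?r2 ?n \<bullet> ?r1 = ?n \<bullet> ?n" "cross3 ?n ?r1 \<bullet> ?r2 = ?n \<bullet> ?n"
    "cross3 ?n ?r1 \<bullet> ?r1 = 0" "cross3 ?r2 ?n \<bullet> ?r2 = 0"
    by (simp_all add: inner_vec_def sum_3 cross_components algebra_simps)
  have "w \<bullet> ?r1 = pd ?d 1 f p" "w \<bullet> ?r2 = pd ?d 2 f p"
    using n0 unfolding w_def by (simp_all add: inner_add_left c1 field_simps)
  then have w2: "w \<bullet> coord_deriv ?d R p u = coord_deriv ?d f p u" for u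
    using linear_vec2[OF lin(1), of u] linear_vec2[OF lin(2), of u] by (simp add: inner_add_right)
  ultimately have Pw: "?P w" by blast
  have gw: "surface_gradient A R f p = w"
    unfolding surface_gradient_def
  proof (rule the_equality[where P = ?P, OF Pw])
    fix w' assume w': "?P w'"
    then obtain u' where u': "w' = differential A R p u'" by blast
    have "w' \<bullet> ?n = 0" unfolding u' linear_vec2[OF lin(1), of u'] by (simp add: inner_add_left dot_cross_self)
    then have "w' - w = 0"
      using w' w2 wn by (intro tangent_zero[OF n0]) (simp_all add: inner_diff_left)
    then show "w' = w" by simp
  qed
  show "surface_gradient A R f p \<bullet> coord_deriv c R p u = coord_deriv c f p u"
    unfolding gw coord_deriv_change[OF dR c(1) d(1) c(2) d(2)] coord_deriv_change[OF df c(1) d(1) c(2) d(2)] by (rule w2)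
  show "surface_gradient A R f p \<bullet> N p = 0"
    unfolding gw unit_normal_chart[OF smooth_R d] using wn by (simp add: sgn_div_norm)
qed

text \<open>The conormal is defined in \<open>chart_at A p\<close> but needed in the charts of the
  partition; the triangular form of the Jacobian at boundary points shows that both charts agree on
  the boundary direction and on the outward side.\<close>

lemma outward_conormal:
  assumes c: "c \<in> A" "p \<in> fst c" and bd: "snd c p $ 2 = 0"
  shows "norm (pd c 1 R p) *\<^sub>R outward_conormal A R p = cross3 (pd c 1 R p) (N p)"
proof -
  let ?d = "chart_at A p"
  have p: "p \<in> topspace M" using c chart_subset by blast
  have d: "?d \<in> A" "p \<in> fst ?d" using chart_at[OF p] by auto
  note dR = smooth_map_diff_at[OF smooth_R p]
  note n0 = nrm_R[OF c]
  note fr = normal_frame[OF smooth_R c n0]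
  obtain l m where lm: "l > 0" "m > 0" "coord_deriv c (snd ?d) p (axis 1 1) = l *\<^sub>R axis 1 1"
    "\<And>u. coord_deriv c (snd ?d) p u $ 2 = m * u $ 2"
    by (rule boundary_trans[OF c(1) d(1) c(2) d(2) bd]) (rule that)
  let ?r1 = "pd c 1 R p" and ?r2 = "pd c 2 R p"
  have r1: "?r1 \<noteq> 0" using n0 by auto
  have Nr: "?r1 \<bullet> N p = 0" using fr(3) by (simp add: inner_commute)
  define t where "t = inverse (norm ?r1) *\<^sub>R cross3 ?r1 (N p)"
  have nt: "norm t = 1"
  proof -
    have "(norm (cross3 ?r1 (N p)))\<^sup>2 = (norm ?r1)\<^sup>2"
      using norm_cross_dot[of ?r1 "N p"] Nr fr(1) by (simp add: norm_eq_1)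
    then have "norm (cross3 ?r1 (N p)) = norm ?r1" by simp
    then show ?thesis using r1 by (simp add: t_def)
  qed
  have t1: "t \<bullet> ?r1 = 0" by (simp add: t_def dot_cross_self)
  have tN: "t \<bullet> N p = 0" by (simp add: t_def dot_cross_self)
  have tn: "t \<bullet> nrm c R p = 0" by (subst fr(2)) (simp add: tN)
  obtain x y where xy: "t = x *\<^sub>R ?r1 + y *\<^sub>R ?r2" by (rule tangent_span[OF n0 tn])
  \<comment> \<open>The sign of \<open>y\<close> is read off from
    \<open>(r1 \<times> t) \<bullet> N\<close>, which equals both \<open>y |r1 \<times> r2|\<close>
    and \<open>- |r1|\<close>.\<close>
  have "cross3 ?r1 t = y *\<^sub>R nrm c R p" unfolding xy by (simp add: cross_add_right cross_mult_right)
  then have "cross3 ?r1 t \<bullet> N p = y * (N p \<bullet> nrm c R p)" by (simp add: inner_commute)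
  also have "N p \<bullet> nrm c R p = norm (nrm c R p)" by (subst fr(2)) (simp add: fr(1))
  also have "cross3 ?r1 t \<bullet> N p = - norm ?r1"
    unfolding t_def cross_mult_right Lagrange using Nr fr(1) r1
    by (simp add: inner_diff_left power2_norm_eq_inner[symmetric] power2_eq_square)
  finally have "y * norm (nrm c R p) = - norm ?r1" ..
  then have "y * norm (nrm c R p) < 0" using zero_less_norm_iff[of ?r1] r1 by linarith
  then have y: "y < 0" by (simp add: mult_less_0_iff)
  define u0 where "u0 = (vector [x, y] :: real^2)"
  have tD: "t = coord_deriv c R p u0"
    using linear_vec2[OF linear_coord_deriv[OF dR c], of u0] xy by (simp add: u0_def)
  let ?D = "differential A R p"
  note ch = coord_deriv_change[OF dR c(1) d(1) c(2) d(2)]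
  have linD: "linear ?D" by (rule linear_coord_deriv[OF dR d])
  have P: "norm t = 1" "t \<bullet> ?D (axis 1 1) = 0" "t = ?D (coord_deriv c (snd ?d) p u0)" "coord_deriv c (snd ?d) p u0 $ 2 < 0"
  proof -
    have "t \<bullet> ?D (l *\<^sub>R axis 1 1) = 0" using t1 unfolding ch lm(3) .
    then show "t \<bullet> ?D (axis 1 1) = 0" using lm(1) by (simp add: linear_cmul[OF linD])
    show "t = ?D (coord_deriv c (snd ?d) p u0)" using tD unfolding ch .
    show "coord_deriv c (snd ?d) p u0 $ 2 < 0" using lm(2,4) y by (simp add: u0_def mult_pos_neg)
  qed (rule nt)
  have "outward_conormal A R p = t"
    unfolding outward_conormal_def
  proof (rule the_equality)
    show "norm t = 1 \<and> t \<bullet> ?D (axis 1 1) = 0 \<and> (\<exists>u. u $ 2 < 0 \<and> t = ?D u)" using P by blast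
    fix t' assume "norm t' = 1 \<and> t' \<bullet> ?D (axis 1 1) = 0 \<and> (\<exists>u. u $ 2 < 0 \<and> t' = ?D u)"
    then show "t' = t" using outward_conormal_unique[OF linD nrm_R[OF d]] P by blast
  qed
  then show ?thesis using r1 by (simp add: t_def)
qed

end

section \<open>Boundary flux and the first variation\<close>

context variation
begin

text \<open>Time derivative of the orthogonality of the normal to the coordinate directions. By
  \<open>sgn 0 = 0\<close> the orthogonality holds at all times, even where the varied map is
  singular.\<close>

lemma W_tangent:
  assumes c: "c \<in> A" "p \<in> fst c"
  shows "W p \<bullet> pd c i R p = - (N p \<bullet> pd c i V p)"
proof -
  define x where "x = snd c p"
  have x: "x \<in> chart_image c" "p = chart_inv c x" using c by (simp_all add: x_def chart_in_image chart_inv_chart)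
  have orth: "Nh c (t, x) \<bullet> rdh c i (t, x) = 0" for t
    using exhaust_2[of i] by (auto simp: Nh_def sgn_div_norm dot_cross_self)
  have r: "((\<lambda>t. rdh c i (t, x)) has_vector_derivative pd c i V p) (at 0)"
    unfolding rdh_eq[OF c(1), of "(_, x)", unfolded snd_conv, OF x(1)] fst_conv snd_conv x(2)[symmetric]
    by (auto intro!: derivative_eq_intros)
  have "((\<lambda>t. Nh c (t, x) \<bullet> rdh c i (t, x)) has_vector_derivative
      (Nh c (0, x) \<bullet> pd c i V p + W p \<bullet> rdh c i (0, x))) (at 0)"
    using bounded_bilinear.has_vector_derivative[OF bounded_bilinear_inner W_eq(1)[OF c(1) x(1)] r] unfolding x(2) .
  then have "((\<lambda>t. 0) has_vector_derivative (Nh c (0, x) \<bullet> pd c i V p + W p \<bullet> rdh c i (0, x))) (at 0)"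
    unfolding orth .
  then have "Nh c (0, x) \<bullet> pd c i V p + W p \<bullet> rdh c i (0, x) = 0"
    using vector_derivative_unique_at has_vector_derivative_const by blast
  then show ?thesis using Nh_eq[OF c(1) x(1), of 0] x(2) by (simp add: Rt_0 rdh_def)
qed

lemma smooth_normal_part: "smooth_map A (normal_part A R V)"
  unfolding normal_part_def[abs_def] by (intro smooth_map_inner smooth_V smooth_N)

definition boundary_flux :: "real \<Rightarrow> real \<Rightarrow> real \<Rightarrow> 'a \<Rightarrow> real" where
  "boundary_flux a b e p =
    (a *\<^sub>R ((1/2) *\<^sub>R surface_gradient A R (normal_part A R V) p + mean_curvature A R p *\<^sub>R tangential_part A R V p)
      + b *\<^sub>R tangential_part A R V p
      + (e/3) *\<^sub>R ((R p \<bullet> N p) *\<^sub>R tangential_part A R V p - normal_part A R V p *\<^sub>R R p)) \<bullet> outward_conormal A R p"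

lemma boundary_flux:
  assumes c: "c \<in> A" "p \<in> fst c" "snd c p $ 2 = 0"
  shows "(F a b e p, G a p) \<bullet> pd c 1 (\<lambda>q. (R q, N q)) p = boundary_flux a b e p * norm (pd c 1 R p)"
proof -
  have p: "p \<in> topspace M" using c chart_subset by blast
  note d = smooth_map_diff_at[OF smooth_R p] smooth_map_diff_at[OF smooth_N p] smooth_map_diff_at[OF smooth_V p]
  note n0 = nrm_R[OF c(1,2)]
  note fr = normal_frame[OF smooth_R c(1,2) n0]
  have g: "surface_gradient A R (normal_part A R V) p \<bullet> pd c i R p = pd c i V p \<bullet> N p + V p \<bullet> pd c i N p" for i
    unfolding surface_gradient(1)[OF smooth_normal_part c(1,2)]
    unfolding normal_part_def[abs_def] coord_deriv_bilinear[OF bounded_bilinear_inner d(3,2) c(1,2)] by simp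
  have "(F a b e p, G a p) \<bullet> pd c 1 (\<lambda>q. (R q, N q)) p = F a b e p \<bullet> pd c 1 R p + G a p \<bullet> pd c 1 N p"
    unfolding coord_deriv_Pair[OF d(1,2) c(1,2)] inner_Pair ..
  also have "\<dots> = (a *\<^sub>R ((1/2) *\<^sub>R surface_gradient A R (normal_part A R V) p + mean_curvature A R p *\<^sub>R tangential_part A R V p)
      + b *\<^sub>R tangential_part A R V p
      + (e/3) *\<^sub>R ((R p \<bullet> N p) *\<^sub>R tangential_part A R V p - normal_part A R V p *\<^sub>R R p)) \<bullet> cross3 (pd c 1 R p) (N p)"
    unfolding F_def G_def tangential_part_def normal_part_def[of A R V p]
    by (rule boundary_algebra[OF fr(2) _ fr(1,3,3,4,4,5) curvatures(1)[OF smooth_R c(1,2) n0]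
          W_tangent[OF c(1,2)] W_tangent[OF c(1,2)] g g]) (use n0 in simp)
  also have "\<dots> = boundary_flux a b e p * norm (pd c 1 R p)"
    unfolding outward_conormal[OF c, symmetric] boundary_flux_def by simp
  finally show ?thesis .
qed

text \<open>\<open>\<Psi>\<close> is the density in its geometric form and agrees with the smooth
  \<open>\<Phi>\<close> only on \<open>reg (pc i)\<close>. By the tube lemma this set contains the
  support of \<open>\<rho> i\<close> for all small times, and elsewhere the factor
  \<open>\<rho> i\<close> is zero.\<close>

lemma Leibniz_chart:
  assumes i: "i < pn" and \<Phi>: "smooth_on (reg (pc i)) \<Phi>"
    and eq: "\<And>t x. (t, x) \<in> reg (pc i) \<Longrightarrow> \<Psi> t (chart_inv (pc i) x) = \<Phi> (t, x)"
  shows "((\<lambda>t. cint (pc i) (\<lambda>p. \<rho> i p * \<Psi> t p)) has_real_derivative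
      cint (pc i) (\<lambda>p. \<rho> i p * dw HT \<Phi> (0, snd (pc i) p) (1, 0))) (at 0)"
proof -
  define c where "c = pc i"
  define K where "K = snd c ` supp i"
  have c: "c \<in> A" using pc[OF i] by (simp add: c_def)
  have K: "compact K" "K \<subseteq> chart_image c"
    using compact_chart_image[OF c] compactin_supp supp_subset[OF i] by (auto simp: K_def c_def chart_image_def)
  have z: "\<rho> i (chart_inv c x) = 0" if "x \<in> chart_image c - K" for x
  proof (rule \<rho>_zero)
    show "chart_inv c x \<in> topspace M" using that chart_inv_in[of x c] chart_subset[OF c] by auto
    show "chart_inv c x \<notin> supp i" using that chart_chart_inv[of x c] unfolding K_def by (metis DiffD1 DiffD2 image_eqI)
  qed
  have cont: "continuous_on (chart_image c) (\<lambda>x. \<rho> i (chart_inv c x))"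
    by (rule smooth_on_continuous[OF smooth_mapD[OF \<rho>_smooth[OF i] c]])
  have sub: "{0} \<times> K \<subseteq> reg c" using reg_0[OF c] K(2) by auto
  have D: "((\<lambda>t. integral (chart_image c) (\<lambda>x. \<rho> i (chart_inv c x) * \<Phi> (t, x))) has_real_derivative
      integral (chart_image c) (\<lambda>x. \<rho> i (chart_inv c x) * dw HT \<Phi> (0, x) (1, 0))) (at 0)"
    by (rule Leibniz_half_plane[OF surf(6)[OF c] K cont z openin_reg[OF c] sub reg_subset \<Phi>[folded c_def]])
  obtain T where T: "open T" "reg c = HT \<inter> T" using openin_reg[OF c] by (auto simp: openin_open)
  obtain X where X: "0 \<in> X" "open X" "X \<times> K \<subseteq> T"
    using Elementary_Topology.tube_lemma[OF K(1) T(1), of 0] sub T(2) by blast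
  have "integral (chart_image c) (\<lambda>x. \<rho> i (chart_inv c x) * \<Phi> (t, x)) = cint c (\<lambda>p. \<rho> i p * \<Psi> t p)" if t: "t \<in> X" for t
    unfolding cint_def
  proof (rule integral_cong)
    fix x assume x: "x \<in> chart_image c"
    show "\<rho> i (chart_inv c x) * \<Phi> (t, x) = \<rho> i (chart_inv c x) * \<Psi> t (chart_inv c x)"
    proof (cases "x \<in> K")
      case True
      then have "(t, x) \<in> reg c" using X(3) t T(2) x chart_image_subset[OF c] by auto
      then show ?thesis using eq[folded c_def] by simp
    next
      case False
      then show ?thesis using z x by simp
    qed
  qed
  from has_field_derivative_transform_within_open[OF D X(2,1) this]
  have "((\<lambda>t. cint c (\<lambda>p. \<rho> i p * \<Psi> t p)) has_real_derivative
      integral (chart_image c) (\<lambda>x. \<rho> i (chart_inv c x) * dw HT \<Phi> (0, x) (1, 0))) (at 0)" by simp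
  also have "integral (chart_image c) (\<lambda>x. \<rho> i (chart_inv c x) * dw HT \<Phi> (0, x) (1, 0)) =
      cint c (\<lambda>p. \<rho> i p * dw HT \<Phi> (0, snd c p) (1, 0))"
    unfolding cint_def by (rule integral_cong) (simp add: chart_chart_inv)
  finally show ?thesis unfolding c_def .
qed

lemma energy_Rt:
  "energy M A a b e (Rt t) =
    (\<Sum>i<pn. cint (pc i) (\<lambda>p. \<rho> i p * ((a * mean_curvature A (Rt t) p + b) * norm (nrm (pc i) (Rt t) p))))
    + e * (1 / 3 * (\<Sum>i<pn. cint (pc i) (\<lambda>p. \<rho> i p * ((Rt t p \<bullet> unit_normal A (Rt t) p) * norm (nrm (pc i) (Rt t) p)))))"
  unfolding energy_def algebraic_volume_def surface_integral_eq by (simp only: mult.assoc)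

lemma cint_integrable_\<rho>:
  assumes i: "i < pn" and f: "continuous_on (chart_image (pc i)) (\<lambda>x. f (chart_inv (pc i) x))"
  shows "(\<lambda>x. \<rho> i (chart_inv (pc i) x) * f (chart_inv (pc i) x)) absolutely_integrable_on chart_image (pc i)"
proof (rule cint_absolutely_integrable[OF pc[OF i] compactin_supp[of i] supp_subset[OF i]])
  show "continuous_on (chart_image (pc i)) (\<lambda>x. \<rho> i (chart_inv (pc i) x) * f (chart_inv (pc i) x))"
    by (intro continuous_on_mult f smooth_on_continuous[OF smooth_mapD[OF \<rho>_smooth[OF i] pc[OF i]]])
  show "\<rho> i p * f p = 0" if "p \<in> fst (pc i) - supp i" for p
    using that \<rho>_zero[of p i] chart_subset[OF pc[OF i]] by auto
qed

text \<open>The time derivative is taken chart by chart, but the exact part is summed over the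
  partition before it becomes a boundary term: in a single chart the differential of
  \<open>\<rho> i\<close> would remain.\<close>

theorem energy_first_variation:
  "((\<lambda>t. energy M A a b e (Rt t)) has_real_derivative
     (- surface_integral M A R (\<lambda>p. (a * gauss_curvature A R p + 2 * b * mean_curvature A R p - e) * normal_part A R V p)
      + boundary_integral M A R (boundary_flux a b e))) (at 0)"
proof -
  let ?d1 = "\<lambda>i p. dw HT (\<Phi>1 a b (pc i)) (0, snd (pc i) p) (1, 0)"
  let ?d2 = "\<lambda>i p. dw HT (\<Phi>2 (pc i)) (0, snd (pc i) p) (1, 0)"
  let ?X = "\<lambda>p. (a * gauss_curvature A R p + 2 * b * mean_curvature A R p - e) * normal_part A R V p"
  let ?w = "\<lambda>i. wedge (pc i) (\<lambda>q. (F a b e q, G a q)) (\<lambda>q. (R q, N q))"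
  have D1: "((\<lambda>t. cint (pc i) (\<lambda>p. \<rho> i p * ((a * mean_curvature A (Rt t) p + b) * norm (nrm (pc i) (Rt t) p)))) has_real_derivative
      cint (pc i) (\<lambda>p. \<rho> i p * ?d1 i p)) (at 0)" if "i < pn" for i
    by (rule Leibniz_chart[OF that smooth_on_\<Phi>(1)[OF pc[OF that]]]) (rule \<Phi>_eq(1)[OF pc[OF that]])
  have D2: "((\<lambda>t. cint (pc i) (\<lambda>p. \<rho> i p * ((Rt t p \<bullet> unit_normal A (Rt t) p) * norm (nrm (pc i) (Rt t) p)))) has_real_derivative
      cint (pc i) (\<lambda>p. \<rho> i p * ?d2 i p)) (at 0)" if "i < pn" for i
    by (rule Leibniz_chart[OF that smooth_on_\<Phi>(2)[OF pc[OF that]]]) (rule \<Phi>_eq(2)[OF pc[OF that]])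
  have "((\<lambda>t. energy M A a b e (Rt t)) has_real_derivative
      ((\<Sum>i<pn. cint (pc i) (\<lambda>p. \<rho> i p * ?d1 i p)) + e * (1 / 3 * (\<Sum>i<pn. cint (pc i) (\<lambda>p. \<rho> i p * ?d2 i p))))) (at 0)"
    unfolding energy_Rt by (intro DERIV_add DERIV_cmult DERIV_sum D1 D2) auto
  also have "(\<Sum>i<pn. cint (pc i) (\<lambda>p. \<rho> i p * ?d1 i p)) + e * (1 / 3 * (\<Sum>i<pn. cint (pc i) (\<lambda>p. \<rho> i p * ?d2 i p))) =
      (\<Sum>i<pn. cint (pc i) (\<lambda>p. \<rho> i p * ?d1 i p) + e / 3 * cint (pc i) (\<lambda>p. \<rho> i p * ?d2 i p))"
    by (simp add: sum.distrib sum_distrib_left)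
  also have "\<dots> = (\<Sum>i<pn. cint (pc i) (\<lambda>p. \<rho> i p * ?w i p) - cint (pc i) (\<lambda>p. \<rho> i p * ?X p * norm (nrm (pc i) R p)))"
  proof (rule sum.cong[OF refl])
    fix i assume "i \<in> {..<pn}"
    then have i: "i < pn" by simp
    note c = pc[OF i]
    have cd: "continuous_on (chart_image (pc i)) (\<lambda>x. dw HT \<Phi> (0, snd (pc i) (chart_inv (pc i) x)) (1, 0))"
      if "smooth_on (reg (pc i)) \<Phi>" for \<Phi> :: "_ \<Rightarrow> real"
    proof (rule continuous_on_eq)
      show "continuous_on (chart_image (pc i)) (\<lambda>x. dw HT \<Phi> (0, x) (1, 0))"
        by (rule continuous_on_compose2[OF smooth_on_continuous[OF smooth_on_dw[OF thick_HT openin_reg[OF c] that]]])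
          (auto intro!: continuous_intros reg_0[OF c])
    qed (simp add: chart_chart_inv)
    have I1: "(\<lambda>x. \<rho> i (chart_inv (pc i) x) * ?d1 i (chart_inv (pc i) x)) absolutely_integrable_on chart_image (pc i)"
      by (rule cint_integrable_\<rho>[OF i]) (rule cd[OF smooth_on_\<Phi>(1)[OF c]])
    have I2: "(\<lambda>x. \<rho> i (chart_inv (pc i) x) * ?d2 i (chart_inv (pc i) x)) absolutely_integrable_on chart_image (pc i)"
      by (rule cint_integrable_\<rho>[OF i]) (rule cd[OF smooth_on_\<Phi>(2)[OF c]])
    have I3: "(\<lambda>x. \<rho> i (chart_inv (pc i) x) * ?w i (chart_inv (pc i) x)) absolutely_integrable_on chart_image (pc i)"
      by (rule cint_integrable_\<rho>[OF i])
        (rule smooth_on_continuous[OF smooth_wedge[OF smooth_map_Pair[OF smooth_F smooth_G] smooth_map_Pair[OF smooth_R smooth_N] c]])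
    note int = set_lebesgue_integral_eq_integral(1)
    \<comment> \<open>Solved for the curvature term, so that its integral follows from the
      integrability of the other three.\<close>
    have eq: "\<rho> i p * ?X p * norm (nrm (pc i) R p) = \<rho> i p * ?w i p - (\<rho> i p * ?d1 i p + e / 3 * (\<rho> i p * ?d2 i p))"
      if "p \<in> fst (pc i)" for p
    proof -
      have "chart_inv (pc i) (snd (pc i) p) = p" by (rule chart_inv_chart[OF c that])
      with density_variation[OF c chart_in_image[OF that], of a b e]
      have "?w i p - (?d1 i p + e / 3 * ?d2 i p) = ?X p * norm (nrm (pc i) R p)" by simp
      then have "\<rho> i p * (?w i p - (?d1 i p + e / 3 * ?d2 i p)) = \<rho> i p * (?X p * norm (nrm (pc i) R p))" by simp
      then show ?thesis by (simp only: right_diff_distrib distrib_left mult.assoc mult.left_commute[of _ "e / 3"])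
    qed
    have "cint (pc i) (\<lambda>p. \<rho> i p * ?X p * norm (nrm (pc i) R p)) =
        cint (pc i) (\<lambda>p. \<rho> i p * ?w i p - (\<rho> i p * ?d1 i p + e / 3 * (\<rho> i p * ?d2 i p)))"
      by (rule cint_cong) (rule eq)
    also have "\<dots> = cint (pc i) (\<lambda>p. \<rho> i p * ?w i p) - (cint (pc i) (\<lambda>p. \<rho> i p * ?d1 i p) + e / 3 * cint (pc i) (\<lambda>p. \<rho> i p * ?d2 i p))"
      unfolding cint_def
      by (simp only: Henstock_Kurzweil_Integration.integral_diff Henstock_Kurzweil_Integration.integral_add
          Henstock_Kurzweil_Integration.integral_mult_right int[OF I1] int[OF I2] int[OF I3]
          integrable_add integrable_on_mult_right)
    finally show "cint (pc i) (\<lambda>p. \<rho> i p * ?d1 i p) + e / 3 * cint (pc i) (\<lambda>p. \<rho> i p * ?d2 i p) =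
        cint (pc i) (\<lambda>p. \<rho> i p * ?w i p) - cint (pc i) (\<lambda>p. \<rho> i p * ?X p * norm (nrm (pc i) R p))" by simp
  qed
  also have "\<dots> = (\<Sum>i<pn. cint (pc i) (\<lambda>p. \<rho> i p * ?w i p)) - surface_integral M A R ?X"
    by (simp add: sum_subtractf surface_integral_eq)
  also have "(\<Sum>i<pn. cint (pc i) (\<lambda>p. \<rho> i p * ?w i p)) =
      (\<Sum>i<pn. bint (pc i) (\<lambda>p. \<rho> i p * ((F a b e p, G a p) \<bullet> pd (pc i) 1 (\<lambda>q. (R q, N q)) p)))"
    by (rule Stokes[OF smooth_map_Pair[OF smooth_F smooth_G] smooth_map_Pair[OF smooth_R smooth_N]])
  also have "\<dots> = boundary_integral M A R (boundary_flux a b e)"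
    unfolding boundary_integral_eq
    by (intro sum.cong refl bint_cong) (simp add: boundary_flux[OF pc])
  finally show ?thesis by (simp add: algebra_simps)
qed

text \<open>The flux contains the gradient of the normal part, so \<open>V p = 0\<close> alone would
  not suffice; \<open>V\<close> vanishes on the open complement of \<open>K\<close>, and there its
  derivatives vanish too.\<close>

lemma boundary_flux_zero:
  assumes "closedin M K" "\<And>q. q \<in> topspace M - K \<Longrightarrow> V q = 0" "p \<in> topspace M - K"
  shows "boundary_flux a b e p = 0"
proof -
  have c: "chart_at A p \<in> A" "p \<in> fst (chart_at A p)" using chart_at[of p] assms(3) by auto
  let ?g = "surface_gradient A R (normal_part A R V) p" and ?c = "chart_at A p"
  have V: "V p = 0" using assms by blast
  have np: "normal_part A R V p = 0" "tangential_part A R V p = 0"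
    by (simp_all add: normal_part_def tangential_part_def V)
  have "coord_deriv ?c (normal_part A R V) p v = 0" for v
    by (rule coord_deriv_zero[OF c assms(1)]) (use assms in \<open>auto simp: normal_part_def\<close>)
  then have g: "?g \<bullet> coord_deriv ?c R p v = 0" for v
    by (simp add: surface_gradient(1)[OF smooth_normal_part c])
  have "?g = 0"
  proof (rule tangent_zero[OF nrm_R[OF c] _ g g])
    show "?g \<bullet> nrm ?c R p = 0"
      by (subst normal_frame(2)[OF smooth_R c nrm_R[OF c]]) (simp add: surface_gradient(2)[OF smooth_normal_part c])
  qed
  then show ?thesis by (simp add: boundary_flux_def np)
qed

lemma has_first_variation_energy:
  "has_first_variation (energy M A a b e) R V
     (- surface_integral M A R (\<lambda>p. (a * gauss_curvature A R p + 2 * b * mean_curvature A R p - e) * normal_part A R V p)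
      + boundary_integral M A R (boundary_flux a b e))"
  using energy_first_variation unfolding has_first_variation_def Rt_def .

text \<open>The support of \<open>V\<close> avoids the boundary, so the flux vanishes at each
  boundary point and only the interior integral survives.\<close>

lemma interior_variation:
  assumes "compactly_supported_in M V (surface_interior M A)"
  shows "has_first_variation (energy M A a b e) R V
     (- surface_integral M A R (\<lambda>p. (a * gauss_curvature A R p + 2 * b * mean_curvature A R p - e) * normal_part A R V p))"
    and "p \<in> surface_boundary M A \<Longrightarrow> normal_part A R V p = 0"
proof -
  obtain K where K: "compactin M K" "K \<subseteq> surface_interior M A" "\<And>q. q \<in> topspace M - K \<Longrightarrow> V q = 0"
    using assms unfolding compactly_supported_in_def by blast
  have nK: "p \<in> topspace M - K" if "p \<in> surface_boundary M A" for p
    using that K(2) unfolding surface_interior_def surface_boundary_def by blast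
  show "p \<in> surface_boundary M A \<Longrightarrow> normal_part A R V p = 0"
    using nK K(3) by (simp add: normal_part_def)
  have "boundary_integral M A R (boundary_flux a b e) = (\<Sum>i<pn. bint (pc i) (\<lambda>p. 0))"
    unfolding boundary_integral_eq
  proof (intro sum.cong refl bint_cong)
    fix i p assume "i \<in> {..<pn}" and p: "p \<in> fst (pc i)" "snd (pc i) p $ 2 = 0"
    then have "p \<in> surface_boundary M A"
      using pc[of i] chart_subset[OF pc, of i] by (auto simp: surface_boundary_def)
    then show "\<rho> i p * boundary_flux a b e p * norm (pd (pc i) 1 R p) = 0"
      using boundary_flux_zero[OF _ K(3) nK] K(1) compactin_closedin by simp
  qed
  then have "boundary_integral M A R (boundary_flux a b e) = 0" by (simp add: bint_def)
  then show "has_first_variation (energy M A a b e) R V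
     (- surface_integral M A R (\<lambda>p. (a * gauss_curvature A R p + 2 * b * mean_curvature A R p - e) * normal_part A R V p))"
    using has_first_variation_energy[of a b e] by simp
qed

end

section \<open>The equilibrium condition\<close>

context surface
begin

text \<open>A nonnegative continuous function on a box with vanishing integral is zero at every
  point of the box, its edges included, so boundary points of the chart are covered.\<close>

lemma cint_eq_0_imp:
  assumes c: "c \<in> A" and K: "compactin M K" "K \<subseteq> fst c"
    and f: "continuous_on (chart_image c) (\<lambda>x. f (chart_inv c x))" "\<And>p. p \<in> fst c - K \<Longrightarrow> f p = 0"
    and nonneg: "\<And>p. p \<in> fst c \<Longrightarrow> 0 \<le> f p" and zero: "cint c f = 0" and p: "p \<in> fst c"
  shows "f p = 0"
proof (cases "p \<in> K")
  case True
  let ?K = "snd c ` K" and ?U = "chart_image c" and ?f = "\<lambda>x. f (chart_inv c x)"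
  have K': "compact ?K" "?K \<subseteq> ?U" using compact_chart_image[OF c K(2)] K by (auto simp: chart_image_def)
  have z: "?f x = 0" if "x \<in> ?U - ?K" for x
  proof (rule f(2))
    have "chart_inv c x \<notin> K" using that chart_chart_inv[of x c] by (metis DiffD1 DiffD2 image_eqI)
    then show "chart_inv c x \<in> fst c - K" using that chart_inv_in[of x c] by blast
  qed
  obtain B where B: "B > 0" "?K \<subseteq> hbox B"
    by (rule compact_in_hbox[OF K'(1) subset_trans[OF K'(2) chart_image_subset[OF c]]]) (rule that)
  have cont: "continuous_on (hbox B) (zero_ext ?U ?f)"
    by (rule continuous_on_subset[OF continuous_on_zero_ext[OF surf(6)[OF c] K' f(1) z] hbox_subset])
  have "integral (hbox B) (zero_ext ?U ?f) = cint c f"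
    unfolding cint_def by (rule integral_zero_ext[symmetric]) (use B z in blast)
  then have "(zero_ext ?U ?f has_integral 0) (hbox B)"
    using integrable_integral[OF integrable_continuous[OF cont]] zero by simp
  then have "zero_ext ?U ?f (snd c p) = 0"
  proof (rule has_integral_0_cbox_imp_0[OF cont, rotated])
    show "0 \<le> zero_ext ?U ?f x" for x using nonneg[OF chart_inv_in[of x c]] by (simp add: zero_ext_def)
    show "box (vector [- B, 0]) (vector [B, B]) \<noteq> ({} :: (real^2) set)"
      using B(1) by (simp add: interval_ne_empty_cart forall_2)
    show "snd c p \<in> hbox B" using B(2) True by blast
  qed
  then show ?thesis using chart_in_image[OF p] by (simp add: zero_ext_def chart_inv_chart[OF c p])
qed (use f(2) p in blast)

end

context immersed_surface
begin

text \<open>Definite descriptions say nothing about continuity; it comes from expressing both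
  curvatures as triple products divided by \<open>norm (nrm c R p)\<close>.\<close>

lemma continuous_on_curvature:
  assumes c: "c \<in> A"
  shows "continuous_on (chart_image c)
    (\<lambda>x. a * gauss_curvature A R (chart_inv c x) + 2 * b * mean_curvature A R (chart_inv c x) - e)"
proof -
  let ?J = "\<lambda>x. norm (nrm c R (chart_inv c x))"
  let ?q = "\<lambda>x. chart_inv c x"
  have eq: "gauss_curvature A R p = inverse (norm (nrm c R p)) * (N p \<bullet> nrm c N p)"
    "2 * mean_curvature A R p = - (inverse (norm (nrm c R p)) * (N p \<bullet> (cross3 (pd c 1 N p) (pd c 2 R p) + cross3 (pd c 1 R p) (pd c 2 N p))))"
    if p: "p \<in> fst c" for p
  proof -
    note n = nrm_R[OF c p]
    have "N p \<bullet> nrm c R p = norm (nrm c R p)"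
      by (subst normal_frame(2)[OF smooth_R c p n]) (simp add: normal_frame(1)[OF smooth_R c p n])
    then show "gauss_curvature A R p = inverse (norm (nrm c R p)) * (N p \<bullet> nrm c N p)"
      "2 * mean_curvature A R p = - (inverse (norm (nrm c R p)) * (N p \<bullet> (cross3 (pd c 1 N p) (pd c 2 R p) + cross3 (pd c 1 R p) (pd c 2 N p))))"
      unfolding curvatures[OF smooth_R c p n] using n by simp_all
  qed
  have "continuous_on (chart_image c) (\<lambda>x. a * (inverse (?J x) * (N (?q x) \<bullet> nrm c N (?q x)))
      + b * (- (1) * (inverse (?J x) * (N (?q x) \<bullet> (cross3 (pd c 1 N (?q x)) (pd c 2 R (?q x)) + cross3 (pd c 1 R (?q x)) (pd c 2 N (?q x)))))) - e)"
  proof (rule smooth_on_continuous)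
    have J: "smooth_on (chart_image c) (\<lambda>x. inverse (?J x))"
      by (rule smooth_on_inverse, rule smooth_on_norm) 
        (rule smooth_on_cross3 smooth_on_coord_deriv smooth_R c | simp add: nrm_R[OF c chart_inv_in])+
    show "smooth_on (chart_image c) (\<lambda>x. a * (inverse (?J x) * (N (?q x) \<bullet> nrm c N (?q x)))
      + b * (- (1) * (inverse (?J x) * (N (?q x) \<bullet> (cross3 (pd c 1 N (?q x)) (pd c 2 R (?q x)) + cross3 (pd c 1 R (?q x)) (pd c 2 N (?q x)))))) - e)"
      by (rule J smooth_on_diff smooth_on_add smooth_on_mult smooth_on_inner smooth_on_cross3 smooth_on_const smooth_on_coord_deriv smooth_mapD smooth_R smooth_N c)+
  qed
  then show ?thesis
  proof (rule continuous_on_eq)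
    fix x assume "x \<in> chart_image c"
    from eq[OF chart_inv_in[OF this]]
    show "a * (inverse (?J x) * (N (?q x) \<bullet> nrm c N (?q x)))
      + b * (- (1) * (inverse (?J x) * (N (?q x) \<bullet> (cross3 (pd c 1 N (?q x)) (pd c 2 R (?q x)) + cross3 (pd c 1 R (?q x)) (pd c 2 N (?q x)))))) - e =
      a * gauss_curvature A R (?q x) + 2 * b * mean_curvature A R (?q x) - e"
      by (simp only: mult.assoc mult.left_commute[of 2 b] minus_mult_left[symmetric] mult_1)
  qed
qed

lemma chart_interior:
  assumes "c \<in> A" "p \<in> fst c"
  shows "p \<in> surface_interior M A \<longleftrightarrow> 0 < snd c p $ 2"
proof -
  have "p \<in> surface_boundary M A \<longleftrightarrow> snd c p $ 2 = 0"
    using assms chart_subset[OF assms(1)] boundary_chart_change[of _ c p] unfolding surface_boundary_def by blast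
  then show ?thesis
    using assms chart_subset[OF assms(1)] snd_in_half_plane[OF assms]
    unfolding surface_interior_def half_plane_def by auto
qed

text \<open>For necessity, let the condition fail at \<open>p\<close>, so that the defect
  \<open>g\<close> keeps its sign \<open>s\<close> nearby. For \<open>V = \<phi> N\<close> the first
  variation is minus the integral of \<open>g \<phi>\<close>; all chart contributions to
  \<open>s\<close> times this integral are nonnegative and add up to zero, so each is zero, although
  a chart with \<open>\<rho> i p \<noteq> 0\<close> has a positive integrand at
  \<open>p\<close>.\<close>

theorem linear_Weingarten:
  "(\<forall>V::'a \<Rightarrow> real^3. smooth_map A V \<and> compactly_supported_in M V (surface_interior M A) \<longrightarrow>
        has_first_variation (energy M A a b e) R V 0)
   \<longleftrightarrow> (\<forall>p\<in>surface_interior M A. a * gauss_curvature A R p + 2 * b * mean_curvature A R p = e)" (is "?L \<longleftrightarrow> ?R")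
proof
  assume W: ?R
  show ?L
  proof (intro allI impI, elim conjE)
    fix V :: "'a \<Rightarrow> real^3" assume V: "smooth_map A V" "compactly_supported_in M V (surface_interior M A)"
    interpret variation M A R V by unfold_locales (rule V)
    have "surface_integral M A R (\<lambda>p. (a * gauss_curvature A R p + 2 * b * mean_curvature A R p - e) * normal_part A R V p)
        = (\<Sum>i<pn. cint (pc i) (\<lambda>p. 0))"
      unfolding surface_integral_eq
    proof (intro sum.cong refl cint_cong)
      fix i p assume "i \<in> {..<pn}" "p \<in> fst (pc i)"
      then have p: "p \<in> topspace M" using chart_subset[OF pc] by blast
      have "(a * gauss_curvature A R p + 2 * b * mean_curvature A R p - e) * normal_part A R V p = 0"
      \<comment> \<open>The condition is assumed in the interior only; on the boundary the compact
        support makes the normal part vanish.\<close>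
      proof (cases "p \<in> surface_boundary M A")
        case True
        then show ?thesis using interior_variation(2)[OF V(2)] by simp
      next
        case False
        then show ?thesis using W p by (simp add: surface_interior_def)
      qed
      then show "\<rho> i p * ((a * gauss_curvature A R p + 2 * b * mean_curvature A R p - e) * normal_part A R V p)
          * norm (nrm (pc i) R p) = 0" by simp
    qed
    then show "has_first_variation (energy M A a b e) R V 0"
      using interior_variation(1)[OF V(2), of a b e] by (simp add: cint_def)
  qed
next
  assume L: ?L
  show ?R
  proof (rule ballI, rule ccontr)
    fix p assume pI: "p \<in> surface_interior M A" and ne: "a * gauss_curvature A R p + 2 * b * mean_curvature A R p \<noteq> e"
    define g where "g q = a * gauss_curvature A R q + 2 * b * mean_curvature A R q - e" for q
    define s where "s = sgn (g p)"
    have gp: "s * g p > 0" using ne by (simp add: s_def g_def sgn_mult_self_eq abs_sgn[symmetric] mult.commute[of "sgn _"])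
    have p: "p \<in> topspace M" using pI by (simp add: surface_interior_def)
    define c where "c = chart_at A p"
    have c: "c \<in> A" "p \<in> fst c" using chart_at[OF p] by (auto simp: c_def)
    have gc: "continuous_on (chart_image d) (\<lambda>x. g (chart_inv d x))" if "d \<in> A" for d
      unfolding g_def by (rule continuous_on_curvature[OF that])
    \<comment> \<open>Besides the persistent sign, a positive second coordinate is required, which
      keeps the support of \<open>\<phi>\<close> in the interior.\<close>
    define X where "X = chart_image c \<inter> (\<lambda>x. s * g (chart_inv c x)) -` {0<..} \<inter> {x. 0 < x $ 2}"
    have "openin (top_of_set (chart_image c)) (chart_image c \<inter> (\<lambda>x. s * g (chart_inv c x)) -` {0<..})"
      by (rule continuous_openin_preimage_gen) (auto intro!: continuous_intros gc[OF c(1)])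
    then have "openin (top_of_set half_plane) (chart_image c \<inter> (\<lambda>x. s * g (chart_inv c x)) -` {0<..})"
      by (rule openin_trans[OF _ surf(6)[OF c(1)]])
    then have X: "openin (top_of_set half_plane) X"
      unfolding X_def by (rule openin_Int_open) (rule open_halfspace_component_gt_cart)
    define O' where "O' = {q \<in> fst c. snd c q \<in> X}"
    have O': "openin M O'" unfolding O'_def by (rule openin_chart_preimage[OF c(1) X])
    have pO: "p \<in> O'"
      using c gp chart_interior[OF c] pI chart_in_image[OF c(2)] by (simp add: O'_def X_def chart_inv_chart)
    obtain \<phi> K where \<phi>: "smooth_map A \<phi>" "\<And>q. 0 \<le> \<phi> q" "compactin M K" "K \<subseteq> fst c \<inter> O'" "\<And>q. q \<notin> K \<Longrightarrow> \<phi> q = (0::real)" "\<phi> p > 0"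
      by (rule bump_function[OF c O' pO]) blast
    define V :: "'a \<Rightarrow> real^3" where "V q = \<phi> q *\<^sub>R N q" for q
    have V: "smooth_map A V" unfolding V_def by (rule smooth_map_scaleR[OF \<phi>(1) smooth_N])
    interpret variation M A R V by unfold_locales (rule V)
    have nv: "normal_part A R V q = \<phi> q" if "q \<in> topspace M" for q
    proof -
      have d: "chart_at A q \<in> A" "q \<in> fst (chart_at A q)" using chart_at[OF that] by auto
      show ?thesis using normal_frame(1)[OF smooth_R d nrm_R[OF d]] by (simp add: normal_part_def V_def)
    qed
    have "K \<subseteq> surface_interior M A"
    proof
      fix q assume "q \<in> K"
      then have "q \<in> fst c" "0 < snd c q $ 2" using \<phi>(4) by (auto simp: O'_def X_def)
      then show "q \<in> surface_interior M A" using chart_interior[OF c(1)] by blast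
    qed
    then have cs: "compactly_supported_in M V (surface_interior M A)"
      unfolding compactly_supported_in_def using \<phi>(3,5) by (intro exI[of _ K]) (auto simp: V_def)
    then have fv: "has_first_variation (energy M A a b e) R V 0" using L V by blast
    have I: "surface_integral M A R (\<lambda>q. g q * normal_part A R V q) = 0"
      using DERIV_unique[OF interior_variation(1)[OF cs, of a b e, unfolded has_first_variation_def] fv[unfolded has_first_variation_def]]
      by (simp add: g_def)
    define f where "f i q = \<rho> i q * (s * g q * \<phi> q) * norm (nrm (pc i) R q)" for i q
    have "(\<Sum>i<pn. cint (pc i) (f i)) = s * surface_integral M A R (\<lambda>q. g q * normal_part A R V q)"
      unfolding surface_integral_eq sum_distrib_left
    proof (intro sum.cong refl)
      fix i assume "i \<in> {..<pn}"
      then have i: "pc i \<in> A" using pc by blast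
      have "cint (pc i) (f i) = cint (pc i) (\<lambda>q. s * (\<rho> i q * (g q * normal_part A R V q) * norm (nrm (pc i) R q)))"
        by (rule cint_cong) (use nv chart_subset[OF i] in \<open>auto simp: f_def\<close>)
      then show "cint (pc i) (f i) = s * cint (pc i) (\<lambda>q. \<rho> i q * (g q * normal_part A R V q) * norm (nrm (pc i) R q))"
        by (simp add: cint_def)
    qed
    then have S0: "(\<Sum>i<pn. cint (pc i) (f i)) = 0" using I by simp
    have sg: "0 \<le> s * g q * \<phi> q" if "q \<in> topspace M" for q
    proof (cases "q \<in> K")
      case True
      then have "s * g q > 0" using \<phi>(4) by (auto simp: O'_def X_def chart_inv_chart[OF c(1)])
      then show ?thesis using \<phi>(2) by simp
    qed (simp add: \<phi>(5))
    have fn: "0 \<le> f i q" if "i < pn" "q \<in> fst (pc i)" for i q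
    proof -
      have "q \<in> topspace M" using that chart_subset[OF pc] by blast
      then show ?thesis unfolding f_def using \<rho>_nonneg[OF that(1)] sg by simp
    qed
    have fz: "f i q = 0" if "i < pn" "q \<in> fst (pc i) - supp i" for i q
    proof -
      have "q \<in> topspace M" using that chart_subset[OF pc] by blast
      then show ?thesis using that \<rho>_zero by (simp add: f_def)
    qed
    have fc: "continuous_on (chart_image (pc i)) (\<lambda>x. f i (chart_inv (pc i) x))" if i: "i < pn" for i
      unfolding f_def
      by (intro continuous_on_mult continuous_on_norm continuous_on_const gc[OF pc[OF i]]
          smooth_on_continuous[OF smooth_mapD[OF \<rho>_smooth[OF i] pc[OF i]]]
          smooth_on_continuous[OF smooth_mapD[OF \<phi>(1) pc[OF i]]]
          smooth_on_continuous[OF smooth_on_cross3[OF smooth_on_coord_deriv[OF smooth_R pc[OF i]] smooth_on_coord_deriv[OF smooth_R pc[OF i]]]])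
    have cn: "0 \<le> cint (pc i) (f i)" if i: "i < pn" for i
      unfolding cint_def
    proof (rule Henstock_Kurzweil_Integration.integral_nonneg)
      show "(\<lambda>x. f i (chart_inv (pc i) x)) integrable_on chart_image (pc i)"
        by (rule set_lebesgue_integral_eq_integral(1)[OF cint_absolutely_integrable[OF pc[OF i] compactin_supp supp_subset[OF i] fc[OF i] fz[OF i]]])
      show "0 \<le> f i (chart_inv (pc i) x)" if "x \<in> chart_image (pc i)" for x
        by (rule fn[OF i chart_inv_in[OF that]])
    qed
    \<comment> \<open>As the partition functions add up to 1, at least one of them does not vanish
      at \<open>p\<close>.\<close>
    have "(\<Sum>i<pn. \<rho> i p) = 1" by (rule sum_\<rho>[OF p])
    then obtain i where i: "i < pn" "\<rho> i p \<noteq> 0"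
      by (metis lessThan_iff sum.neutral zero_neq_one)
    have pi: "p \<in> fst (pc i)" using \<rho>_zero[OF p] i supp_subset by blast
    have c0: "cint (pc i) (f i) = 0"
      using S0 cn i(1) sum_nonneg_eq_0_iff[of "{..<pn}" "\<lambda>i. cint (pc i) (f i)"] by auto
    have "f i p = 0"
      by (rule cint_eq_0_imp[OF pc[OF i(1)] compactin_supp supp_subset[OF i(1)] fc[OF i(1)] fz[OF i(1)] fn[OF i(1)] c0 pi])
    then show False
      using i(2) gp \<phi>(6) nrm_R[OF pc[OF i(1)] pi] by (auto simp: f_def)
  qed
qed

end

theorem theorem6p5:
  fixes M :: "'a topology" and A :: "'a chart set" and R :: "'a \<Rightarrow> real^3" and a b c :: real
  assumes "compact_oriented_surface M A"
    and "smooth_immersion M A R"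
    and "has_curvature_line_coordinates M A R"
  shows
    "(\<forall>V::'a \<Rightarrow> real^3. smooth_map A V \<longrightarrow>
        (let N = unit_normal A R; H = mean_curvature A R; K = gauss_curvature A R;
             v = normal_part A R V; \<eta> = tangential_part A R V; \<t> = outward_conormal A R
         in has_first_variation (energy M A a b c) R V
              (- surface_integral M A R (\<lambda>p. (a * K p + 2 * b * H p - c) * v p)
               + boundary_integral M A R (\<lambda>p.
                   (a *\<^sub>R ((1/2) *\<^sub>R surface_gradient A R v p + H p *\<^sub>R \<eta> p) + b *\<^sub>R \<eta> p
                    + (c/3) *\<^sub>R ((R p \<bullet> N p) *\<^sub>R \<eta> p - v p *\<^sub>R R p)) \<bullet> \<t> p))))
     \<and> ((\<forall>V::'a \<Rightarrow> real^3.
            smooth_map A V \<and> compactly_supported_in M V (surface_interior M A) \<longrightarrow>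
            has_first_variation (energy M A a b c) R V 0)
        \<longleftrightarrow> (\<forall>p\<in>surface_interior M A.
               a * gauss_curvature A R p + 2 * b * mean_curvature A R p = c))"
proof -
  interpret immersed_surface M A R by unfold_locales (rule assms(1,2))+
  show ?thesis
  proof (intro conjI allI impI)
    fix V :: "'a \<Rightarrow> real^3" assume V: "smooth_map A V"
    interpret variation M A R V by unfold_locales (rule V)
    show "let N = unit_normal A R; H = mean_curvature A R; K = gauss_curvature A R;
             v = normal_part A R V; \<eta> = tangential_part A R V; \<t> = outward_conormal A R
         in has_first_variation (energy M A a b c) R V
              (- surface_integral M A R (\<lambda>p. (a * K p + 2 * b * H p - c) * v p)
               + boundary_integral M A R (\<lambda>p.
                   (a *\<^sub>R ((1/2) *\<^sub>R surface_gradient A R v p + H p *\<^sub>R \<eta> p) + b *\<^sub>R \<eta> p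
                    + (c/3) *\<^sub>R ((R p \<bullet> N p) *\<^sub>R \<eta> p - v p *\<^sub>R R p)) \<bullet> \<t> p))"
      using has_first_variation_energy[of a b c] unfolding Let_def boundary_flux_def[abs_def] .
  qed (rule linear_Weingarten)
qed

end
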